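(* Let $p\ge q>1$ and let $s$ be a real number with $$p-1<s,\qquad (n-q)s\le n(q-1).$$ Then any nonnegative weak solution $u\in W^{1,p}_{loc}(\mathbb{R}^n)\cap L^s_{loc}(\mathbb{R}^n)$ of $$\Delta_pu+\Delta_qu+u^s\le0\quad\text{in }\mathbb{R}^n$$ is equal to $0$ a.e. on $\mathbb{R}^n$, where $\mathbb{R}^n$ carries the flat metric.
   Context: $\Delta_zu=\mathrm{div}(|\nabla u|^{z-2}\nabla u)$ for $z\in\{p,q\}$. A function $u\in W^{1,p}_{loc}(\mathbb{R}^n)\cap L^s_{loc}(\mathbb{R}^n)$ is a nonnegative weak solution of $\Delta_pu+\Delta_qu+u^s\le0$ if $u\ge0$ and, for every $0\le\psi\in W^{1,p}(\mathbb{R}^n)\cap L^\infty(\mathbb{R}^n)$ with compact support, $$-\int_{\mathbb{R}^n}|\nabla u|^{p-2}\langle\nabla u,\nabla\psi\rangle\,dx-\int_{\mathbb{R}^n}|\nabla u|^{q-2}\langle\nabla u,\nabla\psi\rangle\,dx+\int_{\mathbb{R}^n}u^s\psi\,dx\le0.$$ *)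

theory Defs
  imports "HOL-Analysis.Analysis"
begin

text \<open>
  Elements of Lebesgue and Sobolev spaces are represented by functions rather than by classes of
  almost everywhere equal functions. Hence sign and support conditions on them are imposed up to
  null sets. The exponent \<open>r\<close> may be smaller than 1, as is needed for the integrability of
  a power \<open>u powr s\<close> with small \<open>s\<close>.
\<close>

definition Lp_space :: "real \<Rightarrow> ('a::euclidean_space \<Rightarrow> 'b::euclidean_space) set" where
  "Lp_space r = {f \<in> borel_measurable lebesgue. integrable lebesgue (\<lambda>x. norm (f x) powr r)}"

definition Lp_loc :: "real \<Rightarrow> ('a::euclidean_space \<Rightarrow> 'b::euclidean_space) set" where
  "Lp_loc r = {f \<in> borel_measurable lebesgue.
     \<forall>K. compact K \<longrightarrow> set_integrable lebesgue K (\<lambda>x. norm (f x) powr r)}"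

definition Linf_space :: "('a::euclidean_space \<Rightarrow> 'b::euclidean_space) set" where
  "Linf_space = {f \<in> borel_measurable lebesgue. \<exists>C. AE x in lebesgue. norm (f x) \<le> C}"

definition compact_ess_support :: "('a::euclidean_space \<Rightarrow> real) \<Rightarrow> bool" where
  "compact_ess_support f \<longleftrightarrow> (\<exists>K. compact K \<and> (AE x in lebesgue. x \<notin> K \<longrightarrow> f x = 0))"

fun C_k :: "nat \<Rightarrow> ('a::euclidean_space \<Rightarrow> real) \<Rightarrow> bool" where
  "C_k 0 f \<longleftrightarrow> continuous_on UNIV f"
| "C_k (Suc k) f \<longleftrightarrow> (\<forall>x. f differentiable (at x)) \<and>
     (\<forall>i\<in>Basis. C_k k (\<lambda>x. frechet_derivative f (at x) i))"

definition test_functions :: "('a::euclidean_space \<Rightarrow> real) set" where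
  "test_functions = {\<phi>. (\<forall>k. C_k k \<phi>) \<and> compact (closure {x. \<phi> x \<noteq> 0})}"

text \<open>
  The weak gradient is a relation, since it is determined only up to null sets.
\<close>

definition has_weak_gradient :: "('a::euclidean_space \<Rightarrow> real) \<Rightarrow> ('a \<Rightarrow> 'a) \<Rightarrow> bool" where
  "has_weak_gradient u G \<longleftrightarrow> u \<in> Lp_loc 1 \<and> G \<in> Lp_loc 1 \<and>
     (\<forall>\<phi>\<in>test_functions. \<forall>i\<in>Basis.
        (LINT x|lebesgue. u x * frechet_derivative \<phi> (at x) i) =
        - (LINT x|lebesgue. (G x \<bullet> i) * \<phi> x))"

definition W1p :: "real \<Rightarrow> ('a::euclidean_space \<Rightarrow> real) set" where
  "W1p p = {u \<in> Lp_space p. \<exists>G \<in> Lp_space p. has_weak_gradient u G}"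

definition W1p_loc :: "real \<Rightarrow> ('a::euclidean_space \<Rightarrow> real) set" where
  "W1p_loc p = {u \<in> Lp_loc p. \<exists>G \<in> Lp_loc p. has_weak_gradient u G}"

text \<open>
  Nonnegative weak solutions of \<open>\<Delta>\<^sub>p u + \<Delta>\<^sub>q u + u\<^sup>s \<le> 0\<close> on the whole space. The functions
  \<open>Gu\<close> and \<open>G\<psi>\<close> are arbitrary representatives of the weak gradients of \<open>u\<close> and \<open>\<psi>\<close>; the
  integrals do not depend on their choice. Where \<open>Gu x = 0\<close>, the field
  \<open>norm (Gu x) powr (p - 2) *\<^sub>R Gu x\<close> is 0 for every \<open>p > 1\<close>, as it should be, because
  \<open>0 powr a = 0\<close>.
\<close>

definition nonneg_weak_solution ::
    "real \<Rightarrow> real \<Rightarrow> real \<Rightarrow> ('a::euclidean_space \<Rightarrow> real) \<Rightarrow> bool" where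
  "nonneg_weak_solution p q s u \<longleftrightarrow>
     u \<in> W1p_loc p \<inter> Lp_loc s \<and> (AE x in lebesgue. 0 \<le> u x) \<and>
     (\<forall>\<psi> \<in> W1p p \<inter> Linf_space. \<forall>Gu G\<psi>.
        (AE x in lebesgue. 0 \<le> \<psi> x) \<longrightarrow> compact_ess_support \<psi> \<longrightarrow>
        has_weak_gradient u Gu \<longrightarrow> has_weak_gradient \<psi> G\<psi> \<longrightarrow>
        - (LINT x|lebesgue. norm (Gu x) powr (p - 2) * (Gu x \<bullet> G\<psi> x))
        - (LINT x|lebesgue. norm (Gu x) powr (q - 2) * (Gu x \<bullet> G\<psi> x))
        + (LINT x|lebesgue. u x powr s * \<psi> x) \<le> 0)"

end

theory Submission
  imports Defs "HOL-Computational_Algebra.Polynomial"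
begin

text \<open>
  Test the inequality with \<open>\<psi> = \<phi> ^ k * (u + \<delta>) powr (- t)\<close>. The term produced by differentiating
  the power of \<open>u\<close> absorbs the gradient of \<open>u\<close> by Young's inequality, and a second application of
  Young's inequality absorbs the remaining powers of \<open>u\<close> into the integral of \<open>u powr s * \<psi>\<close>. What
  is left is, for \<open>z \<in> {p, q}\<close>, an integral of a power of the gradient of \<open>\<phi>\<close> and a term that
  vanishes with \<open>\<delta>\<close>.

  Let \<open>\<phi>\<close> pass from 1 to 0 logarithmically between the radii \<open>exp N\<close> and \<open>exp (2 * N)\<close>, so that its
  gradient is at most \<open>4 / (N * bracket x)\<close>, and let \<open>t = 1 / N\<close>. In dimension \<open>n\<close>, the hypothesis on
  \<open>s\<close> makes \<open>bracket x powr (- n)\<close> the worst possible integrand, up to a constant; its integral over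
  the annulus is of order \<open>N\<close>, whereas the prefactor is \<open>N powr (- 1 - \<kappa>)\<close> with \<open>\<kappa> > 0\<close>. Thus the
  critical exponent needs no separate treatment, and \<open>N\<close> tending to infinity gives the result.
\<close>

section \<open>Smooth compactly supported mollifiers\<close>

text \<open>The exponent \<open>t = 1 / N\<close> is constrained from two sides. A fixed
  \<open>t\<close> would lose a power \<open>bracket x powr (z * t / (s - z + 1))\<close>, which is
  unbounded and not affordable at the critical exponent; on the annulus, where
  \<open>bracket x \<le> exp (2 * N)\<close>, the choice \<open>1 / N\<close> keeps it below a
  constant. In exchange, absorbing the gradient of \<open>u\<close> costs
  \<open>t powr (1 - z) = N powr (z - 1)\<close>, which the factor \<open>N powr (- z)\<close> from
  the cutoff outweighs by just \<open>1 / N\<close>. The second use of Young's inequality raises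
  this to the power \<open>(s - t) / (s - z + 1) = 1 + (z - 1 - t) / (s - z + 1)\<close>, and the
  excess over 1 is the source of \<open>\<kappa>\<close>.

  The shift \<open>\<delta>\<close> gives the negative power of \<open>u\<close> a bounded value and
  a bounded derivative, hence admissibility. It must tend to 0 before \<open>N\<close> tends to
  infinity, since its error term carries the volume of a ball of radius \<open>exp (2 * N)\<close>.

  Weak gradients are tested with smooth functions only, while the cutoff is merely continuously
  differentiable and \<open>u\<close> is rough. Mollification serves to prove the chain and product
  rules that give the weak gradient of \<open>\<psi>\<close>.\<close>

lemma C_k_SucI:
  assumes "\<And>x. (f has_derivative f' x) (at x)" and "\<And>i. i \<in> Basis \<Longrightarrow> C_k k (\<lambda>x. f' x i)"
  shows "C_k (Suc k) f"
proof -
  have "frechet_derivative f (at x) = f' x" for x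
    using assms(1) frechet_derivative_at by metis
  then show ?thesis
    using assms by (auto simp: differentiable_def)
qed

lemma C_k_Suc_has_derivative:
  "C_k (Suc k) f \<Longrightarrow> (f has_derivative frechet_derivative f (at x)) (at x)"
  by (simp add: frechet_derivative_works)

lemma C_k_Suc_D: "C_k (Suc k) f \<Longrightarrow> C_k k f"
proof (induction k arbitrary: f)
  case 0
  then show ?case
    by (auto intro!: differentiable_imp_continuous_on simp: differentiable_on_def
        intro: differentiable_at_withinI)
next
  case (Suc k)
  have "C_k k (\<lambda>x. frechet_derivative f (at x) i)" if "i \<in> Basis" for i
    using Suc.prems that by (intro Suc.IH) auto
  then show ?case using Suc.prems by auto
qed

lemma C_k_add: "C_k k f \<Longrightarrow> C_k k g \<Longrightarrow> C_k k (\<lambda>x. f x + g x)"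
proof (induction k arbitrary: f g)
  case 0
  then show ?case by (auto intro: continuous_intros)
next
  case (Suc k)
  show ?case
  proof (rule C_k_SucI)
    show "((\<lambda>x. f x + g x) has_derivative
        (\<lambda>h. frechet_derivative f (at x) h + frechet_derivative g (at x) h)) (at x)" for x
      using Suc.prems by (intro derivative_intros C_k_Suc_has_derivative)
  qed (use Suc in auto)
qed

lemma C_k_mult: "C_k k f \<Longrightarrow> C_k k g \<Longrightarrow> C_k k (\<lambda>x. f x * g x)"
proof (induction k arbitrary: f g)
  case 0
  then show ?case by (auto intro: continuous_intros)
next
  case (Suc k)
  show ?case
  proof (rule C_k_SucI)
    show "((\<lambda>x. f x * g x) has_derivative
        (\<lambda>h. f x * frechet_derivative g (at x) h + frechet_derivative f (at x) h * g x)) (at x)" for x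
      using Suc.prems by (intro derivative_intros C_k_Suc_has_derivative)
    show "C_k k (\<lambda>x. f x * frechet_derivative g (at x) i + frechet_derivative f (at x) i * g x)"
      if "i \<in> Basis" for i
      using Suc.prems that C_k_Suc_D[OF Suc.prems(1)] C_k_Suc_D[OF Suc.prems(2)]
      by (intro C_k_add Suc.IH) auto
  qed
qed

lemma C_k_const: "C_k k (\<lambda>x. c)"
proof (induction k arbitrary: c)
  case (Suc k)
  show ?case by (rule C_k_SucI[where f' = "\<lambda>x h. 0"]) (use Suc in auto)
qed auto

lemma C_k_prod:
  "finite A \<Longrightarrow> (\<And>a. a \<in> A \<Longrightarrow> C_k k (f a)) \<Longrightarrow> C_k k (\<lambda>x. \<Prod>a\<in>A. f a x)"
  by (induction A rule: finite_induct) (auto intro!: C_k_const C_k_mult)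

lemma C_k_translate: "C_k k f \<Longrightarrow> C_k k (\<lambda>y. f (y - x))"
proof (induction k arbitrary: f)
  case 0
  then show ?case by (auto intro!: continuous_intros intro: continuous_on_compose2)
next
  case (Suc k)
  show ?case
  proof (rule C_k_SucI)
    show "((\<lambda>y. f (y - x)) has_derivative (\<lambda>h. frechet_derivative f (at (y - x)) h)) (at y)" for y
      by (rule has_derivative_compose[where g = f, OF _ C_k_Suc_has_derivative[OF Suc.prems]])
         (auto intro!: derivative_eq_intros)
    show "C_k k (\<lambda>y. frechet_derivative f (at (y - x)) i)" if "i \<in> Basis" for i
      using Suc.prems that by (intro Suc.IH) auto
  qed
qed

text \<open>Differentiating along a basis vector turns \<open>D j\<close> into a multiple of
  \<open>D (Suc j)\<close>, so the induction runs over a whole sequence of derivatives with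
  \<open>j\<close> variable.\<close>

lemma C_k_inner:
  fixes v :: "'a::euclidean_space"
  assumes "\<And>k x. (D k has_real_derivative D (Suc k) x) (at x)"
  shows "C_k k (\<lambda>x. D j (x \<bullet> v + c))"
proof (induction k arbitrary: j)
  case 0
  have "continuous_on UNIV (D j)"
    using assms by (metis DERIV_isCont continuous_at_imp_continuous_on)
  then show ?case
    by (auto intro!: continuous_intros intro: continuous_on_compose2)
next
  case (Suc k)
  show ?case
  proof (rule C_k_SucI)
    show "((\<lambda>x. D j (x \<bullet> v + c)) has_derivative (\<lambda>h. (h \<bullet> v) * D (Suc j) (x \<bullet> v + c))) (at x)" for x
      by (rule has_derivative_compose[where g = "D j" and f = "\<lambda>x. x \<bullet> v + c", OF _ assms[unfolded has_field_derivative_def], THEN has_derivative_eq_rhs])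
         (auto intro!: derivative_eq_intros)
    show "C_k k (\<lambda>x. (i \<bullet> v) * D (Suc j) (x \<bullet> v + c))" for i
      by (intro C_k_mult C_k_const Suc.IH)
  qed
qed

text \<open>This family is closed under differentiation, so it provides all derivatives of \<open>exp (- 1 / x)\<close> at once.\<close>

definition flat :: "real poly \<Rightarrow> real \<Rightarrow> real" where
  "flat P x = (if x > 0 then poly P (1/x) / exp (1/x) else 0)"

lemma tendsto_poly_div_exp: "((\<lambda>x. poly P x / exp x) \<longlongrightarrow> (0::real)) at_top"
proof -
  have "((\<lambda>x. \<Sum>i\<le>degree P. coeff P i * (x ^ i / exp x)) \<longlongrightarrow> (\<Sum>i\<le>degree P. coeff P i * 0)) at_top"
    by (intro tendsto_intros tendsto_power_div_exp_0)
  then show ?thesis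
    by (simp add: poly_altdef sum_divide_distrib)
qed

text \<open>With \<open>y = 1 / x\<close>, the derivative of \<open>poly P y * exp (- y)\<close> in
  \<open>x\<close> is \<open>y * y * (poly P y - poly (pderiv P) y) * exp (- y)\<close>, which
  explains the new polynomial. At 0 the difference quotient from the right is a function of the same
  kind, for \<open>[:0,1:] * P\<close>, and the exponential beats every polynomial.\<close>

lemma flat_deriv: "(flat P has_real_derivative flat ([:0, 0, 1:] * (P - pderiv P)) x) (at x)"
proof -
  consider "x < 0" | "x = 0" | "x > 0" by linarith
  then show ?thesis
  proof cases
    case 1
    have "((\<lambda>x. 0) has_real_derivative 0) (at x)" by simp
    moreover have "eventually (\<lambda>y. y < 0) (nhds x)"
      using 1 by (intro order_tendstoD) (auto simp: filterlim_ident)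
    then have "eventually (\<lambda>y. 0 = flat P y) (nhds x)"
      by eventually_elim (auto simp: flat_def)
    ultimately have "(flat P has_real_derivative 0) (at x)"
      using DERIV_cong_ev[of x x "\<lambda>x. 0" "flat P" 0 0] by simp
    then show ?thesis using 1 by (simp add: flat_def)
  next
    case 3
    have i: "((\<lambda>x. 1 / x) has_real_derivative - 1 / x\<^sup>2) (at x)"
      using 3 by (auto intro!: derivative_eq_intros simp: power2_eq_square)
    have "((\<lambda>x. poly P (1/x) * exp (- (1/x))) has_real_derivative
        poly (pderiv P) (1/x) * (- 1 / x\<^sup>2) * exp (- (1/x)) +
        (exp (- (1/x)) * - (- 1 / x\<^sup>2)) * poly P (1/x)) (at x)"
      by (intro DERIV_mult DERIV_fun_exp DERIV_minus i DERIV_chain2[OF poly_DERIV i])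
    also have "poly (pderiv P) (1/x) * (- 1 / x\<^sup>2) * exp (- (1/x)) +
        (exp (- (1/x)) * - (- 1 / x\<^sup>2)) * poly P (1/x) = flat ([:0, 0, 1:] * (P - pderiv P)) x"
      using 3 by (simp add: flat_def exp_minus divide_inverse power2_eq_square algebra_simps)
    finally have "((\<lambda>x. poly P (1/x) / exp (1/x)) has_real_derivative
        flat ([:0, 0, 1:] * (P - pderiv P)) x) (at x)"
      unfolding exp_minus divide_inverse by simp
    moreover have "eventually (\<lambda>y. y > 0) (nhds x)"
      using 3 by (intro order_tendstoD) (auto simp: filterlim_ident)
    then have "eventually (\<lambda>y. poly P (1/y) / exp (1/y) = flat P y) (nhds x)"
      by eventually_elim (auto simp: flat_def)
    ultimately show ?thesis
      using DERIV_cong_ev[OF refl _ refl, of "\<lambda>y. poly P (1/y) / exp (1/y)" "flat P" x] by blast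
  next
    case 2
    have "((\<lambda>h. flat P h / h) \<longlongrightarrow> 0) (at 0)"
    proof (rule filterlim_split_at)
      have "eventually (\<lambda>h::real. h < 0) (at_left 0)" by (simp add: eventually_at_filter)
      then have "eventually (\<lambda>h. 0 = flat P h / h) (at_left 0)"
        by eventually_elim (simp add: flat_def)
      then show "((\<lambda>h. flat P h / h) \<longlongrightarrow> 0) (at_left 0)"
        by (rule Lim_transform_eventually[OF tendsto_const])
      have "((\<lambda>h::real. poly ([:0,1:] * P) (1/h) / exp (1/h)) \<longlongrightarrow> 0) (at_right 0)"
        by (rule filterlim_compose[OF tendsto_poly_div_exp filterlim_inverse_at_top_right,
            unfolded inverse_eq_divide])
      moreover have "eventually (\<lambda>h::real. h > 0) (at_right 0)" by (simp add: eventually_at_filter)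
      then have "eventually (\<lambda>h. poly ([:0,1:] * P) (1/h) / exp (1/h) = flat P h / h) (at_right 0)"
        by eventually_elim (simp add: flat_def)
      ultimately show "((\<lambda>h. flat P h / h) \<longlongrightarrow> 0) (at_right 0)"
        by (rule Lim_transform_eventually)
    qed
    then show ?thesis using 2 by (simp add: DERIV_def flat_def)
  qed
qed

definition flat_D :: "nat \<Rightarrow> real \<Rightarrow> real" where
  "flat_D k = flat (((\<lambda>P. [:0, 0, 1:] * (P - pderiv P)) ^^ k) 1)"

lemma flat_D_deriv: "(flat_D k has_real_derivative flat_D (Suc k) x) (at x)"
  unfolding flat_D_def using flat_deriv by simp

lemma flat_D_0: "flat_D 0 x = (if x > 0 then 1 / exp (1/x) else 0)"
  by (simp add: flat_D_def flat_def)

text \<open>Positive exactly on the open cube of half side \<open>e\<close>. With a product over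
  coordinates instead of a radial bump, smoothness follows from products and affine functionals
  alone.\<close>

definition box_bump :: "real \<Rightarrow> 'a::euclidean_space \<Rightarrow> real" where
  "box_bump e x = (\<Prod>i\<in>Basis. flat_D 0 (x \<bullet> i + e) * flat_D 0 (x \<bullet> (- i) + e))"

lemma C_k_box_bump: "C_k k (box_bump e)"
  unfolding box_bump_def[abs_def]
  by (intro C_k_prod C_k_mult C_k_inner flat_D_deriv) auto

lemma box_bump_nonneg: "0 \<le> box_bump e x"
  unfolding box_bump_def by (intro prod_nonneg mult_nonneg_nonneg) (auto simp: flat_D_0)

lemma box_bump_0_pos: "e > 0 \<Longrightarrow> 0 < box_bump e 0"
  unfolding box_bump_def by (intro prod_pos mult_pos_pos) (auto simp: flat_D_0)

text \<open>By \<open>norm_le_l1\<close>, a vector of norm at least \<open>DIM('a) * e\<close> has a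
  coordinate of modulus at least \<open>e\<close>, and the factor of that coordinate
  vanishes.\<close>

lemma box_bump_eq_0: 
  fixes x :: "'a::euclidean_space" and e :: real
  assumes "norm x \<ge> real DIM('a) * e" "e > 0"
  shows "box_bump e x = 0"
proof -
  have "\<exists>i\<in>Basis. \<bar>x \<bullet> i\<bar> \<ge> e"
  proof (rule ccontr)
    assume "\<not> ?thesis"
    then have "(\<Sum>i\<in>Basis. \<bar>x \<bullet> i\<bar>) < (\<Sum>i\<in>(Basis::'a set). e)"
      by (intro sum_strict_mono) auto
    then show False using norm_le_l1[of x] assms by simp
  qed
  then obtain i where i: "i \<in> Basis" "\<bar>x \<bullet> i\<bar> \<ge> e"
    by blast
  then have "x \<bullet> i + e \<le> 0 \<or> x \<bullet> (- i) + e \<le> 0"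
    unfolding inner_minus_right by linarith
  then have "flat_D 0 (x \<bullet> i + e) * flat_D 0 (x \<bullet> (- i) + e) = 0"
    by (elim disjE) (simp_all add: flat_D_0)
  then show ?thesis
    unfolding box_bump_def using i(1) finite_Basis by (meson prod_zero)
qed

definition mollifier :: "real \<Rightarrow> ('a::euclidean_space \<Rightarrow> real) \<Rightarrow> bool" where
  "mollifier e \<rho> \<longleftrightarrow> (\<forall>k. C_k k \<rho>) \<and> (\<forall>x. 0 \<le> \<rho> x) \<and> (\<forall>x. e \<le> norm x \<longrightarrow> \<rho> x = 0) \<and>
     integrable lborel \<rho> \<and> (\<integral>x. \<rho> x \<partial>lborel) = 1"

lemma mollifier_exists:
  assumes "e > 0"
  shows "\<exists>\<rho> :: 'a::euclidean_space \<Rightarrow> real. mollifier e \<rho>"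
proof -
  define d where "d = e / DIM('a)"
  have d: "d > 0" "DIM('a) * d = e" using assms by (auto simp: d_def)
  let ?b = "box_bump d :: 'a \<Rightarrow> real"
  have z: "?b x = 0" if "norm x \<ge> e" for x
    using box_bump_eq_0[of d x] d that by simp
  have cont: "continuous_on UNIV ?b" using C_k_box_bump[of 0 d] by simp
  have int: "integrable lborel ?b"
  proof -
    have "set_integrable lborel (cball 0 e) ?b"
      unfolding set_integrable_def
      by (rule borel_integrable_compact[OF compact_cball continuous_on_subset[OF cont subset_UNIV]])
    moreover have "(\<lambda>x. indicat_real (cball 0 e) x *\<^sub>R ?b x) = ?b"
      using z by (fastforce simp: indicator_def)
    ultimately show ?thesis unfolding set_integrable_def by simp
  qed
  define c where "c = (\<integral>x. ?b x \<partial>lborel)"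
  \<comment> \<open>The bump is continuous and positive at 0; a vanishing integral would make a
    nonempty open set negligible.\<close>
  have "c \<noteq> 0"
  proof
    assume "c = 0"
    then have "AE x in lborel. ?b x = 0"
      using integral_nonneg_eq_0_iff_AE[OF int] box_bump_nonneg by (auto simp: c_def)
    moreover have op: "open {x. ?b x \<noteq> 0}"
      using open_Collect_neq[OF cont continuous_on_const] .
    ultimately have "{x. ?b x \<noteq> 0} \<in> null_sets lborel"
      using AE_iff_null_sets[of "{x. ?b x \<noteq> 0}" lborel] by simp
    then have "negligible {x. ?b x \<noteq> 0}"
      by (simp add: negligible_iff_null_sets null_sets_completionI)
    then have "{x. ?b x \<noteq> 0} = {}"
      using open_not_negligible[OF op] by blast
    then show False using box_bump_0_pos[OF d(1), where 'a = 'a] by auto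
  qed
  moreover have "c \<ge> 0" unfolding c_def by (intro Bochner_Integration.integral_nonneg box_bump_nonneg)
  ultimately have c: "c > 0" by simp
  show ?thesis
    unfolding mollifier_def
  proof (intro exI[of _ "\<lambda>x. (1 / c) * ?b x"] conjI allI impI)
    show "C_k k (\<lambda>x. (1 / c) * ?b x)" for k
      by (intro C_k_mult C_k_const C_k_box_bump)
    show "0 \<le> (1 / c) * ?b x" for x
      using c box_bump_nonneg[of d x] by simp
    show "(1 / c) * ?b x = 0" if "norm x \<ge> e" for x
      using z[OF that] by simp
    show "integrable lborel (\<lambda>x. (1 / c) * ?b x)"
      using int by simp
    show "(\<integral>x. (1 / c) * ?b x \<partial>lborel) = 1"
      using c by (simp add: c_def)
  qed
qed

section \<open>Translation and mollification in \<open>L\<^sup>1\<close>\<close>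

lemma lborel_distr_translate: "distr lborel lborel (\<lambda>x. x + h) = (lborel :: 'a::euclidean_space measure)"
  using lborel_distr_plus[of h] by (simp add: add.commute[of h] distr_cong[of lborel lborel borel lborel])

lemma integrable_translate:
  fixes f :: "'a::euclidean_space \<Rightarrow> real"
  assumes "integrable lborel f"
  shows "integrable lborel (\<lambda>x. f (x + h))"
  using assms by (subst (asm) lborel_distr_translate[of h, symmetric], subst (asm) integrable_distr_eq) auto

lemma integral_translate:
  fixes f :: "'a::euclidean_space \<Rightarrow> real"
  assumes [measurable]: "f \<in> borel_measurable borel"
  shows "(\<integral>x. f (x + h) \<partial>lborel) = (\<integral>x. f x \<partial>lborel)"
  by (subst (2) lborel_distr_translate[of h, symmetric], subst integral_distr) auto

definition L1_shift :: "('a::euclidean_space \<Rightarrow> real) \<Rightarrow> 'a \<Rightarrow> real" where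
  "L1_shift f h = (\<integral>x. \<bar>f (x + h) - f x\<bar> \<partial>lborel)"

lemma L1_shift_nonneg: "0 \<le> L1_shift f h"
  unfolding L1_shift_def by simp

lemma L1_shift_add_le:
  assumes [simp]: "integrable lborel f" "integrable lborel g"
  shows "L1_shift (\<lambda>x. f x + g x) h \<le> L1_shift f h + L1_shift g h"
proof -
  note [simp] = integrable_translate
  have "L1_shift (\<lambda>x. f x + g x) h \<le> (\<integral>x. \<bar>f (x + h) - f x\<bar> + \<bar>g (x + h) - g x\<bar> \<partial>lborel)"
    unfolding L1_shift_def by (intro integral_mono) auto
  also have "\<dots> = L1_shift f h + L1_shift g h"
    unfolding L1_shift_def by (intro Bochner_Integration.integral_add) auto
  finally show ?thesis .
qed

lemma L1_shift_le:
  assumes [simp]: "integrable lborel f"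
  shows "L1_shift f h \<le> 2 * (\<integral>x. \<bar>f x\<bar> \<partial>lborel)"
proof -
  note [simp] = integrable_translate
  have "L1_shift f h \<le> (\<integral>x. \<bar>f (x + h)\<bar> + \<bar>f x\<bar> \<partial>lborel)"
    unfolding L1_shift_def by (intro integral_mono) auto
  also have "\<dots> = (\<integral>x. \<bar>f (x + h)\<bar> \<partial>lborel) + (\<integral>x. \<bar>f x\<bar> \<partial>lborel)"
    by (intro Bochner_Integration.integral_add) auto
  also have "(\<integral>x. \<bar>f (x + h)\<bar> \<partial>lborel) = (\<integral>x. \<bar>f x\<bar> \<partial>lborel)"
    using borel_measurable_integrable[OF assms(1)] by (intro integral_translate[of "\<lambda>x. \<bar>f x\<bar>"]) simp
  finally show ?thesis by simp
qed

lemma L1_shift_approx_le: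
  assumes "integrable lborel f" "integrable lborel g"
  shows "L1_shift f h \<le> L1_shift g h + 2 * (\<integral>x. \<bar>f x - g x\<bar> \<partial>lborel)"
  using L1_shift_add_le[of g "\<lambda>x. f x - g x" h] L1_shift_le[of "\<lambda>x. f x - g x" h] assms
  by simp

text \<open>Continuity of translations at 0 passes to limits in the L1 norm, because replacing
  \<open>f\<close> by \<open>g\<close> changes \<open>L1_shift\<close> by at most twice their
  distance, uniformly in \<open>h\<close>.\<close>

lemma tendsto_L1_shift_approx:
  assumes f: "integrable lborel f"
    and ap: "\<And>e. e > 0 \<Longrightarrow> \<exists>g. integrable lborel g \<and> (L1_shift g \<longlongrightarrow> 0) (at 0) \<and> (\<integral>x. \<bar>f x - g x\<bar> \<partial>lborel) < e"
  shows "(L1_shift f \<longlongrightarrow> 0) (at 0)"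
proof (rule tendstoI)
  fix e :: real assume "e > 0"
  then obtain g where g: "integrable lborel g" "(L1_shift g \<longlongrightarrow> 0) (at 0)" "(\<integral>x. \<bar>f x - g x\<bar> \<partial>lborel) < e / 4"
    using ap[of "e / 4"] by auto
  have "eventually (\<lambda>h. L1_shift g h < e / 2) (at 0)"
    using g(2) \<open>e > 0\<close> by (intro order_tendstoD) auto
  then show "eventually (\<lambda>h. dist (L1_shift f h) 0 < e) (at 0)"
  proof eventually_elim
    case (elim h)
    then show ?case
      using L1_shift_approx_le[OF f g(1), of h] g(3) L1_shift_nonneg[of f h] by (simp add: dist_real_def)
  qed
qed

text \<open>As \<open>U\<close> and its translates have equal measure, only the points that leave \<open>U\<close> matter; openness makes them disappear.\<close>

lemma tendsto_L1_shift_open: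
  fixes U :: "'a::euclidean_space set"
  assumes U: "open U" "emeasure lborel U < \<infinity>"
  shows "(L1_shift (indicat_real U) \<longlongrightarrow> 0) (at 0)"
proof -
  have iU [simp]: "integrable lborel (indicat_real U)" 
    using U by (intro integrable_real_indicator) auto
  have [measurable]: "U \<in> sets borel" using U by simp
  have "(\<lambda>n. L1_shift (indicat_real U) (S n)) \<longlonglongrightarrow> 0" if S: "S \<longlonglongrightarrow> 0" for S :: "nat \<Rightarrow> 'a"
  proof -
    note [simp] = integrable_translate
    have [simp]: "integrable lborel (\<lambda>x. max 0 (indicat_real U x - indicat_real U (x + h)))" for h
      by (intro integrable_max) auto
    have eq: "L1_shift (indicat_real U) h = 2 * (\<integral>x. max 0 (indicat_real U x - indicat_real U (x + h)) \<partial>lborel)" for h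
    proof -
      have "L1_shift (indicat_real U) h = (\<integral>x. (indicat_real U (x + h) - indicat_real U x) + 2 * max 0 (indicat_real U x - indicat_real U (x + h)) \<partial>lborel)"
        unfolding L1_shift_def by (intro Bochner_Integration.integral_cong) (auto simp: indicator_def)
      also have "\<dots> = (\<integral>x. indicat_real U (x + h) \<partial>lborel) - (\<integral>x. indicat_real U x \<partial>lborel) + 2 * (\<integral>x. max 0 (indicat_real U x - indicat_real U (x + h)) \<partial>lborel)"
        by (subst Bochner_Integration.integral_add; (subst Bochner_Integration.integral_diff)?; simp)
      finally show ?thesis
        using integral_translate[of "indicat_real U" h] by simp
    qed
    have "(\<lambda>n. \<integral>x. max 0 (indicat_real U x - indicat_real U (x + S n)) \<partial>lborel) \<longlonglongrightarrow> (\<integral>x. 0 \<partial>(lborel::'a measure))"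
    proof (rule integral_dominated_convergence[where w = "indicat_real U"])
      show "AE x in lborel. (\<lambda>n. max 0 (indicat_real U x - indicat_real U (x + S n))) \<longlonglongrightarrow> 0"
      proof (intro AE_I2)
        fix x :: 'a
        have "(\<lambda>n. x + S n) \<longlonglongrightarrow> x + 0" by (intro tendsto_intros S)
        then have "eventually (\<lambda>n. x \<in> U \<longrightarrow> x + S n \<in> U) sequentially"
          using topological_tendstoD[of "\<lambda>n. x + S n" "x + 0" sequentially U] U(1) by (cases "x \<in> U") auto
        then have "eventually (\<lambda>n. 0 = max 0 (indicat_real U x - indicat_real U (x + S n))) sequentially"
          by eventually_elim (auto simp: indicator_def)
        then show "(\<lambda>n. max 0 (indicat_real U x - indicat_real U (x + S n))) \<longlonglongrightarrow> 0"
          by (rule Lim_transform_eventually[OF tendsto_const])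
      qed
    qed (auto simp: indicator_def)
    then show ?thesis unfolding eq by (auto intro: tendsto_mult_right_zero)
  qed
  then show ?thesis
    using LIMSEQ_SEQ_conv[of "0::'a" "L1_shift (indicat_real U)" 0] by blast
qed

text \<open>Outer regularity reduces a Borel set of finite measure to an open one; multiples, sums
  and dominated limits of such indicators then give all integrable functions.\<close>

lemma tendsto_L1_shift:
  fixes f :: "'a::euclidean_space \<Rightarrow> real"
  assumes "integrable lborel f"
  shows "(L1_shift f \<longlongrightarrow> 0) (at 0)"
  using assms
proof (induction f rule: integrable_induct)
  case (base A c)
  have A: "A \<in> lmeasurable" "A \<in> sets borel"
    using base by (auto simp: fmeasurable_def)
  have iA [simp]: "integrable lborel (indicat_real A)"
    using base by (intro integrable_real_indicator) auto
  have "(L1_shift (indicat_real A) \<longlongrightarrow> 0) (at 0)"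
  proof (rule tendsto_L1_shift_approx)
    fix e :: real assume "e > 0"
    then obtain U where U: "open U" "A \<subseteq> U" "U - A \<in> lmeasurable" "emeasure lebesgue (U - A) < ennreal e"
      using sets_lebesgue_outer_open[of A e] A(1) by (metis fmeasurableD)
    have "U = A \<union> (U - A)" using U(2) by auto
    then have "U \<in> lmeasurable" using fmeasurable.Un[OF A(1) U(3)] by simp
    have [measurable]: "U \<in> sets borel" "A \<in> sets borel" using U A by auto
    have fin: "emeasure lborel U < \<infinity>" using \<open>U \<in> lmeasurable\<close> by (simp add: fmeasurable_def)
    then have iU [simp]: "integrable lborel (indicat_real U)" by (intro integrable_real_indicator) auto
    have "(\<integral>x. \<bar>indicat_real A x - indicat_real U x\<bar> \<partial>lborel) = (\<integral>x. indicat_real (U - A) x \<partial>lborel)"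
      using U(2) by (intro Bochner_Integration.integral_cong) (auto simp: indicator_def)
    also have "\<dots> = measure lborel (U - A)" by simp
    also have "\<dots> < e"
    proof -
      have "emeasure lborel (U - A) = ennreal (measure lborel (U - A))"
        using U(4) by (intro emeasure_eq_ennreal_measure) (auto simp: top_unique)
      then show ?thesis using U(4) by (simp add: ennreal_less_iff)
    qed
    finally show "\<exists>g. integrable lborel g \<and> (L1_shift g \<longlongrightarrow> 0) (at 0) \<and> (\<integral>x. \<bar>indicat_real A x - g x\<bar> \<partial>lborel) < e"
      using tendsto_L1_shift_open[OF U(1) fin] by (intro exI[of _ "indicat_real U"]) auto
  qed simp
  then have "((\<lambda>h. \<bar>c\<bar> * L1_shift (indicat_real A) h) \<longlongrightarrow> \<bar>c\<bar> * 0) (at 0)"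
    by (intro tendsto_intros)
  moreover have "L1_shift (\<lambda>x. indicat_real A x *\<^sub>R c) h = \<bar>c\<bar> * L1_shift (indicat_real A) h" for h
    unfolding L1_shift_def integral_mult_right_zero[symmetric]
    by (intro Bochner_Integration.integral_cong) (auto simp: indicator_def)
  ultimately show ?case by simp
next
  case (add f g)
  show ?case
  proof (rule tendsto_sandwich[OF _ _ tendsto_const])
    show "((\<lambda>h. L1_shift f h + L1_shift g h) \<longlongrightarrow> 0) (at 0)"
      using tendsto_add[OF add.IH] by simp
    show "eventually (\<lambda>h. L1_shift (\<lambda>x. f x + g x) h \<le> L1_shift f h + L1_shift g h) (at 0)"
      using L1_shift_add_le[OF add.hyps] by (intro always_eventually allI)
  qed (simp add: L1_shift_nonneg)
next
  case (lim f s)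
  note [measurable] = borel_measurable_integrable[OF lim.hyps(1)] borel_measurable_integrable[OF lim.hyps(4)]
  \<comment> \<open>The induction rule provides
    \<open>\<bar>s i x\<bar> \<le> 2 * \<bar>f x\<bar>\<close>, whence the majorant
    \<open>3 * \<bar>f x\<bar>\<close>.\<close>
  have "(\<lambda>i. \<integral>x. \<bar>f x - s i x\<bar> \<partial>lborel) \<longlonglongrightarrow> (\<integral>x. 0 \<partial>(lborel::'a measure))"
  proof (rule integral_dominated_convergence[where w = "\<lambda>x. 3 * \<bar>f x\<bar>"])
    show "AE x in lborel. (\<lambda>i. \<bar>f x - s i x\<bar>) \<longlonglongrightarrow> 0"
    proof (intro AE_I2)
      fix x
      have "(\<lambda>i. \<bar>f x - s i x\<bar>) \<longlonglongrightarrow> \<bar>f x - f x\<bar>"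
        using lim.hyps(2) by (intro tendsto_intros) auto
      then show "(\<lambda>i. \<bar>f x - s i x\<bar>) \<longlonglongrightarrow> 0" by simp
    qed
    show "AE x in lborel. norm \<bar>f x - s i x\<bar> \<le> 3 * \<bar>f x\<bar>" for i
    proof (intro AE_I2)
      fix x show "norm \<bar>f x - s i x\<bar> \<le> 3 * \<bar>f x\<bar>"
        using lim.hyps(3)[of x i] by simp
    qed
  qed (use lim.hyps(4) in simp_all)
  then have L: "(\<lambda>i. \<integral>x. \<bar>f x - s i x\<bar> \<partial>lborel) \<longlonglongrightarrow> 0" by simp
  show ?case
  proof (rule tendsto_L1_shift_approx[OF lim.hyps(4)])
    fix e :: real assume "e > 0"
    then have "eventually (\<lambda>i. (\<integral>x. \<bar>f x - s i x\<bar> \<partial>lborel) < e) sequentially"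
      using L by (intro order_tendstoD) auto
    then obtain i where "(\<integral>x. \<bar>f x - s i x\<bar> \<partial>lborel) < e"
      using eventually_happens'[OF sequentially_bot] by blast
    then show "\<exists>g. integrable lborel g \<and> (L1_shift g \<longlongrightarrow> 0) (at 0) \<and> (\<integral>x. \<bar>f x - g x\<bar> \<partial>lborel) < e"
      by (intro exI[of _ "s i"] conjI lim.hyps(1) lim.IH)
  qed
qed

text \<open>A correlation, not a convolution: the plus sign makes \<open>mollify \<rho> f\<close> an
  average of translates, matching \<open>L1_shift\<close>. In the equivalent form with the kernel
  \<open>\<rho> (y - x)\<close>, differentiation in \<open>x\<close> brings a minus sign that
  cancels the one in the definition of the weak derivative.\<close>

definition mollify :: "('a::euclidean_space \<Rightarrow> real) \<Rightarrow> ('a \<Rightarrow> real) \<Rightarrow> 'a \<Rightarrow> real" where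
  "mollify \<rho> f x = (\<integral>y. f (x + y) * \<rho> y \<partial>lborel)"

definition locally_integrable :: "('a::euclidean_space \<Rightarrow> real) \<Rightarrow> bool" where
  "locally_integrable f \<longleftrightarrow> f \<in> borel_measurable borel \<and> (\<forall>R. set_integrable lborel (cball 0 R) f)"

lemma mollifier_cont: "mollifier e \<rho> \<Longrightarrow> continuous_on UNIV \<rho>"
  unfolding mollifier_def by (metis C_k.simps(1))

lemma mollifier_measurable: "mollifier e \<rho> \<Longrightarrow> \<rho> \<in> borel_measurable borel"
  by (intro borel_measurable_continuous_onI mollifier_cont)

lemma bounded_if_vanishing:
  fixes f :: "'a::euclidean_space \<Rightarrow> real"
  assumes "continuous_on UNIV f" "\<And>x. R \<le> norm x \<Longrightarrow> f x = 0"
  obtains M where "M > 0" "\<And>x. \<bar>f x\<bar> \<le> M"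
proof -
  have "bounded (f ` cball 0 R)"
    by (intro compact_imp_bounded compact_continuous_image continuous_on_subset[OF assms(1)]) auto
  then obtain M where M: "M > 0" "\<And>x. x \<in> cball 0 R \<Longrightarrow> \<bar>f x\<bar> \<le> M"
    by (auto simp: bounded_pos)
  have "\<bar>f x\<bar> \<le> M" for x
    using M assms(2)[of x] by (cases "norm x \<le> R") auto
  then show ?thesis using that M(1) by blast
qed

lemma integrable_bounded_mult:
  fixes f g :: "'a \<Rightarrow> real"
  assumes "integrable M f" "g \<in> borel_measurable M" "\<And>x. \<bar>g x\<bar> \<le> B"
  shows "integrable M (\<lambda>x. f x * g x)"
proof (rule Bochner_Integration.integrable_bound[where f = "\<lambda>x. B * f x"])
  show "AE x in M. norm (f x * g x) \<le> norm (B * f x)"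
  proof (intro AE_I2)
    fix x
    have "\<bar>g x\<bar> \<le> \<bar>B\<bar>" using assms(3)[of x] by linarith
    then show "norm (f x * g x) \<le> norm (B * f x)"
      using mult_right_mono[of "\<bar>g x\<bar>" "\<bar>B\<bar>" "\<bar>f x\<bar>"] by (simp add: abs_mult mult.commute)
  qed
qed (use assms borel_measurable_integrable in auto)

lemma mollify_measurable [measurable]:
  assumes [measurable]: "f \<in> borel_measurable borel" "\<rho> \<in> borel_measurable borel"
  shows "mollify \<rho> f \<in> borel_measurable borel"
  unfolding mollify_def[abs_def] by measurable

text \<open>As \<open>\<rho>\<close> has integral 1, \<open>mollify \<rho> f x - f x\<close> is an
  average of \<open>f (x + y) - f x\<close>, and Tonelli exchanges the two integrals. The estimate
  is made for the nonnegative integral because the integrability of the difference is derived from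
  it.\<close>

lemma nn_integral_mollify_diff_le:
  fixes f :: "'a::euclidean_space \<Rightarrow> real"
  assumes f: "integrable lborel f" and \<rho>: "mollifier e \<rho>"
    and sh: "\<And>h. norm h < e \<Longrightarrow> L1_shift f h \<le> \<eta>"
  shows "(\<integral>\<^sup>+x. \<bar>mollify \<rho> f x - f x\<bar> \<partial>lborel) \<le> ennreal \<eta>"
proof -
  have \<rho>0: "0 \<le> \<rho> x" "norm x \<ge> e \<Longrightarrow> \<rho> x = 0" for x
    using \<rho> by (auto simp: mollifier_def)
  have \<rho>i: "integrable lborel \<rho>" "(\<integral>x. \<rho> x \<partial>lborel) = 1"
    using \<rho> by (auto simp: mollifier_def)
  note [measurable] = mollifier_measurable[OF \<rho>]
  have [measurable]: "f \<in> borel_measurable borel"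
    using borel_measurable_integrable[OF f] by simp
  obtain M where M: "\<And>x. \<bar>\<rho> x\<bar> \<le> M"
    using bounded_if_vanishing[OF mollifier_cont[OF \<rho>] \<rho>0(2)] by blast
  have "ennreal \<bar>mollify \<rho> f x - f x\<bar> \<le> (\<integral>\<^sup>+y. ennreal (\<bar>f (x + y) - f x\<bar> * \<rho> y) \<partial>lborel)" for x
  proof -
    have i: "integrable lborel (\<lambda>y. f (x + y) * \<rho> y)"
      using integrable_translate[OF f, of x] M
      by (intro integrable_bounded_mult[where B = M]) (auto simp: add.commute)
    have "mollify \<rho> f x - f x = (\<integral>y. f (x + y) * \<rho> y \<partial>lborel) - (\<integral>y. f x * \<rho> y \<partial>lborel)"
      using \<rho>i by (simp add: mollify_def)
    also have "\<dots> = (\<integral>y. (f (x + y) - f x) * \<rho> y \<partial>lborel)"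
      using i \<rho>i by (subst Bochner_Integration.integral_diff[symmetric]) (auto simp: left_diff_distrib)
    finally have "ennreal \<bar>mollify \<rho> f x - f x\<bar> \<le> (\<integral>\<^sup>+y. norm ((f (x + y) - f x) * \<rho> y) \<partial>lborel)"
      using integral_norm_bound_ennreal[of lborel "\<lambda>y. (f (x + y) - f x) * \<rho> y"] i \<rho>i
      by (simp add: left_diff_distrib)
    then show ?thesis using \<rho>0(1) by (simp add: abs_mult)
  qed
  then have "(\<integral>\<^sup>+x. \<bar>mollify \<rho> f x - f x\<bar> \<partial>lborel) \<le>
      (\<integral>\<^sup>+x. (\<integral>\<^sup>+y. ennreal (\<bar>f (x + y) - f x\<bar> * \<rho> y) \<partial>lborel) \<partial>lborel)"
    by (intro nn_integral_mono) auto
  also have "\<dots> = (\<integral>\<^sup>+y. (\<integral>\<^sup>+x. ennreal (\<bar>f (x + y) - f x\<bar> * \<rho> y) \<partial>lborel) \<partial>lborel)"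
    by (rule lborel_pair.Fubini') measurable
  also have "\<dots> \<le> (\<integral>\<^sup>+y. ennreal \<eta> * ennreal (\<rho> y) \<partial>lborel)"
  proof (intro nn_integral_mono)
    fix y :: 'a
    have "(\<integral>\<^sup>+x. ennreal (\<bar>f (x + y) - f x\<bar> * \<rho> y) \<partial>lborel) = (\<integral>\<^sup>+x. ennreal \<bar>f (x + y) - f x\<bar> \<partial>lborel) * ennreal (\<rho> y)"
      using \<rho>0 by (simp add: ennreal_mult' nn_integral_multc)
    also have "(\<integral>\<^sup>+x. ennreal \<bar>f (x + y) - f x\<bar> \<partial>lborel) = ennreal (L1_shift f y)"
      unfolding L1_shift_def using f integrable_translate[OF f] by (intro nn_integral_eq_integral) auto
    also have "ennreal (L1_shift f y) * ennreal (\<rho> y) \<le> ennreal \<eta> * ennreal (\<rho> y)"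
      using \<rho>0(2)[of y] sh[of y] by (cases "norm y < e") (auto intro: mult_right_mono ennreal_leI)
    finally show "(\<integral>\<^sup>+x. ennreal (\<bar>f (x + y) - f x\<bar> * \<rho> y) \<partial>lborel) \<le> ennreal \<eta> * ennreal (\<rho> y)" .
  qed
  also have "\<dots> = ennreal \<eta>"
    using \<rho>i \<rho>0 nn_integral_eq_integral[of lborel \<rho>] by (simp add: nn_integral_cmult)
  finally show ?thesis .
qed

lemma integral_mollify_diff_le:
  fixes f :: "'a::euclidean_space \<Rightarrow> real"
  assumes f: "integrable lborel f" and \<rho>: "mollifier e \<rho>" and "0 \<le> \<eta>"
    and sh: "\<And>h. norm h < e \<Longrightarrow> L1_shift f h \<le> \<eta>"
  shows "(\<integral>x. \<bar>mollify \<rho> f x - f x\<bar> \<partial>lborel) \<le> \<eta>"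
proof -
  note [measurable] = mollifier_measurable[OF \<rho>]
  have [measurable]: "f \<in> borel_measurable borel"
    using borel_measurable_integrable[OF f] by simp
  show ?thesis
    using nn_integral_mollify_diff_le[OF f \<rho> sh] \<open>0 \<le> \<eta>\<close>
    by (subst integral_eq_nn_integral) (auto intro!: enn2real_leI)
qed

lemma integrable_mollify_diff:
  fixes f :: "'a::euclidean_space \<Rightarrow> real"
  assumes f: "integrable lborel f" and \<rho>: "mollifier e \<rho>"
  shows "integrable lborel (\<lambda>x. mollify \<rho> f x - f x)"
proof -
  note [measurable] = mollifier_measurable[OF \<rho>]
  have [measurable]: "f \<in> borel_measurable borel"
    using borel_measurable_integrable[OF f] by simp
  show ?thesis
    using nn_integral_mollify_diff_le[OF f \<rho> L1_shift_le[OF f]]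
    by (intro integrableI_bounded) (auto intro: le_less_trans ennreal_less_top)
qed

lemma mollify_tendsto_L1:
  fixes f :: "'a::euclidean_space \<Rightarrow> real"
  assumes f: "integrable lborel f" and \<rho>: "\<And>n. mollifier (1 / real (Suc n)) (\<rho> n)"
  shows "(\<lambda>n. \<integral>x. \<bar>mollify (\<rho> n) f x - f x\<bar> \<partial>lborel) \<longlonglongrightarrow> 0"
proof (rule LIMSEQ_I)
  fix r :: real assume "r > 0"
  then have "eventually (\<lambda>h. L1_shift f h < r / 2) (at 0)"
    using tendsto_L1_shift[OF f] by (intro order_tendstoD) auto
  then obtain d where d: "d > 0" "\<And>h. h \<noteq> 0 \<Longrightarrow> norm h < d \<Longrightarrow> L1_shift f h < r / 2"
    unfolding eventually_at by (auto simp: dist_norm)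
  have d': "L1_shift f h \<le> r / 2" if "norm h < d" for h
    using d(2)[of h] that \<open>r > 0\<close> by (cases "h = 0") (auto simp: L1_shift_def)
  obtain N where N: "1 / real (Suc N) < d"
    using nat_approx_posE[OF d(1)] by auto
  show "\<exists>no. \<forall>n\<ge>no. norm ((\<integral>x. \<bar>mollify (\<rho> n) f x - f x\<bar> \<partial>lborel) - 0) < r"
  proof (intro exI allI impI)
    fix n assume "n \<ge> N"
    then have "1 / real (Suc n) \<le> 1 / real (Suc N)"
      by (intro divide_left_mono) auto
    then have "(\<integral>x. \<bar>mollify (\<rho> n) f x - f x\<bar> \<partial>lborel) \<le> r / 2"
      using N d' \<open>r > 0\<close> by (intro integral_mollify_diff_le[OF f \<rho>]) auto
    then show "norm ((\<integral>x. \<bar>mollify (\<rho> n) f x - f x\<bar> \<partial>lborel) - 0) < r"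
      using \<open>r > 0\<close> by simp
  qed
qed

text \<open>Reduces locally integrable functions to integrable ones: mollification at
  \<open>x\<close> sees only values at distance below \<open>e \<le> 1\<close>.\<close>

lemma mollify_local:
  fixes f :: "'a::euclidean_space \<Rightarrow> real"
  assumes \<rho>: "mollifier e \<rho>" and "e \<le> 1" "norm x \<le> R"
  shows "mollify \<rho> f x = mollify \<rho> (\<lambda>y. indicat_real (cball 0 (R + 1)) y * f y) x"
  unfolding mollify_def
proof (intro Bochner_Integration.integral_cong refl)
  fix y :: 'a
  have "\<rho> y = 0 \<or> norm (x + y) \<le> R + 1"
    using assms norm_triangle_ineq[of x y] by (cases "norm y \<ge> e") (auto simp: mollifier_def)
  then show "f (x + y) * \<rho> y = indicat_real (cball 0 (R + 1)) (x + y) * f (x + y) * \<rho> y"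
    by (auto simp: indicator_def)
qed

lemma mollify_tendsto_L1_loc:
  fixes f :: "'a::euclidean_space \<Rightarrow> real"
  assumes f: "locally_integrable f" and \<rho>: "\<And>n. mollifier (1 / real (Suc n)) (\<rho> n)"
  shows "integrable lborel (\<lambda>x. indicat_real (cball 0 R) x * (mollify (\<rho> n) f x - f x))" (is ?A)
    and "(\<lambda>n. \<integral>x. \<bar>indicat_real (cball 0 R) x * (mollify (\<rho> n) f x - f x)\<bar> \<partial>lborel) \<longlonglongrightarrow> 0" (is ?B)
proof -
  let ?g = "\<lambda>y. indicat_real (cball 0 (R + 1)) y * f y"
  have g: "integrable lborel ?g"
    using f unfolding locally_integrable_def set_integrable_def by simp
  have eq: "indicat_real (cball 0 R) x * (mollify (\<rho> n) f x - f x) =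
      indicat_real (cball 0 R) x * (mollify (\<rho> n) ?g x - ?g x)" for n x
  proof (cases "norm x \<le> R")
    case True
    then show ?thesis using mollify_local[OF \<rho> _ True, of n f] by simp
  qed simp
  have int: "integrable lborel (\<lambda>x. indicat_real (cball 0 R) x * (mollify (\<rho> n) ?g x - ?g x))" for n
    by (intro integrable_mult_indicator[where 'b = real, simplified] integrable_mollify_diff[OF g \<rho>]) auto
  then show ?A unfolding eq .
  have "(\<integral>x. \<bar>indicat_real (cball 0 R) x * (mollify (\<rho> n) ?g x - ?g x)\<bar> \<partial>lborel) \<le>
      (\<integral>x. \<bar>mollify (\<rho> n) ?g x - ?g x\<bar> \<partial>lborel)" for n
    by (intro integral_mono integrable_abs int integrable_mollify_diff[OF g \<rho>]) (auto simp: indicator_def)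
  then show ?B unfolding eq
    by (intro tendsto_sandwich[OF _ _ tendsto_const mollify_tendsto_L1[OF g \<rho>]]) auto
qed

section \<open>Derivatives of mollified functions\<close>

text \<open>A derivative along one direction only: weak gradients are tested componentwise, so
  mollified functions can be treated one coordinate at a time.\<close>

definition has_dir_deriv :: "('a::euclidean_space \<Rightarrow> real) \<Rightarrow> ('a \<Rightarrow> real) \<Rightarrow> 'a \<Rightarrow> bool" where
  "has_dir_deriv w w' i \<longleftrightarrow> (\<forall>x. ((\<lambda>t. w (x + t *\<^sub>R i)) has_real_derivative w' x) (at 0))"

lemma has_dir_deriv_shift:
  assumes "has_dir_deriv w w' i"
  shows "((\<lambda>t. w (x + t *\<^sub>R i)) has_real_derivative w' (x + s *\<^sub>R i)) (at s)"
proof -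
  have "((\<lambda>t. w ((x + s *\<^sub>R i) + t *\<^sub>R i)) has_real_derivative w' (x + s *\<^sub>R i)) (at (s - s))"
    using assms by (simp add: has_dir_deriv_def)
  moreover have "(\<lambda>t. w ((x + s *\<^sub>R i) + (t - s) *\<^sub>R i)) = (\<lambda>t. w (x + t *\<^sub>R i))"
    by (simp add: algebra_simps)
  ultimately show ?thesis
    using DERIV_shift[of "\<lambda>t. w ((x + s *\<^sub>R i) + (t - s) *\<^sub>R i)" "w' (x + s *\<^sub>R i)" 0 s]
    by (simp add: add.commute)
qed

lemma has_dir_deriv_lipschitz:
  assumes "has_dir_deriv w w' i" "\<And>x. \<bar>w' x\<bar> \<le> M"
  shows "\<bar>w (x + t *\<^sub>R i) - w x\<bar> \<le> M * \<bar>t\<bar>"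
  using field_differentiable_bound[of UNIV "\<lambda>t. w (x + t *\<^sub>R i)" "\<lambda>t. w' (x + t *\<^sub>R i)" M t 0]
    has_dir_deriv_shift[OF assms(1), of x] assms(2) by simp

lemma has_dir_deriv_quotient_tendsto:
  assumes "has_dir_deriv w w' i"
  shows "(\<lambda>n. (w (x + (1 / real (Suc n)) *\<^sub>R i) - w x) / (1 / real (Suc n))) \<longlonglongrightarrow> w' x"
proof -
  have "((\<lambda>t. (w (x + t *\<^sub>R i) - w x) / t) \<longlongrightarrow> w' x) (at 0)"
    using assms by (simp add: has_dir_deriv_def DERIV_def)
  moreover have "filterlim (\<lambda>n. 1 / real (Suc n)) (at 0) sequentially"
    using LIMSEQ_Suc[OF lim_1_over_n] by (auto simp: filterlim_at)
  ultimately show ?thesis by (rule filterlim_compose)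
qed

text \<open>The difference quotients integrate to 0 by translation invariance, and they converge
  boundedly on a fixed ball. This replaces Fubini and the fundamental theorem of calculus.\<close>

lemma integral_dir_deriv_eq_0:
  fixes w :: "'a::euclidean_space \<Rightarrow> real"
  assumes d: "has_dir_deriv w w' i" and M: "\<And>x. \<bar>w' x\<bar> \<le> M"
    and w: "integrable lborel w" and [measurable]: "w' \<in> borel_measurable borel"
    and z: "\<And>x. R \<le> norm x \<Longrightarrow> w x = 0"
  shows "(\<integral>x. w' x \<partial>lborel) = 0"
proof -
  have [measurable]: "w \<in> borel_measurable borel"
    using borel_measurable_integrable[OF w] by simp
  let ?q = "\<lambda>n x. (w (x + (1 / real (Suc n)) *\<^sub>R i) - w x) / (1 / real (Suc n))"
  \<comment> \<open>The step \<open>1 / real (Suc n)\<close> is at most 1, so the translates of the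
    support used here all stay in this ball.\<close>
  let ?K = "cball 0 (R + norm i) :: 'a set"
  have "(\<lambda>n. \<integral>x. ?q n x \<partial>lborel) \<longlonglongrightarrow> (\<integral>x. w' x \<partial>lborel)"
  proof (rule integral_dominated_convergence[where w = "\<lambda>x. M * indicat_real ?K x"])
    show "AE x in lborel. norm (?q n x) \<le> M * indicat_real ?K x" for n
    proof (intro AE_I2)
      fix x
      show "norm (?q n x) \<le> M * indicat_real ?K x"
      proof (cases "x \<in> ?K")
        case True
        then show ?thesis
          using has_dir_deriv_lipschitz[OF d M, of x "1 / real (Suc n)"]
          by (subst norm_divide, subst pos_divide_le_eq) auto
      next
        case False
        then have x: "norm x > R + norm i" by simp
        have "norm x \<le> norm (x + (1 / real (Suc n)) *\<^sub>R i) + norm ((1 / real (Suc n)) *\<^sub>R i)"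
          using norm_triangle_ineq4[of "x + (1 / real (Suc n)) *\<^sub>R i" "(1 / real (Suc n)) *\<^sub>R i"] by simp
        also have "norm ((1 / real (Suc n)) *\<^sub>R i) \<le> norm i"
          using mult_right_mono[of "1 / real (Suc n)" 1 "norm i"] by (simp del: of_nat_Suc)
        finally have "w (x + (1 / real (Suc n)) *\<^sub>R i) = 0"
          using x by (intro z) simp
        moreover have "w x = 0"
          using x by (intro z) (smt (verit) norm_ge_zero)
        ultimately show ?thesis using False by simp
      qed
    qed
    show "integrable lborel (\<lambda>x. M * indicat_real ?K x)"
      by (intro integrable_mult_right integrable_real_indicator emeasure_bounded_finite) auto
  qed (use has_dir_deriv_quotient_tendsto[OF d] in \<open>auto intro!: AE_I2\<close>)
  moreover have "(\<integral>x. ?q n x \<partial>lborel) = 0" for n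
    using w integrable_translate[OF w] integral_translate[of w] by simp
  ultimately have "(\<lambda>n. 0) \<longlonglongrightarrow> (\<integral>x. w' x \<partial>lborel)" by simp
  then show ?thesis by (simp add: LIMSEQ_const_iff)
qed

lemma has_derivative_imp_dir_deriv:
  assumes "\<And>x. (f has_derivative f' x) (at x)"
  shows "has_dir_deriv f (\<lambda>x. f' x i) i"
  unfolding has_dir_deriv_def
proof
  fix x
  interpret bounded_linear "f' x" using assms has_derivative_bounded_linear by blast
  have "((\<lambda>t. f (x + t *\<^sub>R i)) has_derivative (\<lambda>t. f' x (t *\<^sub>R i))) (at 0)"
    by (rule has_derivative_compose[where g = f and f = "\<lambda>t. x + t *\<^sub>R i"])
       (use assms[of x] in \<open>auto intro!: derivative_eq_intros\<close>)
  then show "((\<lambda>t. f (x + t *\<^sub>R i)) has_real_derivative f' x i) (at 0)"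
    by (simp add: has_field_derivative_def scaleR mult.commute[of _ "f' x i"])
qed

lemma has_dir_deriv_vanishing:
  assumes "has_dir_deriv f f' i" "\<And>x. R \<le> norm x \<Longrightarrow> f x = 0" "R < norm x"
  shows "f' x = 0"
proof -
  have "((\<lambda>t. norm (x + t *\<^sub>R i)) \<longlongrightarrow> norm (x + 0 *\<^sub>R i)) (nhds 0)"
    by (intro tendsto_intros filterlim_ident)
  then have "eventually (\<lambda>t. R < norm (x + t *\<^sub>R i)) (nhds 0)"
    using assms(3) by (intro order_tendstoD) auto
  then have "eventually (\<lambda>t. f (x + t *\<^sub>R i) = 0) (nhds 0)"
    by eventually_elim (use assms(2) in auto)
  then have "((\<lambda>t. f (x + t *\<^sub>R i)) has_real_derivative 0) (at 0)"
    by (subst DERIV_cong_ev[OF refl _ refl]) auto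
  then show ?thesis
    using assms(1) DERIV_unique unfolding has_dir_deriv_def by blast
qed

text \<open>One component of \<open>has_weak_gradient\<close>, for Borel functions and over
  \<open>lborel\<close>, where translation and Fubini are at hand;
  \<open>has_weak_gradient_borel_iff\<close> links the two notions.\<close>

definition weak_dir_deriv :: "('a::euclidean_space \<Rightarrow> real) \<Rightarrow> ('a \<Rightarrow> real) \<Rightarrow> 'a \<Rightarrow> bool" where
  "weak_dir_deriv f g i \<longleftrightarrow> locally_integrable f \<and> locally_integrable g \<and>
     (\<forall>\<phi>\<in>test_functions. (\<integral>x. f x * frechet_derivative \<phi> (at x) i \<partial>lborel) = - (\<integral>x. g x * \<phi> x \<partial>lborel))"

lemma test_functions_support:
  assumes "\<phi> \<in> test_functions"
  obtains R where "\<And>x. R \<le> norm x \<Longrightarrow> \<phi> x = 0" "R > 0"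
proof -
  have "bounded (closure {x. \<phi> x \<noteq> 0})"
    using assms by (simp add: test_functions_def compact_imp_bounded)
  then obtain B where "B > 0" "\<And>x. x \<in> closure {x. \<phi> x \<noteq> 0} \<Longrightarrow> norm x \<le> B"
    by (auto simp: bounded_pos)
  then have "\<phi> x = 0" if "B + 1 \<le> norm x" for x
    using that closure_subset[of "{x. \<phi> x \<noteq> 0}"] by force
  then show ?thesis using that \<open>B > 0\<close> by (metis add_pos_pos zero_less_one)
qed

lemma test_functionsI:
  assumes "\<And>k. C_k k \<phi>" "\<And>x. R \<le> norm x \<Longrightarrow> \<phi> x = 0"
  shows "\<phi> \<in> test_functions"
proof -
  have "{x. \<phi> x \<noteq> 0} \<subseteq> cball 0 R" using assms(2) by (force simp: not_le[symmetric])
  then have "bounded {x. \<phi> x \<noteq> 0}" using bounded_subset bounded_cball by blast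
  then show ?thesis using assms(1) by (auto simp: test_functions_def compact_closure)
qed

lemma test_functions_dir_deriv:
  assumes "\<phi> \<in> test_functions"
  shows "has_dir_deriv \<phi> (\<lambda>x. frechet_derivative \<phi> (at x) i) i"
proof (rule has_derivative_imp_dir_deriv)
  have "C_k (Suc 0) \<phi>" using assms unfolding test_functions_def by blast
  then show "(\<phi> has_derivative frechet_derivative \<phi> (at x)) (at x)" for x
    by (rule C_k_Suc_has_derivative)
qed

lemma test_functions_continuous:
  assumes "\<phi> \<in> test_functions" "i \<in> Basis"
  shows "continuous_on UNIV \<phi>" "continuous_on UNIV (\<lambda>x. frechet_derivative \<phi> (at x) i)"
proof -
  have *: "C_k k \<phi>" for k using assms unfolding test_functions_def by blast
  from *[of 0] show "continuous_on UNIV \<phi>" by simp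
  from *[of "Suc 0"] assms(2) show "continuous_on UNIV (\<lambda>x. frechet_derivative \<phi> (at x) i)" by simp
qed

lemma locally_integrable_mult:
  assumes f: "locally_integrable f" and [measurable]: "g \<in> borel_measurable borel" 
    and B: "\<And>x. \<bar>g x\<bar> \<le> B" and z: "\<And>x. R < norm x \<Longrightarrow> g x = 0"
  shows "integrable lborel (\<lambda>x. f x * g x)"
proof -
  have "integrable lborel (\<lambda>x. (indicat_real (cball 0 R) x * f x) * g x)"
    using f B unfolding locally_integrable_def set_integrable_def
    by (intro integrable_bounded_mult[where B = B and f = "\<lambda>x. indicat_real (cball 0 R) x * f x"]) auto
  moreover have "(indicat_real (cball 0 R) x * f x) * g x = f x * g x" for x
    using z[of x] by (auto simp: indicator_def not_le)
  ultimately show ?thesis by simp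
qed

lemma mollifier_translate_test:
  fixes \<rho> :: "'a::euclidean_space \<Rightarrow> real"
  assumes \<rho>: "mollifier e \<rho>"
  shows "(\<lambda>y. \<rho> (y - x)) \<in> test_functions"
proof (rule test_functionsI)
  show "C_k k (\<lambda>y. \<rho> (y - x))" for k
    using \<rho> by (intro C_k_translate) (auto simp: mollifier_def)
  show "\<rho> (y - x) = 0" if "e + norm x \<le> norm y" for y
    using \<rho> that norm_triangle_ineq2[of y x] by (auto simp: mollifier_def)
qed

lemma mollify_altdef:
  assumes [measurable]: "f \<in> borel_measurable borel" "\<rho> \<in> borel_measurable borel"
  shows "mollify \<rho> f x = (\<integral>y. f y * \<rho> (y - x) \<partial>lborel)"
  using integral_translate[of "\<lambda>y. f y * \<rho> (y - x)" x] by (simp add: mollify_def add.commute)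

text \<open>The difference quotient in \<open>x\<close> falls on the kernel
  \<open>\<lambda>y. \<rho> (y - x)\<close>, which is itself a test function; the limit is the weak
  derivative tested against that kernel.\<close>

lemma has_dir_deriv_mollify:
  fixes f :: "'a::euclidean_space \<Rightarrow> real"
  assumes w: "weak_dir_deriv f g i" and \<rho>: "mollifier e \<rho>" and i: "i \<in> Basis"
  shows "has_dir_deriv (mollify \<rho> f) (mollify \<rho> g) i"
  unfolding has_dir_deriv_def
proof
  fix x :: 'a
  have f: "locally_integrable f" and g: "locally_integrable g"
    using w by (auto simp: weak_dir_deriv_def)
  have [measurable]: "f \<in> borel_measurable borel" "g \<in> borel_measurable borel" "\<rho> \<in> borel_measurable borel"
    using f g mollifier_measurable[OF \<rho>] by (auto simp: locally_integrable_def)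
  let ?\<phi> = "\<lambda>y. \<rho> (y - x)"
  let ?\<phi>' = "\<lambda>y. frechet_derivative ?\<phi> (at y) i"
  have \<phi>: "?\<phi> \<in> test_functions" using mollifier_translate_test[OF \<rho>] .
  note dd = test_functions_dir_deriv[OF \<phi>, of i]
  obtain R where R: "\<And>y. R \<le> norm y \<Longrightarrow> ?\<phi> y = 0" "R > 0"
    using test_functions_support[OF \<phi>] by blast
  have R': "?\<phi>' y = 0" if "R + 1 \<le> norm y" for y
    using has_dir_deriv_vanishing[OF dd R(1)] that by simp
  obtain M where M: "M > 0" "\<And>y. \<bar>?\<phi>' y\<bar> \<le> M"
    using bounded_if_vanishing[OF test_functions_continuous(2)[OF \<phi> i] R'] by blast
  have c\<phi>: "continuous_on UNIV ?\<phi>" using test_functions_continuous(1)[OF \<phi> i] .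
  obtain M0 where M0: "\<And>y. \<bar>?\<phi> y\<bar> \<le> M0"
    using bounded_if_vanishing[OF c\<phi> R(1)] by blast
  \<comment> \<open>Moving \<open>x\<close> by \<open>t\<close> along \<open>i\<close> moves the
    argument of \<open>?\<phi>\<close> by \<open>- t\<close> along \<open>i\<close>, hence the
    sign.\<close>
  let ?q = "\<lambda>t y. f y * ((?\<phi> (y + (- t) *\<^sub>R i) - ?\<phi> y) / t)"
  have [measurable]: "?\<phi> \<in> borel_measurable borel"
    by measurable
  have int: "integrable lborel (\<lambda>y. f y * \<rho> (y - (x + t *\<^sub>R i)))" for t
  proof (rule locally_integrable_mult[OF f, where B = M0 and R = "R + norm (t *\<^sub>R i)"])
    show "\<bar>\<rho> (y - (x + t *\<^sub>R i))\<bar> \<le> M0" for y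
      using M0[of "y - t *\<^sub>R i"] by (simp add: algebra_simps)
    show "\<rho> (y - (x + t *\<^sub>R i)) = 0" if "R + norm (t *\<^sub>R i) < norm y" for y
      using R(1)[of "y - t *\<^sub>R i"] norm_triangle_ineq2[of y "t *\<^sub>R i"] that by (simp add: algebra_simps)
  qed measurable
  have quot: "(mollify \<rho> f (x + t *\<^sub>R i) - mollify \<rho> f x) / t = (\<integral>y. ?q t y \<partial>lborel)" for t
  proof -
    have "(mollify \<rho> f (x + t *\<^sub>R i) - mollify \<rho> f x) / t =
        (\<integral>y. f y * \<rho> (y - (x + t *\<^sub>R i)) - f y * \<rho> (y - x) \<partial>lborel) / t"
      using int[of t] int[of 0] by (simp add: mollify_altdef Bochner_Integration.integral_diff)
    also have "\<dots> = (\<integral>y. ?q t y \<partial>lborel)"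
      unfolding integral_divide_zero[symmetric]
      by (intro Bochner_Integration.integral_cong) (auto simp: algebra_simps diff_divide_distrib)
    finally show ?thesis .
  qed
  have lim: "(\<lambda>n. \<integral>y. ?q (S n) y \<partial>lborel) \<longlonglongrightarrow> (\<integral>y. f y * (- ?\<phi>' y) \<partial>lborel)"
    if S: "\<And>n. S n \<noteq> 0" "S \<longlonglongrightarrow> 0" for S :: "nat \<Rightarrow> real"
  proof -
    \<comment> \<open>A convergent sequence of steps is bounded, which keeps all the shifted
      supports in one ball.\<close>
    obtain T where T: "\<And>n. \<bar>S n\<bar> \<le> T"
      using convergent_imp_Bseq[OF convergentI[OF S(2)]] by (auto simp: Bseq_def)
    let ?r = "R + T * norm i"
    show ?thesis
    proof (rule integral_dominated_convergence[where w = "\<lambda>y. M * \<bar>indicat_real (cball 0 ?r) y * f y\<bar>"])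
      show "(\<lambda>y. f y * - ?\<phi>' y) \<in> borel_measurable lborel"
        using borel_measurable_continuous_onI[OF test_functions_continuous(2)[OF \<phi> i]] by simp
      show "integrable lborel (\<lambda>y. M * \<bar>indicat_real (cball 0 ?r) y * f y\<bar>)"
        using f unfolding locally_integrable_def set_integrable_def by auto
      show "AE y in lborel. (\<lambda>n. ?q (S n) y) \<longlonglongrightarrow> f y * - ?\<phi>' y"
      proof (intro AE_I2 tendsto_intros)
        fix y
        have "((\<lambda>t. (?\<phi> (y + t *\<^sub>R i) - ?\<phi> y) / t) \<longlongrightarrow> ?\<phi>' y) (at 0)"
          using dd by (simp add: has_dir_deriv_def DERIV_def)
        moreover have "filterlim (\<lambda>n. - S n) (at 0) sequentially"
          using S tendsto_minus[OF S(2)] by (simp add: filterlim_at)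
        ultimately have "(\<lambda>n. - ((?\<phi> (y + (- S n) *\<^sub>R i) - ?\<phi> y) / (- S n))) \<longlonglongrightarrow> - ?\<phi>' y"
          by (intro tendsto_minus) (rule filterlim_compose)
        then show "(\<lambda>n. (?\<phi> (y + (- S n) *\<^sub>R i) - ?\<phi> y) / S n) \<longlonglongrightarrow> - ?\<phi>' y"
          by simp
      qed
      show "AE y in lborel. norm (?q (S n) y) \<le> M * \<bar>indicat_real (cball 0 ?r) y * f y\<bar>" for n
      proof (intro AE_I2)
        fix y
        show "norm (?q (S n) y) \<le> M * \<bar>indicat_real (cball 0 ?r) y * f y\<bar>"
        proof (cases "norm y \<le> ?r")
          case True
          have "\<bar>?\<phi> (y + (- S n) *\<^sub>R i) - ?\<phi> y\<bar> / \<bar>S n\<bar> \<le> M"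
            using has_dir_deriv_lipschitz[OF dd M(2), of y "- S n"] S(1)[of n] by (simp add: divide_le_eq)
          then have "\<bar>f y\<bar> * (\<bar>?\<phi> (y + (- S n) *\<^sub>R i) - ?\<phi> y\<bar> / \<bar>S n\<bar>) \<le> \<bar>f y\<bar> * M"
            by (intro mult_left_mono) auto
          then show ?thesis using True by (simp add: abs_mult mult.commute)
        next
          case False
          have "norm (S n *\<^sub>R i) \<le> T * norm i" using T by (simp add: mult_right_mono)
          moreover have "0 \<le> T * norm i" using T[of 0] by simp
          ultimately have "R \<le> norm (y + (- S n) *\<^sub>R i)" "R \<le> norm y"
            using False norm_triangle_ineq2[of y "S n *\<^sub>R i"] by (auto simp: not_le)
          then have "?\<phi> (y + (- S n) *\<^sub>R i) = 0" "?\<phi> y = 0" using R(1) by blast+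
          then show ?thesis using M by simp
        qed
      qed
    qed measurable
  qed
  have "(\<integral>y. f y * (- ?\<phi>' y) \<partial>lborel) = (\<integral>y. g y * ?\<phi> y \<partial>lborel)"
    using w \<phi> by (simp add: weak_dir_deriv_def)
  also have "\<dots> = mollify \<rho> g x" by (simp add: mollify_altdef)
  finally have "((\<lambda>t. (mollify \<rho> f (x + t *\<^sub>R i) - mollify \<rho> f x) / t) \<longlongrightarrow> mollify \<rho> g x) (at 0)"
    unfolding quot
    by (intro LIMSEQ_SEQ_conv[THEN iffD1] allI impI) (use lim in auto)
  then show "((\<lambda>t. mollify \<rho> f (x + t *\<^sub>R i)) has_real_derivative mollify \<rho> g x) (at 0)"
    by (simp add: DERIV_def)
qed

section \<open>The chain rule for weak gradients\<close>

lemma mollify_bounded: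
  fixes f :: "'a::euclidean_space \<Rightarrow> real"
  assumes f: "locally_integrable f" and \<rho>: "mollifier e \<rho>" and "e \<le> 1"
  obtains B where "B \<ge> 0" "\<And>x. norm x \<le> R \<Longrightarrow> \<bar>mollify \<rho> f x\<bar> \<le> B"
proof -
  let ?g = "\<lambda>y. indicat_real (cball 0 (R + 1)) y * f y"
  have g: "integrable lborel ?g"
    using f unfolding locally_integrable_def set_integrable_def by simp
  have \<rho>0: "\<And>x. norm x \<ge> e \<Longrightarrow> \<rho> x = 0" using \<rho> by (auto simp: mollifier_def)
  obtain M where M: "M > 0" "\<And>x. \<bar>\<rho> x\<bar> \<le> M"
    using bounded_if_vanishing[OF mollifier_cont[OF \<rho>] \<rho>0] by blast
  have "\<bar>mollify \<rho> f x\<bar> \<le> M * (\<integral>y. \<bar>?g y\<bar> \<partial>lborel)" if x: "norm x \<le> R" for x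
  proof -
    have gx: "integrable lborel (\<lambda>y. ?g (x + y))"
      using integrable_translate[OF g, of x] by (simp add: add.commute)
    have "\<bar>mollify \<rho> ?g x\<bar> \<le> (\<integral>y. \<bar>?g (x + y) * \<rho> y\<bar> \<partial>lborel)"
      unfolding mollify_def by (rule integral_abs_bound)
    also have "\<dots> \<le> (\<integral>y. M * \<bar>?g (x + y)\<bar> \<partial>lborel)"
    proof (intro integral_mono integrable_abs integrable_mult_right gx)
      show "integrable lborel (\<lambda>y. ?g (x + y) * \<rho> y)"
        using mollifier_measurable[OF \<rho>] M(2) by (intro integrable_bounded_mult[OF gx]) auto
      show "\<bar>?g (x + y) * \<rho> y\<bar> \<le> M * \<bar>?g (x + y)\<bar>" for y
        using mult_right_mono[OF M(2)[of y], of "\<bar>?g (x + y)\<bar>"] by (simp add: abs_mult mult.commute)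
    qed
    also have "\<dots> = M * (\<integral>y. \<bar>?g (y + x)\<bar> \<partial>lborel)"
      by (simp add: add.commute)
    also have "(\<integral>y. \<bar>?g (y + x)\<bar> \<partial>lborel) = (\<integral>y. \<bar>?g y\<bar> \<partial>lborel)"
      using borel_measurable_integrable[OF g] by (intro integral_translate[of "\<lambda>y. \<bar>?g y\<bar>"]) simp
    finally show ?thesis
      using mollify_local[OF \<rho> \<open>e \<le> 1\<close> x, of f] by simp
  qed
  moreover have "0 \<le> M * (\<integral>y. \<bar>?g y\<bar> \<partial>lborel)"
    using M(1) by (intro mult_nonneg_nonneg Bochner_Integration.integral_nonneg) auto
  ultimately show ?thesis using that by blast
qed

lemma locally_integrable_const: "locally_integrable (\<lambda>_. c)"
  unfolding locally_integrable_def set_integrable_def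
  by (simp add: integrable_real_indicator emeasure_bounded_finite[OF bounded_cball, unfolded infinity_ennreal_def])

lemma integrable_vanishing:
  fixes g :: "'a::euclidean_space \<Rightarrow> real"
  assumes "g \<in> borel_measurable borel" "\<And>x. \<bar>g x\<bar> \<le> B" "\<And>x. R < norm x \<Longrightarrow> g x = 0"
  shows "integrable lborel g"
  using locally_integrable_mult[OF locally_integrable_const[of 1] assms] by simp

text \<open>For mollified functions the chain rule is classical:
  \<open>g (mollify \<rho> f x) * \<zeta> x\<close> has compact support and a bounded directional
  derivative, whose integral is therefore 0. Since \<open>f\<close> and \<open>\<rho>\<close> are
  nonnegative, the mollified values stay in the half line on which \<open>g\<close> is
  controlled.\<close>

lemma integral_dir_deriv_mollified:
  fixes f :: "'a::euclidean_space \<Rightarrow> real"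
  assumes w: "weak_dir_deriv f h i" and i: "i \<in> Basis" and f0: "\<And>x. 0 \<le> f x"
    and \<rho>: "mollifier e \<rho>" and "e \<le> 1"
    and [measurable]: "g \<in> borel_measurable borel" "g' \<in> borel_measurable borel"
    and g: "\<And>v. 0 \<le> v \<Longrightarrow> (g has_real_derivative g' v) (at v)"
    and B: "\<And>v. 0 \<le> v \<Longrightarrow> \<bar>g v\<bar> \<le> B" "\<And>v. 0 \<le> v \<Longrightarrow> \<bar>g' v\<bar> \<le> B"
    and \<zeta>: "has_dir_deriv \<zeta> \<zeta>' i" "continuous_on UNIV \<zeta>" "continuous_on UNIV \<zeta>'"
    and R: "\<And>x. R \<le> norm x \<Longrightarrow> \<zeta> x = 0"
  shows "(\<integral>x. g (mollify \<rho> f x) * \<zeta>' x \<partial>lborel) = - (\<integral>x. g' (mollify \<rho> f x) * mollify \<rho> h x * \<zeta> x \<partial>lborel)"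
proof -
  have lf: "locally_integrable f" and lh: "locally_integrable h"
    using w by (auto simp: weak_dir_deriv_def)
  have [measurable]: "f \<in> borel_measurable borel" "h \<in> borel_measurable borel" "\<rho> \<in> borel_measurable borel"
    "\<zeta> \<in> borel_measurable borel" "\<zeta>' \<in> borel_measurable borel"
    using lf lh mollifier_measurable[OF \<rho>] \<zeta> by (auto simp: locally_integrable_def intro: borel_measurable_continuous_onI)
  let ?u = "mollify \<rho> f" and ?h = "mollify \<rho> h"
  have u0: "0 \<le> ?u x" for x
    unfolding mollify_def using f0 \<rho> by (intro Bochner_Integration.integral_nonneg) (auto simp: mollifier_def)
  have R': "\<zeta>' x = 0" if "R < norm x" for x
    using has_dir_deriv_vanishing[OF \<zeta>(1) R that] by simp
  then have R'': "\<zeta>' x = 0" if "R + 1 \<le> norm x" for x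
    using that by simp
  obtain Z where Z: "Z > 0" "\<And>x. \<bar>\<zeta> x\<bar> \<le> Z"
    using bounded_if_vanishing[OF \<zeta>(2) R] by blast
  obtain Z' where Z': "Z' > 0" "\<And>x. \<bar>\<zeta>' x\<bar> \<le> Z'"
    using bounded_if_vanishing[OF \<zeta>(3), of "R + 1"] R'' by blast
  obtain H where H: "H \<ge> 0" "\<And>x. norm x \<le> R \<Longrightarrow> \<bar>?h x\<bar> \<le> H"
    using mollify_bounded[OF lh \<rho> \<open>e \<le> 1\<close>] by blast
  have B0: "0 \<le> B" using B(1)[of 0] by linarith
  have b1: "\<bar>g (?u x) * \<zeta>' x\<bar> \<le> B * Z'" for x
    unfolding abs_mult using B(1)[OF u0] Z' B0 by (intro mult_mono) auto
  have b2: "\<bar>g' (?u x) * ?h x * \<zeta> x\<bar> \<le> B * H * Z" for x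
  proof (cases "norm x \<le> R")
    case True
    then show ?thesis
      unfolding abs_mult using B(2)[OF u0] Z H B0 by (intro mult_mono mult_nonneg_nonneg) auto
  next
    case False
    then show ?thesis using R[of x] B0 H Z by simp
  qed
  have i1: "integrable lborel (\<lambda>x. g (?u x) * \<zeta>' x)"
    by (rule integrable_vanishing[OF _ b1, where R = R]) (use R' in auto)
  have i2: "integrable lborel (\<lambda>x. g' (?u x) * ?h x * \<zeta> x)"
    by (rule integrable_vanishing[OF _ b2, where R = R]) (use R in auto)
  have "(\<integral>x. g' (?u x) * ?h x * \<zeta> x + g (?u x) * \<zeta>' x \<partial>lborel) = 0"
  proof (rule integral_dir_deriv_eq_0[where w = "\<lambda>x. g (?u x) * \<zeta> x"])
    show "has_dir_deriv (\<lambda>x. g (?u x) * \<zeta> x) (\<lambda>x. g' (?u x) * ?h x * \<zeta> x + g (?u x) * \<zeta>' x) i"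
      unfolding has_dir_deriv_def
    proof
      fix x
      have 1: "((\<lambda>t. ?u (x + t *\<^sub>R i)) has_real_derivative ?h x) (at 0)"
        using has_dir_deriv_mollify[OF w \<rho> i] by (simp add: has_dir_deriv_def)
      have 2: "((\<lambda>t. \<zeta> (x + t *\<^sub>R i)) has_real_derivative \<zeta>' x) (at 0)"
        using \<zeta>(1) by (simp add: has_dir_deriv_def)
      have 3: "((\<lambda>t. g (?u (x + t *\<^sub>R i))) has_real_derivative g' (?u x) * ?h x) (at 0)"
        using DERIV_chain2[OF _ 1, of g "g' (?u x)"] g[OF u0, of x] by simp
      show "((\<lambda>t. g (?u (x + t *\<^sub>R i)) * \<zeta> (x + t *\<^sub>R i)) has_real_derivative
          g' (?u x) * ?h x * \<zeta> x + g (?u x) * \<zeta>' x) (at 0)"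
        using DERIV_mult[OF 3 2] by (simp add: mult.commute add.commute)
    qed
    show "\<bar>g' (?u x) * ?h x * \<zeta> x + g (?u x) * \<zeta>' x\<bar> \<le> B * H * Z + B * Z'" for x
      using b1[of x] b2[of x] by linarith
    show "integrable lborel (\<lambda>x. g (?u x) * \<zeta> x)"
    proof (rule integrable_vanishing[of _ "B * Z" R])
      show "\<bar>g (?u x) * \<zeta> x\<bar> \<le> B * Z" for x
        unfolding abs_mult using B(1)[OF u0] Z B0 by (intro mult_mono) auto
    qed (use R in auto)
    show "g (?u x) * \<zeta> x = 0" if "R \<le> norm x" for x using R[OF that] by simp
  qed measurable
  then show ?thesis using i1 i2 by simp
qed

text \<open>The limit of the mollified identity. The multiplier \<open>\<zeta>\<close> is only asked
  to be differentiable along \<open>i\<close> with continuous derivative, because it will be the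
  product of a test function with a cutoff that is merely continuously differentiable.\<close>

lemma weak_dir_deriv_compose:
  fixes f :: "'a::euclidean_space \<Rightarrow> real"
  assumes w: "weak_dir_deriv f h i" and i: "i \<in> Basis" and f0: "\<And>x. 0 \<le> f x"
    and [measurable]: "g \<in> borel_measurable borel" "g' \<in> borel_measurable borel"
    and g: "\<And>v. 0 \<le> v \<Longrightarrow> (g has_real_derivative g' v) (at v)"
    and g'c: "continuous_on {0..} g'"
    and B: "\<And>v. 0 \<le> v \<Longrightarrow> \<bar>g v\<bar> \<le> B" "\<And>v. 0 \<le> v \<Longrightarrow> \<bar>g' v\<bar> \<le> B"
    and \<zeta>: "has_dir_deriv \<zeta> \<zeta>' i" "continuous_on UNIV \<zeta>" "continuous_on UNIV \<zeta>'"
    and R: "\<And>x. R \<le> norm x \<Longrightarrow> \<zeta> x = 0"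
  shows "(\<integral>x. g (f x) * \<zeta>' x \<partial>lborel) = - (\<integral>x. g' (f x) * h x * \<zeta> x \<partial>lborel)"
proof -
  have "\<exists>\<rho> :: 'a \<Rightarrow> real. mollifier (1 / real (Suc n)) \<rho>" for n
    by (rule mollifier_exists) simp
  then obtain \<rho> :: "nat \<Rightarrow> 'a \<Rightarrow> real" where \<rho>: "\<And>n. mollifier (1 / real (Suc n)) (\<rho> n)"
    by metis
  have lf: "locally_integrable f" and lh: "locally_integrable h"
    using w by (auto simp: weak_dir_deriv_def)
  have [measurable]: "f \<in> borel_measurable borel" "h \<in> borel_measurable borel" "\<And>n. \<rho> n \<in> borel_measurable borel"
    "\<zeta> \<in> borel_measurable borel" "\<zeta>' \<in> borel_measurable borel"
    using lf lh mollifier_measurable[OF \<rho>] \<zeta> by (auto simp: locally_integrable_def intro: borel_measurable_continuous_onI)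
  let ?I = "indicat_real (cball (0::'a) R)"
  have R': "\<zeta>' x = 0" if "R < norm x" for x
    using has_dir_deriv_vanishing[OF \<zeta>(1) R that] by simp
  then have R'': "\<zeta>' x = 0" if "R + 1 \<le> norm x" for x
    using that by simp
  obtain Z where Z: "Z > 0" "\<And>x. \<bar>\<zeta> x\<bar> \<le> Z"
    using bounded_if_vanishing[OF \<zeta>(2) R] by blast
  obtain Z' where Z': "Z' > 0" "\<And>x. \<bar>\<zeta>' x\<bar> \<le> Z'"
    using bounded_if_vanishing[OF \<zeta>(3), of "R + 1"] R'' by blast
  have B0: "0 \<le> B" using B(1)[of 0] by linarith
  have i\<zeta>': "integrable lborel \<zeta>'"
    by (rule integrable_vanishing[OF _ Z'(2), where R = R]) (use R' in auto)
  have ih\<zeta>: "integrable lborel (\<lambda>x. h x * \<zeta> x)"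
    by (rule locally_integrable_mult[OF lh _ Z(2), where R = R]) (use R in auto)
  \<comment> \<open>Passing to the limit inside the nonlinear \<open>g\<close> and \<open>g'\<close>
    takes convergence almost everywhere, which L1 convergence gives along a subsequence.\<close>
  obtain r :: "nat \<Rightarrow> nat" where r: "strict_mono r"
      "AE x in lborel. (\<lambda>n. ?I x * (mollify (\<rho> (r n)) f x - f x)) \<longlonglongrightarrow> 0"
    using tendsto_L1_AE_subseq[OF mollify_tendsto_L1_loc(1)[OF lf \<rho>]
        mollify_tendsto_L1_loc(2)[OF lf \<rho>, folded real_norm_def], of R] by blast
  let ?u = "\<lambda>n. mollify (\<rho> (r n)) f" and ?h = "\<lambda>n. mollify (\<rho> (r n)) h"
  have u0: "0 \<le> ?u n x" for n x
    unfolding mollify_def using f0 \<rho>[of "r n"] by (intro Bochner_Integration.integral_nonneg) (auto simp: mollifier_def)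
  have conv: "AE x in lborel. norm x \<le> R \<longrightarrow> (\<lambda>n. ?u n x) \<longlonglongrightarrow> f x"
    using r(2)
  proof eventually_elim
    case (elim x)
    then show ?case by (subst Lim_null) (cases "norm x \<le> R"; simp)
  qed
  have gc: "isCont g v" if "0 \<le> v" for v using g[OF that] by (rule DERIV_isCont)
  have A: "(\<lambda>n. \<integral>x. g (?u n x) * \<zeta>' x \<partial>lborel) \<longlonglongrightarrow> (\<integral>x. g (f x) * \<zeta>' x \<partial>lborel)"
  proof (rule integral_dominated_convergence[where w = "\<lambda>x. B * \<bar>\<zeta>' x\<bar>"])
    show "AE x in lborel. (\<lambda>n. g (?u n x) * \<zeta>' x) \<longlonglongrightarrow> g (f x) * \<zeta>' x"
      using conv
    proof eventually_elim
      case (elim x)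
      show ?case
      proof (cases "norm x \<le> R")
        case True
        then show ?thesis
          using elim by (intro tendsto_mult tendsto_const isCont_tendsto_compose[OF gc[OF f0]]) simp
      qed (use R' in simp)
    qed
    show "AE x in lborel. norm (g (?u n x) * \<zeta>' x) \<le> B * \<bar>\<zeta>' x\<bar>" for n
      using B(1)[OF u0] by (auto simp: abs_mult intro!: mult_right_mono)
  qed (use i\<zeta>' in auto)
  have g'b: "\<bar>g' (?u n x)\<bar> \<le> B" "\<bar>g' (f x)\<bar> \<le> B" for n x
    using B(2) u0 f0 by auto
  have "(\<lambda>n. \<integral>x. (g' (?u n x) - g' (f x)) * (h x * \<zeta> x) \<partial>lborel) \<longlonglongrightarrow> (\<integral>x. 0 \<partial>(lborel::'a measure))"
  proof (rule integral_dominated_convergence[where w = "\<lambda>x. (2 * B) * \<bar>h x * \<zeta> x\<bar>"])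
    show "AE x in lborel. (\<lambda>n. (g' (?u n x) - g' (f x)) * (h x * \<zeta> x)) \<longlonglongrightarrow> 0"
      using conv
    proof eventually_elim
      case (elim x)
      show ?case
      proof (cases "norm x \<le> R")
        case True
        then have "(\<lambda>n. g' (?u n x)) \<longlonglongrightarrow> g' (f x)"
          using elim f0 u0 by (intro continuous_on_tendsto_compose[OF g'c]) auto
        then have "(\<lambda>n. g' (?u n x) - g' (f x)) \<longlonglongrightarrow> 0"
          by (subst (asm) Lim_null)
        then show ?thesis by (rule tendsto_mult_left_zero)
      qed (use R in simp)
    qed
    show "AE x in lborel. norm ((g' (?u n x) - g' (f x)) * (h x * \<zeta> x)) \<le> (2 * B) * \<bar>h x * \<zeta> x\<bar>" for n
    proof (intro AE_I2)
      fix x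
      have "\<bar>g' (?u n x) - g' (f x)\<bar> \<le> 2 * B" using g'b(1)[of n x] g'b(2)[of x] by linarith
      then show "norm ((g' (?u n x) - g' (f x)) * (h x * \<zeta> x)) \<le> (2 * B) * \<bar>h x * \<zeta> x\<bar>"
        unfolding real_norm_def abs_mult[of "_ - _"] by (rule mult_right_mono) simp
    qed
    show "integrable lborel (\<lambda>x. 2 * B * \<bar>h x * \<zeta> x\<bar>)" using ih\<zeta> by auto
  qed measurable
  then have C1: "(\<lambda>n. \<integral>x. (g' (?u n x) - g' (f x)) * (h x * \<zeta> x) \<partial>lborel) \<longlonglongrightarrow> 0" by simp
  have ihn: "integrable lborel (\<lambda>x. ?I x * (?h n x - h x))" for n
    by (rule mollify_tendsto_L1_loc(1)[OF lh \<rho>])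
  have lim_h: "(\<lambda>n. \<integral>x. \<bar>?I x * (?h n x - h x)\<bar> \<partial>lborel) \<longlonglongrightarrow> 0"
    using LIMSEQ_subseq_LIMSEQ[OF mollify_tendsto_L1_loc(2)[OF lh \<rho>, of R] r(1)] by (simp add: o_def)
  have eqI: "g' (?u n x) * (?h n x - h x) * \<zeta> x = (?I x * (?h n x - h x)) * (g' (?u n x) * \<zeta> x)" for n x
    using R[of x] by (auto simp: indicator_def)
  have bI: "\<bar>g' (?u n x) * \<zeta> x\<bar> \<le> B * Z" for n x
    unfolding abs_mult using g'b Z B0 by (intro mult_mono) auto
  have iI: "integrable lborel (\<lambda>x. g' (?u n x) * (?h n x - h x) * \<zeta> x)" for n
    unfolding eqI by (intro integrable_bounded_mult[OF ihn _ bI]) measurable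
  have C2: "(\<lambda>n. \<integral>x. g' (?u n x) * (?h n x - h x) * \<zeta> x \<partial>lborel) \<longlonglongrightarrow> 0"
  proof (rule Lim_null_comparison)
    show "eventually (\<lambda>n. norm (\<integral>x. g' (?u n x) * (?h n x - h x) * \<zeta> x \<partial>lborel)
        \<le> B * Z * (\<integral>x. \<bar>?I x * (?h n x - h x)\<bar> \<partial>lborel)) sequentially"
    proof (intro always_eventually allI)
      fix n
      have "norm (\<integral>x. g' (?u n x) * (?h n x - h x) * \<zeta> x \<partial>lborel) \<le> (\<integral>x. \<bar>g' (?u n x) * (?h n x - h x) * \<zeta> x\<bar> \<partial>lborel)"
        using integral_abs_bound by simp
      also have "\<dots> \<le> (\<integral>x. B * Z * \<bar>?I x * (?h n x - h x)\<bar> \<partial>lborel)"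
      proof (intro integral_mono integrable_abs iI integrable_mult_right ihn)
        show "\<bar>g' (?u n x) * (?h n x - h x) * \<zeta> x\<bar> \<le> B * Z * \<bar>?I x * (?h n x - h x)\<bar>" for x
          unfolding eqI abs_mult[of "?I x * (?h n x - h x)"]
          using mult_right_mono[OF bI[of n x], of "\<bar>?I x * (?h n x - h x)\<bar>"] by (simp only: mult.commute abs_ge_zero)
      qed
      finally show "norm (\<integral>x. g' (?u n x) * (?h n x - h x) * \<zeta> x \<partial>lborel)
        \<le> B * Z * (\<integral>x. \<bar>?I x * (?h n x - h x)\<bar> \<partial>lborel)" by simp
    qed
    show "(\<lambda>n. B * Z * (\<integral>x. \<bar>?I x * (?h n x - h x)\<bar> \<partial>lborel)) \<longlonglongrightarrow> 0"
      using tendsto_mult_right_zero[OF lim_h] .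
  qed
  have ig': "integrable lborel (\<lambda>x. (h x * \<zeta> x) * g' (f x))"
    by (intro integrable_bounded_mult[OF ih\<zeta> _ g'b(2)]) measurable
  have ig'': "integrable lborel (\<lambda>x. (h x * \<zeta> x) * g' (?u n x))" for n
    by (intro integrable_bounded_mult[OF ih\<zeta> _ g'b(1)]) measurable
  \<comment> \<open>Two factors vary with \<open>n\<close>. The error of \<open>h\<close> is small
    in L1 and multiplied by a bounded function; the error of \<open>g'\<close> tends to 0 almost
    everywhere on the support of \<open>\<zeta>\<close> and is dominated by a multiple of
    \<open>\<bar>h x * \<zeta> x\<bar>\<close>.\<close>
  have split: "(\<integral>x. g' (?u n x) * ?h n x * \<zeta> x \<partial>lborel) =
      (\<integral>x. g' (?u n x) * (?h n x - h x) * \<zeta> x \<partial>lborel) + (\<integral>x. (g' (?u n x) - g' (f x)) * (h x * \<zeta> x) \<partial>lborel)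
      + (\<integral>x. g' (f x) * h x * \<zeta> x \<partial>lborel)" for n
  proof -
    have j2: "integrable lborel (\<lambda>x. (g' (?u n x) - g' (f x)) * (h x * \<zeta> x))"
      using Bochner_Integration.integrable_diff[OF ig''[of n] ig'] by (simp add: algebra_simps)
    have j3: "integrable lborel (\<lambda>x. g' (f x) * h x * \<zeta> x)"
      using ig' by (simp add: mult.commute mult.left_commute)
    have "(\<integral>x. g' (?u n x) * ?h n x * \<zeta> x \<partial>lborel) = (\<integral>x. (g' (?u n x) * (?h n x - h x) * \<zeta> x
        + (g' (?u n x) - g' (f x)) * (h x * \<zeta> x)) + g' (f x) * h x * \<zeta> x \<partial>lborel)"
      by (intro Bochner_Integration.integral_cong) (auto simp: algebra_simps)
    also have "\<dots> = (\<integral>x. g' (?u n x) * (?h n x - h x) * \<zeta> x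
        + (g' (?u n x) - g' (f x)) * (h x * \<zeta> x) \<partial>lborel) + (\<integral>x. g' (f x) * h x * \<zeta> x \<partial>lborel)"
      by (intro Bochner_Integration.integral_add Bochner_Integration.integrable_add iI j2 j3)
    also have "(\<integral>x. g' (?u n x) * (?h n x - h x) * \<zeta> x
        + (g' (?u n x) - g' (f x)) * (h x * \<zeta> x) \<partial>lborel) = (\<integral>x. g' (?u n x) * (?h n x - h x) * \<zeta> x \<partial>lborel) + (\<integral>x. (g' (?u n x) - g' (f x)) * (h x * \<zeta> x) \<partial>lborel)"
      by (intro Bochner_Integration.integral_add iI j2)
    finally show ?thesis .
  qed
  have C: "(\<lambda>n. \<integral>x. g' (?u n x) * ?h n x * \<zeta> x \<partial>lborel) \<longlonglongrightarrow> (\<integral>x. g' (f x) * h x * \<zeta> x \<partial>lborel)"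
    unfolding split using tendsto_add[OF tendsto_add[OF C2 C1] tendsto_const] by simp
  have "(\<integral>x. g (?u n x) * \<zeta>' x \<partial>lborel) = - (\<integral>x. g' (?u n x) * ?h n x * \<zeta> x \<partial>lborel)" for n
    by (rule integral_dir_deriv_mollified[OF w i f0 \<rho> _ _ _ g B \<zeta> R]) (auto simp: divide_le_eq)
  then have "(\<lambda>n. - (\<integral>x. g' (?u n x) * ?h n x * \<zeta> x \<partial>lborel)) \<longlonglongrightarrow> (\<integral>x. g (f x) * \<zeta>' x \<partial>lborel)"
    using A by simp
  then show ?thesis by (rule LIMSEQ_unique[OF _ tendsto_minus[OF C]])
qed

section \<open>Borel representatives and the passage between \<open>lebesgue\<close> and
  \<open>lborel\<close>\<close>

lemma lebesgue_borel_representative: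
  fixes f :: "'a::euclidean_space \<Rightarrow> 'b::euclidean_space"
  assumes "f \<in> borel_measurable lebesgue"
  obtains f' where "f' \<in> borel_measurable borel" "AE x in lebesgue. f x = f' x"
proof -
  have "\<exists>g\<in>borel_measurable lborel. AE x in lborel. f x \<bullet> i = g x" for i
    using assms by (intro completion_ex_borel_measurable_real) auto
  then obtain g where g: "\<And>i. g i \<in> borel_measurable lborel" "\<And>i. AE x in lborel. f x \<bullet> i = g i x"
    by metis
  have [measurable]: "g i \<in> borel_measurable borel" for i using g(1)[of i] by simp
  show ?thesis
  proof (rule that[of "\<lambda>x. \<Sum>i\<in>Basis. g i x *\<^sub>R i"])
    have "AE x in lborel. \<forall>i\<in>Basis. f x \<bullet> i = g i x"
      using g(2) by (intro AE_finite_allI) auto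
    then have "AE x in lborel. f x = (\<Sum>i\<in>Basis. g i x *\<^sub>R i)"
    proof eventually_elim
      case (elim x)
      have "f x = (\<Sum>i\<in>Basis. (f x \<bullet> i) *\<^sub>R i)" by (simp add: euclidean_representation)
      also have "\<dots> = (\<Sum>i\<in>Basis. g i x *\<^sub>R i)" using elim by (intro sum.cong) auto
      finally show ?case .
    qed
    then show "AE x in lebesgue. f x = (\<Sum>i\<in>Basis. g i x *\<^sub>R i)"
      by (rule AE_completion)
  qed measurable
qed

lemma borel_imp_lebesgue_measurable:
  "f \<in> borel_measurable borel \<Longrightarrow> f \<in> borel_measurable lebesgue"
  by (intro measurable_completion) simp

lemma integrable_lebesgue_iff:
  fixes f :: "'a::euclidean_space \<Rightarrow> real"
  assumes "f \<in> borel_measurable borel"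
  shows "integrable lebesgue f \<longleftrightarrow> integrable lborel f"
  using assms by (intro integrable_completion) simp

lemma integral_lebesgue_eq:
  fixes f :: "'a::euclidean_space \<Rightarrow> real"
  assumes "f \<in> borel_measurable borel"
  shows "(LINT x|lebesgue. f x) = (\<integral>x. f x \<partial>lborel)"
  using assms by (intro integral_completion) simp

lemma cball_measurable [measurable]: "cball (a :: 'a::metric_space) r \<in> sets borel"
  by simp

lemma set_integrable_lebesgue_iff:
  fixes f :: "'a::euclidean_space \<Rightarrow> real"
  assumes [measurable]: "f \<in> borel_measurable borel"
  shows "set_integrable lebesgue (cball a R) f \<longleftrightarrow> set_integrable lborel (cball a R) f"
  unfolding set_integrable_def by (rule integrable_lebesgue_iff) measurable

lemma Lp_loc_borel_iff:
  fixes f :: "'a::euclidean_space \<Rightarrow> 'b::euclidean_space"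
  assumes [measurable]: "f \<in> borel_measurable borel"
  shows "f \<in> Lp_loc r \<longleftrightarrow> locally_integrable (\<lambda>x. norm (f x) powr r)"
proof
  assume "f \<in> Lp_loc r"
  then have "set_integrable lebesgue (cball 0 R) (\<lambda>x. norm (f x) powr r)" for R
    by (simp add: Lp_loc_def)
  then show "locally_integrable (\<lambda>x. norm (f x) powr r)"
    by (simp add: locally_integrable_def set_integrable_lebesgue_iff)
next
  assume l: "locally_integrable (\<lambda>x. norm (f x) powr r)"
  have "set_integrable lebesgue K (\<lambda>x. norm (f x) powr r)" if K: "compact K" for K
  proof -
    obtain R where "\<forall>x\<in>K. norm x \<le> R"
      using compact_imp_bounded[OF K] unfolding bounded_iff by blast
    then have R: "K \<subseteq> cball 0 R" by auto
    have "set_integrable lebesgue (cball 0 R) (\<lambda>x. norm (f x) powr r)"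
      using l by (simp add: locally_integrable_def set_integrable_lebesgue_iff)
    then show ?thesis
      by (rule set_integrable_subset) (use R K in \<open>auto simp: compact_imp_closed\<close>)
  qed
  then show "f \<in> Lp_loc r" unfolding Lp_loc_def by (auto intro: borel_imp_lebesgue_measurable)
qed

lemma Lp_loc_cong_AE:
  assumes "f \<in> Lp_loc r" "g \<in> borel_measurable borel" "AE x in lebesgue. f x = g x"
  shows "g \<in> Lp_loc r"
proof -
  have g: "g \<in> borel_measurable lebesgue" and f: "f \<in> borel_measurable lebesgue"
    using assms by (auto intro: borel_imp_lebesgue_measurable simp: Lp_loc_def)
  have "set_integrable lebesgue K (\<lambda>x. norm (g x) powr r)" if K: "compact K" for K
  proof -
    have [measurable]: "K \<in> sets lebesgue" using K by (simp add: compact_imp_closed)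
    have "set_integrable lebesgue K (\<lambda>x. norm (f x) powr r)" using assms(1) K by (simp add: Lp_loc_def)
    then show ?thesis unfolding set_integrable_def
      by (rule integrable_cong_AE_imp) (use f g assms(3) in auto)
  qed
  then show ?thesis using g by (simp add: Lp_loc_def)
qed

lemma locally_integrable_bound:
  assumes g: "locally_integrable g" and [measurable]: "f \<in> borel_measurable borel"
    and le: "\<And>x. \<bar>f x\<bar> \<le> g x"
  shows "locally_integrable f"
  unfolding locally_integrable_def set_integrable_def
proof (intro conjI allI)
  fix R
  show "integrable lborel (\<lambda>x. indicat_real (cball 0 R) x *\<^sub>R f x)"
  proof (rule Bochner_Integration.integrable_bound)
    show "integrable lborel (\<lambda>x. indicat_real (cball 0 R) x *\<^sub>R g x)"
      using g by (simp add: locally_integrable_def set_integrable_def)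
    show "AE x in lborel. norm (indicat_real (cball 0 R) x *\<^sub>R f x) \<le> norm (indicat_real (cball 0 R) x *\<^sub>R g x)"
    proof (intro AE_I2)
      fix x show "norm (indicat_real (cball 0 R) x *\<^sub>R f x) \<le> norm (indicat_real (cball 0 R) x *\<^sub>R g x)"
        using le[of x] by (auto simp: indicator_def)
    qed
  qed measurable
qed measurable

lemma locally_integrable_add:
  "locally_integrable f \<Longrightarrow> locally_integrable g \<Longrightarrow> locally_integrable (\<lambda>x. f x + g x)"
  unfolding locally_integrable_def by (auto intro: set_integral_add)

lemma locally_integrable_cmult:
  "locally_integrable f \<Longrightarrow> locally_integrable (\<lambda>x. c * f x)"
  unfolding locally_integrable_def by (auto intro: set_integrable_mult_right)

lemma locally_integrable_sum:
  "(\<And>a. a \<in> A \<Longrightarrow> locally_integrable (f a)) \<Longrightarrow> locally_integrable (\<lambda>x. \<Sum>a\<in>A. f a x)"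
  by (induction A rule: infinite_finite_induct) (auto intro: locally_integrable_add locally_integrable_const)

lemma locally_integrable_abs:
  "locally_integrable f \<Longrightarrow> locally_integrable (\<lambda>x. \<bar>f x\<bar>)"
  unfolding locally_integrable_def by (auto intro: set_integrable_abs)

lemma Lp_loc_1_iff:
  fixes G :: "'a::euclidean_space \<Rightarrow> 'b::euclidean_space"
  assumes [measurable]: "G \<in> borel_measurable borel"
  shows "G \<in> Lp_loc 1 \<longleftrightarrow> (\<forall>i\<in>Basis. locally_integrable (\<lambda>x. G x \<bullet> i))"
proof -
  have "locally_integrable (\<lambda>x. norm (G x)) \<longleftrightarrow> (\<forall>i\<in>Basis. locally_integrable (\<lambda>x. G x \<bullet> i))"
  proof (intro iffI ballI)
    fix i :: 'b assume i: "i \<in> Basis" and l: "locally_integrable (\<lambda>x. norm (G x))"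
    show "locally_integrable (\<lambda>x. G x \<bullet> i)"
      by (rule locally_integrable_bound[OF l]) (use i in \<open>auto simp: Basis_le_norm\<close>)
  next
    assume "\<forall>i\<in>Basis. locally_integrable (\<lambda>x. G x \<bullet> i)"
    then have "locally_integrable (\<lambda>x. \<Sum>i\<in>Basis. \<bar>G x \<bullet> i\<bar>)"
      by (intro locally_integrable_sum locally_integrable_abs) auto
    then show "locally_integrable (\<lambda>x. norm (G x))"
      by (rule locally_integrable_bound) (auto simp: norm_le_l1)
  qed
  then show ?thesis by (simp add: Lp_loc_borel_iff)
qed

lemma test_functions_measurable [measurable]:
  assumes "\<phi> \<in> test_functions" "i \<in> Basis"
  shows "\<phi> \<in> borel_measurable borel" "(\<lambda>x. frechet_derivative \<phi> (at x) i) \<in> borel_measurable borel"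
  using test_functions_continuous[OF assms] by (auto intro: borel_measurable_continuous_onI)

lemma has_weak_gradient_cong_AE:
  assumes "has_weak_gradient u G" "AE x in lebesgue. u x = u' x" "AE x in lebesgue. G x = G' x"
    and "u' \<in> borel_measurable borel" "G' \<in> borel_measurable borel"
  shows "has_weak_gradient u' G'"
proof -
  have m: "u \<in> borel_measurable lebesgue" "G \<in> borel_measurable lebesgue"
    "u' \<in> borel_measurable lebesgue" "G' \<in> borel_measurable lebesgue"
    using assms by (auto simp: has_weak_gradient_def Lp_loc_def intro: borel_imp_lebesgue_measurable)
  have "(LINT x|lebesgue. u' x * frechet_derivative \<phi> (at x) i) = - (LINT x|lebesgue. (G' x \<bullet> i) * \<phi> x)"
    if \<phi>: "\<phi> \<in> test_functions" and i: "i \<in> Basis" for \<phi> i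
  proof -
    have [measurable]: "\<phi> \<in> borel_measurable lebesgue" "(\<lambda>x. frechet_derivative \<phi> (at x) i) \<in> borel_measurable lebesgue"
      using test_functions_measurable[OF \<phi> i] by (auto intro: borel_imp_lebesgue_measurable)
    note m [measurable]
    have "(LINT x|lebesgue. u' x * frechet_derivative \<phi> (at x) i) = (LINT x|lebesgue. u x * frechet_derivative \<phi> (at x) i)"
      using assms(2) by (intro integral_cong_AE) auto
    also have "\<dots> = - (LINT x|lebesgue. (G x \<bullet> i) * \<phi> x)"
      using assms(1) \<phi> i by (simp add: has_weak_gradient_def)
    also have "(LINT x|lebesgue. (G x \<bullet> i) * \<phi> x) = (LINT x|lebesgue. (G' x \<bullet> i) * \<phi> x)"
      using assms(3) by (intro integral_cong_AE) auto
    finally show ?thesis .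
  qed
  then show ?thesis
    using assms by (auto simp: has_weak_gradient_def intro: Lp_loc_cong_AE)
qed

lemma has_weak_gradient_borel_iff:
  fixes u :: "'a::euclidean_space \<Rightarrow> real"
  assumes [measurable]: "u \<in> borel_measurable borel" "G \<in> borel_measurable borel"
  shows "has_weak_gradient u G \<longleftrightarrow> (\<forall>i\<in>Basis. weak_dir_deriv u (\<lambda>x. G x \<bullet> i) i)"
proof -
  have u: "u \<in> Lp_loc 1 \<longleftrightarrow> locally_integrable u"
    using Lp_loc_1_iff[of u] by simp
  have "(LINT x|lebesgue. u x * frechet_derivative \<phi> (at x) i) = (\<integral>x. u x * frechet_derivative \<phi> (at x) i \<partial>lborel)"
    "(LINT x|lebesgue. (G x \<bullet> i) * \<phi> x) = (\<integral>x. (G x \<bullet> i) * \<phi> x \<partial>lborel)"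
    if \<phi>: "\<phi> \<in> test_functions" and i: "i \<in> Basis" for \<phi> i
  proof -
    note test_functions_measurable[OF \<phi> i, measurable]
    show "(LINT x|lebesgue. u x * frechet_derivative \<phi> (at x) i) = (\<integral>x. u x * frechet_derivative \<phi> (at x) i \<partial>lborel)"
      "(LINT x|lebesgue. (G x \<bullet> i) * \<phi> x) = (\<integral>x. (G x \<bullet> i) * \<phi> x \<partial>lborel)"
      by (rule integral_lebesgue_eq; measurable)+
  qed
  \<comment> \<open>Local integrability of \<open>u\<close> is contained in each
    \<open>weak_dir_deriv\<close>; recovering it takes at least one direction.\<close>
  moreover obtain b :: 'a where "b \<in> Basis" using nonempty_Basis by blast
  ultimately show ?thesis
    unfolding has_weak_gradient_def weak_dir_deriv_def u Lp_loc_1_iff[OF assms(2)]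
    by (safe; simp)
qed

text \<open>For a test function \<open>\<eta>\<close>, the product \<open>c * \<eta>\<close> serves
  as the multiplier in \<open>weak_dir_deriv_compose\<close>; expanding its derivative moves the
  term with \<open>Dc\<close> to the side of the gradient. Chain rule and product rule thus come out
  together.\<close>

lemma has_weak_gradient_cutoff_compose:
  fixes u :: "'a::euclidean_space \<Rightarrow> real"
  assumes wg: "has_weak_gradient u G" and u0: "\<And>x. 0 \<le> u x"
    and [measurable]: "u \<in> borel_measurable borel" "G \<in> borel_measurable borel"
    and [measurable]: "g \<in> borel_measurable borel" "g' \<in> borel_measurable borel"
    and g: "\<And>v. 0 \<le> v \<Longrightarrow> (g has_real_derivative g' v) (at v)"
    and g'c: "continuous_on {0..} g'"
    and B: "\<And>v. 0 \<le> v \<Longrightarrow> \<bar>g v\<bar> \<le> B" "\<And>v. 0 \<le> v \<Longrightarrow> \<bar>g' v\<bar> \<le> B"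
    and c: "\<And>x. (c has_derivative (\<lambda>h. Dc x \<bullet> h)) (at x)" "continuous_on UNIV Dc"
    and R: "\<And>x. R \<le> norm x \<Longrightarrow> c x = 0"
  shows "has_weak_gradient (\<lambda>x. c x * g (u x)) (\<lambda>x. g (u x) *\<^sub>R Dc x + (c x * g' (u x)) *\<^sub>R G x)"
proof -
  have cc: "continuous_on UNIV c"
    using c(1) by (intro continuous_at_imp_continuous_on) (auto intro: has_derivative_continuous)
  have [measurable]: "c \<in> borel_measurable borel" "Dc \<in> borel_measurable borel"
    using cc c(2) by (auto intro: borel_measurable_continuous_onI)
  obtain X where X: "X > 0" "\<And>x. \<bar>c x\<bar> \<le> X"
    using bounded_if_vanishing[OF cc R] by blast
  have B0: "0 \<le> B" using B(1)[of 0] by linarith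
  have l1: "locally_integrable (\<lambda>x. c x * g (u x))"
  proof (rule locally_integrable_bound[OF locally_integrable_const[of "X * B"]])
    show "\<bar>c x * g (u x)\<bar> \<le> X * B" for x
      unfolding abs_mult using X B(1)[OF u0] B0 by (intro mult_mono) auto
  qed measurable
  show ?thesis
  proof (subst has_weak_gradient_borel_iff; (intro ballI)?)
    fix i :: 'a assume i: "i \<in> Basis"
    have w: "weak_dir_deriv u (\<lambda>x. G x \<bullet> i) i"
      using wg i by (simp add: has_weak_gradient_borel_iff)
    then have lG: "locally_integrable (\<lambda>x. G x \<bullet> i)" by (simp add: weak_dir_deriv_def)
    have cD: "continuous_on UNIV (\<lambda>x. Dc x \<bullet> i)"
      using c(2) by (intro continuous_intros)
    have dc: "has_dir_deriv c (\<lambda>x. Dc x \<bullet> i) i"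
      using has_derivative_imp_dir_deriv[OF c(1)] .
    have D0: "Dc x \<bullet> i = 0" if "R < norm x" for x
      using has_dir_deriv_vanishing[OF dc R that] .
    then have D0': "Dc x \<bullet> i = 0" if "R + 1 \<le> norm x" for x
      using that by simp
    obtain Y where Y: "Y > 0" "\<And>x. \<bar>Dc x \<bullet> i\<bar> \<le> Y"
      using bounded_if_vanishing[OF cD D0'] by blast
    have b1: "\<bar>g (u x) * (Dc x \<bullet> i)\<bar> \<le> B * Y" for x
      unfolding abs_mult using Y B(1)[OF u0] B0 by (intro mult_mono) auto
    have b2: "\<bar>(c x * g' (u x)) * (G x \<bullet> i)\<bar> \<le> X * B * \<bar>G x \<bullet> i\<bar>" for x
      unfolding abs_mult using X B(2)[OF u0] B0 by (intro mult_right_mono mult_mono) auto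
    have l2: "locally_integrable (\<lambda>x. (g (u x) *\<^sub>R Dc x + (c x * g' (u x)) *\<^sub>R G x) \<bullet> i)"
      unfolding inner_add_left inner_scaleR_left
    proof (intro locally_integrable_add)
      show "locally_integrable (\<lambda>x. g (u x) * (Dc x \<bullet> i))"
        by (rule locally_integrable_bound[OF locally_integrable_const _ b1]) measurable
      show "locally_integrable (\<lambda>x. (c x * g' (u x)) * (G x \<bullet> i))"
        by (rule locally_integrable_bound[OF locally_integrable_cmult[OF locally_integrable_abs[OF lG]] _ b2]) measurable
    qed
    show "weak_dir_deriv (\<lambda>x. c x * g (u x)) (\<lambda>x. (g (u x) *\<^sub>R Dc x + (c x * g' (u x)) *\<^sub>R G x) \<bullet> i) i"
      unfolding weak_dir_deriv_def
    proof (intro conjI l1 l2 ballI)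
      fix \<eta> :: "'a \<Rightarrow> real" assume \<eta>: "\<eta> \<in> test_functions"
      let ?\<eta>' = "\<lambda>x. frechet_derivative \<eta> (at x) i"
      note test_functions_measurable[OF \<eta> i, measurable]
      have d\<eta>: "has_dir_deriv \<eta> ?\<eta>' i" using test_functions_dir_deriv[OF \<eta>] .
      have c\<eta>: "continuous_on UNIV \<eta>" "continuous_on UNIV ?\<eta>'" using test_functions_continuous[OF \<eta> i] .
      obtain S where S: "\<And>x. S \<le> norm x \<Longrightarrow> \<eta> x = 0" "S > 0"
        using test_functions_support[OF \<eta>] by blast
      obtain E where E: "E > 0" "\<And>x. \<bar>\<eta> x\<bar> \<le> E"
        using bounded_if_vanishing[OF c\<eta>(1) S(1)] by blast
      have S': "?\<eta>' x = 0" if "S + 1 \<le> norm x" for x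
        using has_dir_deriv_vanishing[OF d\<eta> S(1), where x = x] that by simp
      obtain E' where E': "E' > 0" "\<And>x. \<bar>?\<eta>' x\<bar> \<le> E'"
        using bounded_if_vanishing[OF c\<eta>(2) S'] by blast
      have "has_dir_deriv (\<lambda>x. c x * \<eta> x) (\<lambda>x. (Dc x \<bullet> i) * \<eta> x + c x * ?\<eta>' x) i"
        unfolding has_dir_deriv_def
      proof
        fix x
        have 1: "((\<lambda>t. c (x + t *\<^sub>R i)) has_real_derivative Dc x \<bullet> i) (at 0)"
          using dc by (simp add: has_dir_deriv_def)
        have 2: "((\<lambda>t. \<eta> (x + t *\<^sub>R i)) has_real_derivative ?\<eta>' x) (at 0)"
          using d\<eta> by (simp add: has_dir_deriv_def)
        show "((\<lambda>t. c (x + t *\<^sub>R i) * \<eta> (x + t *\<^sub>R i)) has_real_derivative (Dc x \<bullet> i) * \<eta> x + c x * ?\<eta>' x) (at 0)"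
          using DERIV_mult[OF 1 2] by (simp add: mult.commute)
      qed
      note d = this
      have cont: "continuous_on UNIV (\<lambda>x. c x * \<eta> x)"
        "continuous_on UNIV (\<lambda>x. (Dc x \<bullet> i) * \<eta> x + c x * ?\<eta>' x)"
        by (intro continuous_intros cc cD c\<eta>)+
      have van: "c x * \<eta> x = 0" if "R \<le> norm x" for x
        using R[OF that] by simp
      have main: "(\<integral>x. g (u x) * ((Dc x \<bullet> i) * \<eta> x + c x * ?\<eta>' x) \<partial>lborel) =
          - (\<integral>x. g' (u x) * (G x \<bullet> i) * (c x * \<eta> x) \<partial>lborel)"
        by (rule weak_dir_deriv_compose[OF w i u0 \<open>g \<in> borel_measurable borel\<close>
              \<open>g' \<in> borel_measurable borel\<close> g g'c B d cont van])
      have i1: "integrable lborel (\<lambda>x. c x * g (u x) * ?\<eta>' x)"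
      proof (rule locally_integrable_mult[OF l1 _ E'(2), where R = "S + 1"])
        show "?\<eta>' x = 0" if "S + 1 < norm x" for x using S' that by simp
      qed measurable
      have i2: "integrable lborel (\<lambda>x. g (u x) * (Dc x \<bullet> i) * \<eta> x)"
        by (rule locally_integrable_mult[OF locally_integrable_bound[OF locally_integrable_const _ b1] _ E(2), where R = S])
           (use S(1) in auto)
      have i3: "integrable lborel (\<lambda>x. (c x * g' (u x)) * (G x \<bullet> i) * \<eta> x)"
        by (rule locally_integrable_mult[OF locally_integrable_bound[OF locally_integrable_cmult[OF locally_integrable_abs[OF lG]] _ b2] _ E(2), where R = S])
           (use S(1) in auto)
      have "(\<integral>x. g (u x) * ((Dc x \<bullet> i) * \<eta> x + c x * ?\<eta>' x) \<partial>lborel) =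
          (\<integral>x. g (u x) * (Dc x \<bullet> i) * \<eta> x \<partial>lborel) + (\<integral>x. c x * g (u x) * ?\<eta>' x \<partial>lborel)"
        using i1 i2 by (subst Bochner_Integration.integral_add[symmetric]) (auto simp: algebra_simps)
      moreover have "(\<integral>x. g' (u x) * (G x \<bullet> i) * (c x * \<eta> x) \<partial>lborel) = (\<integral>x. (c x * g' (u x)) * (G x \<bullet> i) * \<eta> x \<partial>lborel)"
        by (intro Bochner_Integration.integral_cong) (auto simp: algebra_simps)
      moreover have "(\<integral>x. ((g (u x) *\<^sub>R Dc x + (c x * g' (u x)) *\<^sub>R G x) \<bullet> i) * \<eta> x \<partial>lborel) =
          (\<integral>x. g (u x) * (Dc x \<bullet> i) * \<eta> x \<partial>lborel) + (\<integral>x. (c x * g' (u x)) * (G x \<bullet> i) * \<eta> x \<partial>lborel)"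
        using i2 i3 by (subst Bochner_Integration.integral_add[symmetric]) (auto simp: inner_add_left algebra_simps)
      ultimately show "(\<integral>x. c x * g (u x) * ?\<eta>' x \<partial>lborel) =
          - (\<integral>x. ((g (u x) *\<^sub>R Dc x + (c x * g' (u x)) *\<^sub>R G x) \<bullet> i) * \<eta> x \<partial>lborel)"
        using main by linarith
    qed
  qed measurable
qed

section \<open>Elementary inequalities\<close>

lemma powr_le_1_add_powr:
  fixes a y p :: real
  assumes "0 \<le> a" "0 \<le> y" "y \<le> p"
  shows "a powr y \<le> 1 + a powr p"
proof (cases "a \<le> 1")
  case True
  then have "a powr y \<le> 1" using assms powr_mono2[of y a 1] by simp
  then show ?thesis using powr_ge_zero[of a p] by linarith
next
  case False
  then have "a powr y \<le> a powr p" using assms by (intro powr_mono) auto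
  then show ?thesis by simp
qed

lemma powr_1_add_le:
  fixes a p :: real
  assumes "0 \<le> a" "0 \<le> p"
  shows "(1 + a) powr p \<le> 2 powr p * (1 + a powr p)"
proof -
  have "(1 + a) powr p \<le> (2 * max 1 a) powr p"
    using assms by (intro powr_mono2) auto
  also have "\<dots> = 2 powr p * max 1 a powr p" by (simp add: powr_mult)
  also have "max 1 a powr p \<le> 1 + a powr p" by (simp add: max_def)
  finally show ?thesis by simp
qed

text \<open>Young's inequality in a form that follows by cases: either \<open>b \<le> c * a\<close>
  and the left side is at most 0, or \<open>a \<le> b / c\<close> and the first term alone is small
  enough.\<close>

lemma young_absorb:
  fixes a b c z :: real
  assumes "0 \<le> a" "0 \<le> b" "0 < c" "1 < z"
  shows "a powr (z - 1) * b - c * a powr z \<le> b powr z * c powr (1 - z)"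
proof (cases "b \<le> c * a")
  case True
  have "a powr (z - 1) * b \<le> a powr (z - 1) * (c * a)"
    using True by (intro mult_left_mono) auto
  also have "\<dots> = c * a powr z"
    using assms by (cases "a = 0") (auto simp: powr_diff)
  finally show ?thesis using powr_ge_zero[of b z] powr_ge_zero[of c "1 - z"] 
    by (smt (verit) mult_nonneg_nonneg)
next
  case False
  moreover have "0 \<le> c * a" using assms by simp
  ultimately have b: "0 < b" by linarith
  have a: "a \<le> b / c" using False assms by (simp add: le_divide_eq mult.commute)
  have "a powr (z - 1) * b \<le> (b / c) powr (z - 1) * b"
    using a b assms by (intro mult_right_mono powr_mono2) auto
  also have "\<dots> = b powr z * c powr (1 - z)"
    using b assms by (simp add: powr_divide powr_diff)
  finally show ?thesis using assms by (smt (verit) mult_nonneg_nonneg powr_ge_zero)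
qed

text \<open>Write \<open>a = norm G\<close>. Once \<open>\<phi> ^ (k - 1) * v powr (- t)\<close> is
  factored out, \<open>a powr (z - 1) * (real k * norm D) - (t * \<phi> / v) * a powr z\<close>
  remains, so the derivative of the negative power absorbs \<open>G\<close> completely, by
  \<open>young_absorb\<close> with \<open>c = t * \<phi> / v\<close>.\<close>

lemma flux_le:
  fixes G D :: "'a::real_inner"
  assumes z: "1 < z" and v: "0 < v" and t: "0 < t" and \<phi>: "0 \<le> \<phi>" and k: "2 \<le> k"
  shows "norm G powr (z - 2) * (G \<bullet> (v powr (- t) *\<^sub>R ((real k * \<phi> ^ (k - 1)) *\<^sub>R D) + (\<phi> ^ k * (- t * v powr (- t - 1))) *\<^sub>R G))
    \<le> \<phi> ^ (k - 1) * v powr (- t) * ((real k * norm D) powr z * (t * \<phi> / v) powr (1 - z))"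
proof (cases "\<phi> = 0")
  case True
  \<comment> \<open>Because \<open>k \<ge> 2\<close>, even \<open>\<phi> ^ (k - 1)\<close> vanishes,
    so both sides are 0.\<close>
  moreover have "k \<noteq> 0" "k - 1 \<noteq> 0" using k by auto
  ultimately show ?thesis by (simp add: power_0_left)
next
  case False
  then have \<phi>: "0 < \<phi>" using \<phi> by simp
  let ?a = "norm G"
  have e1: "?a powr (z - 2) * ?a = ?a powr (z - 1)"
    by (cases "G = 0") (auto simp: powr_diff power2_eq_square)
  have e2: "?a powr (z - 2) * ?a\<^sup>2 = ?a powr z"
    by (cases "G = 0") (auto simp: powr_diff)
  have vt: "v powr (- t - 1) = v powr (- t) / v" using v by (simp add: powr_diff)
  have \<phi>k: "\<phi> ^ k = \<phi> ^ (k - 1) * \<phi>" using k by (cases k) auto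
  have "norm G powr (z - 2) * (G \<bullet> (v powr (- t) *\<^sub>R ((real k * \<phi> ^ (k - 1)) *\<^sub>R D) + (\<phi> ^ k * (- t * v powr (- t - 1))) *\<^sub>R G))
     = v powr (- t) * (real k * \<phi> ^ (k - 1)) * (?a powr (z - 2) * (G \<bullet> D)) - \<phi> ^ k * (t * v powr (- t - 1)) * (?a powr (z - 2) * ?a\<^sup>2)"
    by (simp add: inner_add_right power2_norm_eq_inner algebra_simps)
  also have "\<dots> \<le> v powr (- t) * (real k * \<phi> ^ (k - 1)) * (?a powr (z - 2) * (?a * norm D)) - \<phi> ^ k * (t * v powr (- t - 1)) * (?a powr (z - 2) * ?a\<^sup>2)"
    using \<phi> by (intro diff_right_mono mult_left_mono norm_cauchy_schwarz) auto
  also have "\<dots> = \<phi> ^ (k - 1) * v powr (- t) * (?a powr (z - 1) * (real k * norm D) - (t * \<phi> / v) * ?a powr z)"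
    unfolding e2 vt \<phi>k e1[symmetric] by (simp add: algebra_simps)
  also have "\<dots> \<le> \<phi> ^ (k - 1) * v powr (- t) * ((real k * norm D) powr z * (t * \<phi> / v) powr (1 - z))"
    using \<phi> z t v by (intro mult_left_mono young_absorb) auto
  finally show ?thesis .
qed

text \<open>The summand with \<open>2 * \<delta>\<close> covers the case \<open>u < \<delta>\<close>, in which the power of \<open>u\<close> cannot absorb anything.\<close>

lemma absorb_power:
  fixes K \<phi> u \<delta> t z s :: real
  assumes K: "0 < K" and \<phi>: "0 < \<phi>" "\<phi> \<le> 1" and u: "0 \<le> u" and \<delta>: "0 < \<delta>"
    and t: "0 < t" "t < z - 1" and z: "1 < z" "z - 1 < s" and k: "z * s \<le> real k * (s - z + 1)"
  shows "K * (\<phi> powr (real k - z) * (u + \<delta>) powr (z - 1 - t)) \<le>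
    1 / 4 * (u powr s * (u + \<delta>) powr (- t) * \<phi> ^ k)
    + 2 powr ((s + 2) * ((z - 1) / (s - z + 1))) * K powr ((s - t) / (s - z + 1)) + K * (2 * \<delta>) powr (z - 1 - t)"
proof -
  let ?v = "u + \<delta>" and ?m = "s - z + 1"
  define e where "e = (z - 1 - t) / ?m"
  have m: "0 < ?m" using z by simp
  have e: "0 \<le> e" "e \<le> (z - 1) / ?m"
    using t m by (auto simp: e_def divide_right_mono)
  have s0: "0 < s" using z by simp
  have se: "(s - t) / ?m = 1 + e" using m by (simp add: e_def field_simps)
  \<comment> \<open>The reason for a large \<open>k\<close>: in the third case below
    \<open>\<phi> powr (- z)\<close> is raised to the power \<open>1 + e\<close>, and the exponent
    of \<open>\<phi>\<close> that is left must be nonnegative.\<close>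
  have zk: "z * (1 + e) \<le> real k"
  proof -
    have "z * (1 + e) = z * (s - t) / ?m" unfolding se[symmetric] by simp
    also have "\<dots> \<le> z * s / ?m" using m t z by (intro divide_right_mono mult_left_mono) auto
    also have "\<dots> \<le> real k" using k m by (simp add: divide_le_eq)
    finally show ?thesis .
  qed
  have "z * 1 \<le> z * (1 + e)" using e z by (intro mult_left_mono) auto
  then have zk': "z \<le> real k" using zk by simp
  have \<phi>1: "\<phi> powr r \<le> 1" if "0 \<le> r" for r
    using powr_mono2[OF that, of \<phi> 1] \<phi> by simp
  have \<phi>k: "\<phi> ^ k = \<phi> powr real k" using \<phi> by (simp add: powr_realpow)
  have v: "0 < ?v" using u \<delta> by simp
  let ?A = "1 / 4 * (u powr s * ?v powr (- t) * \<phi> ^ k)"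
  let ?B = "2 powr ((s + 2) * ((z - 1) / ?m)) * K powr ((s - t) / ?m)"
  let ?C = "K * (2 * \<delta>) powr (z - 1 - t)"
  have nn: "0 \<le> ?A" "0 \<le> ?B" "0 \<le> ?C" using \<phi> K by auto
  \<comment> \<open>For \<open>\<delta> \<le> u\<close> the shift costs a factor 2, as
    \<open>u + \<delta> \<le> 2 * u\<close>. Above the threshold,
    \<open>K * \<phi> powr (- z) * ?v powr (z - 1)\<close> is at most \<open>u powr s / 4\<close>:
    in \<open>2 powr (s + 2)\<close>, the part \<open>2 powr s\<close> pays for the shift and 4
    gives the coefficient. Below it, \<open>?v\<close> itself is bounded in terms of
    \<open>K\<close> and \<open>\<phi>\<close>.\<close>
  consider "u < \<delta>" | "\<delta> \<le> u" "K * \<phi> powr (- z) * 2 powr (s + 2) \<le> ?v powr ?m"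
    | "\<delta> \<le> u" "?v powr ?m \<le> K * \<phi> powr (- z) * 2 powr (s + 2)" by linarith
  then show ?thesis
  proof cases
    case 1
    have "K * (\<phi> powr (real k - z) * ?v powr (z - 1 - t)) \<le> K * (1 * (2 * \<delta>) powr (z - 1 - t))"
      using 1 u t K zk' by (intro mult_left_mono mult_mono powr_mono2 \<phi>1) auto
    also have "\<dots> = ?C" by simp
    finally show ?thesis using nn by linarith
  next
    case 2
    have us: "?v powr s \<le> 2 powr s * u powr s"
      unfolding powr_mult[symmetric] using 2 v u s0 \<delta> by (intro powr_mono2) (auto simp: powr_mult[symmetric])
    have "K * (\<phi> powr (real k - z) * ?v powr (z - 1 - t)) = (K * \<phi> powr (- z)) * (\<phi> powr real k * ?v powr (z - 1 - t))"
      using \<phi> by (simp add: powr_diff powr_minus divide_inverse mult.assoc mult.left_commute)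
    also have "\<dots> \<le> (?v powr ?m / 2 powr (s + 2)) * (\<phi> powr real k * ?v powr (z - 1 - t))"
      using 2 by (intro mult_right_mono) (auto simp: le_divide_eq)
    also have "\<dots> = (\<phi> powr real k * (?v powr ?m * ?v powr (z - 1 - t))) / 2 powr (s + 2)"
      by (simp add: mult.commute mult.left_commute)
    also have "?v powr ?m * ?v powr (z - 1 - t) = ?v powr s * ?v powr (- t)"
      by (simp add: powr_add[symmetric])
    also have "(\<phi> powr real k * (?v powr s * ?v powr (- t))) / 2 powr (s + 2)
        \<le> (\<phi> powr real k * ((2 powr s * u powr s) * ?v powr (- t))) / 2 powr (s + 2)"
      using us by (intro divide_right_mono mult_left_mono mult_right_mono) auto
    also have "\<dots> = ?A" unfolding \<phi>k by (simp add: powr_add)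
    finally show ?thesis using nn by linarith
  next
    case 3
    let ?Y = "K * \<phi> powr (- z) * 2 powr (s + 2)"
    have "?v powr (z - 1 - t) = (?v powr ?m) powr e"
      using m by (simp add: powr_powr e_def)
    also have "\<dots> \<le> ?Y powr e" using 3 e by (intro powr_mono2) auto
    also have "\<dots> = K powr e * \<phi> powr (- z * e) * 2 powr ((s + 2) * e)"
      using K \<phi> by (simp add: powr_mult powr_powr)
    finally have "K * (\<phi> powr (real k - z) * ?v powr (z - 1 - t)) \<le>
        K * (\<phi> powr (real k - z) * (K powr e * \<phi> powr (- z * e) * 2 powr ((s + 2) * e)))"
      using K by (intro mult_left_mono) auto
    also have "\<dots> = (K powr 1 * K powr e) * (\<phi> powr (real k - z) * \<phi> powr (- z * e)) * 2 powr ((s + 2) * e)"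
      using K by simp
    also have "\<dots> = K powr (1 + e) * \<phi> powr (real k - z * (1 + e)) * 2 powr ((s + 2) * e)"
      unfolding powr_add[symmetric] by (simp add: algebra_simps)
    also have "\<dots> \<le> K powr (1 + e) * 1 * 2 powr ((s + 2) * ((z - 1) / ?m))"
    proof (intro mult_mono[OF mult_left_mono])
      show "2 powr ((s + 2) * e) \<le> 2 powr ((s + 2) * ((z - 1) / ?m))"
        using e(2) s0 by (intro powr_mono mult_left_mono) auto
    qed (use zk \<phi>1 in auto)
    also have "\<dots> = ?B" unfolding se by simp
    finally show ?thesis using nn by linarith
  qed
qed

text \<open>Let \<open>\<sigma> = (s - 1 / real N) / (s - z + 1)\<close>. It exceeds 1 by a fixed
  margin, which yields the power of \<open>N\<close>. The hypothesis on \<open>n\<close> says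
  \<open>n \<le> z * s / (s - z + 1)\<close>; having \<open>s - 1 / real N\<close> in place of
  \<open>s\<close> costs \<open>\<rho> powr (z / (real N * (s - z + 1)))\<close>, which
  \<open>\<rho> \<le> exp (2 * real N)\<close> turns into a constant.\<close>

lemma critical_decay:
  fixes s z a \<rho> n :: real and N :: nat
  assumes z: "1 < z" "z - 1 < s" and n: "n * (s - z + 1) \<le> z * s" and a: "1 \<le> a"
    and N: "2 \<le> real N * (z - 1)" and \<rho>: "1 \<le> \<rho>" "\<rho> \<le> exp (2 * real N)"
  shows "(a / (real N * \<rho> powr z)) powr ((s - 1 / real N) / (s - z + 1)) \<le>
    a powr (s / (s - z + 1)) * exp (2 * z / (s - z + 1)) * (real N powr (- 1 - (z - 1) / (2 * (s - z + 1))) * \<rho> powr (- n))"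
proof -
  let ?m = "s - z + 1"
  have m: "0 < ?m" using z by simp
  have N0: "1 \<le> real N" using N z by (cases N) auto
  let ?t = "1 / real N"
  \<comment> \<open>Spending at most half of \<open>z - 1\<close> leaves the excess of
    \<open>\<sigma>\<close> over 1 bounded below independently of \<open>N\<close>.\<close>
  have t: "0 < ?t" "?t \<le> (z - 1) / 2" using N N0 by (auto simp: field_simps)
  define \<sigma> where "\<sigma> = (s - ?t) / ?m"
  have \<sigma>0: "\<sigma> \<le> s / ?m" unfolding \<sigma>_def using t m by (intro divide_right_mono) auto
  have "\<sigma> - 1 = (z - 1 - ?t) / ?m" 
  proof -
    have "\<sigma> - 1 = (s - ?t) / ?m - ?m / ?m" using m by (simp add: \<sigma>_def)
    also have "\<dots> = ((s - ?t) - ?m) / ?m" by (rule diff_divide_distrib[symmetric])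
    also have "(s - ?t) - ?m = z - 1 - ?t" by simp
    finally show ?thesis .
  qed
  also have "\<dots> \<ge> ((z - 1) / 2) / ?m" using t m by (intro divide_right_mono) auto
  finally have \<sigma>1: "1 + (z - 1) / (2 * ?m) \<le> \<sigma>" by simp
  have "n \<le> z * s / ?m" using n m by (simp add: le_divide_eq)
  also have "z * s / ?m = z * \<sigma> + z * ?t / ?m"
    unfolding \<sigma>_def by (simp add: diff_divide_distrib right_diff_distrib)
  finally have n': "n - z * ?t / ?m \<le> z * \<sigma>" by simp
  have "(a / (real N * \<rho> powr z)) powr \<sigma> = a powr \<sigma> * (real N powr (- \<sigma>) * \<rho> powr (- (z * \<sigma>)))"
  proof -
    have "(a / (real N * \<rho> powr z)) powr \<sigma> = a powr \<sigma> / (real N powr \<sigma> * \<rho> powr (z * \<sigma>))"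
      using a N0 \<rho> by (simp add: powr_divide powr_mult powr_powr)
    then show ?thesis by (simp add: powr_minus divide_inverse)
  qed
  also have "\<dots> \<le> a powr (s / ?m) * (real N powr (- 1 - (z - 1) / (2 * ?m)) * \<rho> powr (- (n - z * ?t / ?m)))"
    using a N0 \<rho> \<sigma>0 \<sigma>1 n' by (intro mult_mono powr_mono mult_nonneg_nonneg) auto
  also have "\<dots> \<le> a powr (s / ?m) * (real N powr (- 1 - (z - 1) / (2 * ?m)) * (\<rho> powr (- n) * exp (2 * z / ?m)))"
  proof -
    have "\<rho> powr (- (n - z * ?t / ?m)) = \<rho> powr (- n) * \<rho> powr (z * ?t / ?m)"
      by (simp add: powr_add[symmetric])
    also have "\<rho> powr (z * ?t / ?m) \<le> exp (2 * real N) powr (z * ?t / ?m)"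
      using \<rho> z t m by (intro powr_mono2) auto
    also have "exp (2 * real N) powr (z * ?t / ?m) = exp (2 * z / ?m)"
    proof -
      have "z * ?t / M * (2 * real N) = 2 * z / M" if "M \<noteq> 0" for M
        using N0 that by (simp add: field_simps)
      from this[of ?m] show ?thesis using m by (simp add: powr_def)
    qed
    finally have "\<rho> powr (- (n - z * ?t / ?m)) \<le> \<rho> powr (- n) * exp (2 * z / ?m)"
      by (simp add: mult_left_mono)
    then show ?thesis by (intro mult_left_mono) auto
  qed
  finally show ?thesis unfolding \<sigma>_def by (simp only: mult.assoc mult.commute mult.left_commute)
qed

section \<open>Admissible test functions\<close>

lemma integrable_vanishing_bound:
  fixes f :: "'a::euclidean_space \<Rightarrow> real"
  assumes h: "locally_integrable h" and [measurable]: "f \<in> borel_measurable borel"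
    and le: "\<And>x. \<bar>f x\<bar> \<le> h x" and z: "\<And>x. R < norm x \<Longrightarrow> f x = 0"
  shows "integrable lborel f"
proof (rule Bochner_Integration.integrable_bound)
  show "integrable lborel (\<lambda>x. indicat_real (cball 0 R) x * h x)"
    using h by (simp add: locally_integrable_def set_integrable_def)
  show "AE x in lborel. norm (f x) \<le> norm (indicat_real (cball 0 R) x * h x)"
  proof (intro AE_I2)
    fix x show "norm (f x) \<le> norm (indicat_real (cball 0 R) x * h x)"
      using le[of x] z[of x] by (cases "norm x \<le> R") auto
  qed
qed simp

text \<open>A Borel representative that is nonnegative everywhere lets the chain rule and the powers
  be used pointwise. \<open>G\<close> is kept as a weak gradient of \<open>u\<close> too, because
  the weak inequality is stated for \<open>u\<close> and not for \<open>u0\<close>.\<close>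

lemma nonneg_weak_solution_representative:
  fixes u :: "'a::euclidean_space \<Rightarrow> real"
  assumes sol: "nonneg_weak_solution p q s u"
  obtains u0 G where "u0 \<in> borel_measurable borel" "G \<in> borel_measurable borel" "\<And>x. 0 \<le> u0 x"
    "AE x in lebesgue. u x = u0 x" "has_weak_gradient u G" "has_weak_gradient u0 G"
    "locally_integrable (\<lambda>x. u0 x powr s)" "locally_integrable (\<lambda>x. norm (G x) powr p)"
proof -
  have u: "u \<in> Lp_loc p" "u \<in> Lp_loc s" "AE x in lebesgue. 0 \<le> u x"
    using sol by (auto simp: nonneg_weak_solution_def W1p_loc_def)
  obtain G' where G': "G' \<in> Lp_loc p" "has_weak_gradient u G'"
    using sol by (auto simp: nonneg_weak_solution_def W1p_loc_def)
  have "u \<in> borel_measurable lebesgue" "G' \<in> borel_measurable lebesgue"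
    using u G' by (auto simp: Lp_loc_def)
  then obtain u1 G where u1 [measurable]: "u1 \<in> borel_measurable borel" and ae1: "AE x in lebesgue. u x = u1 x"
    and G [measurable]: "G \<in> borel_measurable borel" and aeG: "AE x in lebesgue. G' x = G x"
    using lebesgue_borel_representative by metis
  define u0 where "u0 = (\<lambda>x. max 0 (u1 x))"
  have u0 [measurable]: "u0 \<in> borel_measurable borel" unfolding u0_def by measurable
  have ae0: "AE x in lebesgue. u x = u0 x"
    using ae1 u(3) by eventually_elim (simp add: u0_def max_def)
  have w0: "has_weak_gradient u0 G"
    by (rule has_weak_gradient_cong_AE[OF G'(2) ae0 aeG u0 G])
  \<comment> \<open>\<open>has_weak_gradient_cong_AE\<close> leads to Borel functions only, whereas
    \<open>u\<close> is known to be Lebesgue measurable; hence a direct argument.\<close>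
  have uG: "has_weak_gradient u G"
  proof -
    have m: "u \<in> borel_measurable lebesgue" "G \<in> borel_measurable lebesgue" "G' \<in> borel_measurable lebesgue"
      using u G' by (auto simp: Lp_loc_def intro: borel_imp_lebesgue_measurable)
    have "(LINT x|lebesgue. (G' x \<bullet> i) * \<phi> x) = (LINT x|lebesgue. (G x \<bullet> i) * \<phi> x)"
      if "\<phi> \<in> test_functions" "i \<in> Basis" for \<phi> i
    proof -
      have [measurable]: "\<phi> \<in> borel_measurable lebesgue"
        using test_functions_measurable[OF that] by (auto intro: borel_imp_lebesgue_measurable)
      note m [measurable]
      show ?thesis using aeG by (intro integral_cong_AE) auto
    qed
    then show ?thesis using G'(2) w0 by (auto simp: has_weak_gradient_def)
  qed
  have "u0 \<in> Lp_loc s" by (rule Lp_loc_cong_AE[OF u(2) u0 ae0])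
  then have "locally_integrable (\<lambda>x. u0 x powr s)"
    by (simp add: Lp_loc_borel_iff u0_def)
  moreover have "G \<in> Lp_loc p" by (rule Lp_loc_cong_AE[OF G'(1) G aeG])
  then have "locally_integrable (\<lambda>x. norm (G x) powr p)"
    by (simp add: Lp_loc_borel_iff)
  moreover have "0 \<le> u0 x" for x by (simp add: u0_def)
  ultimately show ?thesis using that u0 G ae0 uG w0 by blast
qed

text \<open>The integrability claims matter as much as the inequality: a Bochner integral that does
  not exist is 0 by convention, and a fraction of the integral with \<open>u0 x powr s\<close> will
  be subtracted from both sides. For \<open>1 < z\<close> and \<open>z \<le> p\<close> the flux is
  bounded by a multiple of \<open>1 + norm (G x) powr p\<close>, so local integrability for
  \<open>p\<close> covers \<open>q\<close> as well.\<close>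

lemma test_inequality:
  fixes u u0 :: "'a::euclidean_space \<Rightarrow> real"
  assumes sol: "nonneg_weak_solution p q s u" and pq: "1 < q" "q \<le> p"
    and [measurable]: "u0 \<in> borel_measurable borel" "G \<in> borel_measurable borel" and u0: "\<And>x. 0 \<le> u0 x"
    and ae: "AE x in lebesgue. u x = u0 x" and wu: "has_weak_gradient u G" and w: "has_weak_gradient u0 G"
    and ls: "locally_integrable (\<lambda>x. u0 x powr s)" and lp: "locally_integrable (\<lambda>x. norm (G x) powr p)"
    and [measurable]: "g \<in> borel_measurable borel" "g' \<in> borel_measurable borel"
    and g: "\<And>v. 0 \<le> v \<Longrightarrow> (g has_real_derivative g' v) (at v)"
    and g'c: "continuous_on {0..} g'" and g0: "\<And>v. 0 \<le> v \<Longrightarrow> 0 \<le> g v"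
    and B: "\<And>v. 0 \<le> v \<Longrightarrow> \<bar>g v\<bar> \<le> B" "\<And>v. 0 \<le> v \<Longrightarrow> \<bar>g' v\<bar> \<le> B"
    and c: "\<And>x. (c has_derivative (\<lambda>h. Dc x \<bullet> h)) (at x)" "continuous_on UNIV Dc" "\<And>x. 0 \<le> c x"
    and R: "\<And>x. R \<le> norm x \<Longrightarrow> c x = 0"
  defines "\<Psi> \<equiv> \<lambda>x. g (u0 x) *\<^sub>R Dc x + (c x * g' (u0 x)) *\<^sub>R G x"
  shows "\<And>z. 1 < z \<Longrightarrow> z \<le> p \<Longrightarrow> integrable lborel (\<lambda>x. norm (G x) powr (z - 2) * (G x \<bullet> \<Psi> x))"
    and "integrable lborel (\<lambda>x. u0 x powr s * (c x * g (u0 x)))"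
    and "(\<integral>x. u0 x powr s * (c x * g (u0 x)) \<partial>lborel) \<le>
      (\<integral>x. norm (G x) powr (p - 2) * (G x \<bullet> \<Psi> x) \<partial>lborel) + (\<integral>x. norm (G x) powr (q - 2) * (G x \<bullet> \<Psi> x) \<partial>lborel)"
proof -
  let ?\<psi> = "\<lambda>x. c x * g (u0 x)"
  have cc: "continuous_on UNIV c"
    using c(1) by (intro continuous_at_imp_continuous_on) (auto intro: has_derivative_continuous)
  have [measurable]: "c \<in> borel_measurable borel" "Dc \<in> borel_measurable borel"
    using cc c(2) by (auto intro: borel_measurable_continuous_onI)
  have \<Psi>m [measurable]: "\<Psi> \<in> borel_measurable borel" unfolding \<Psi>_def by measurable
  have Dc0: "Dc x = 0" if "R < norm x" for x
  proof (rule euclidean_eqI)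
    fix i :: 'a assume "i \<in> Basis"
    show "Dc x \<bullet> i = 0 \<bullet> i"
      using has_dir_deriv_vanishing[OF has_derivative_imp_dir_deriv[OF c(1)] R that] by simp
  qed
  obtain X where X: "X > 0" "\<And>x. \<bar>c x\<bar> \<le> X"
    using bounded_if_vanishing[OF cc R] by blast
  have Dn0: "norm (Dc x) = 0" if "R + 1 \<le> norm x" for x using Dc0 that by simp
  have cDn: "continuous_on UNIV (\<lambda>x. norm (Dc x))" using c(2) by (intro continuous_intros)
  obtain Y where Y: "Y > 0" "\<And>x. \<bar>norm (Dc x)\<bar> \<le> Y"
    using bounded_if_vanishing[OF cDn Dn0] by blast
  have B0: "0 \<le> B" using B(1)[of 0] by linarith
  have \<psi>b: "\<bar>?\<psi> x\<bar> \<le> X * B" for x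
    unfolding abs_mult using X B(1)[OF u0] B0 by (intro mult_mono) auto
  define C where "C = B * Y + X * B"
  have C0: "0 \<le> C" using B0 X Y by (simp add: C_def)
  have \<Psi>b: "norm (\<Psi> x) \<le> C * (1 + norm (G x))" for x
  proof -
    have "norm (\<Psi> x) \<le> \<bar>g (u0 x)\<bar> * norm (Dc x) + \<bar>c x * g' (u0 x)\<bar> * norm (G x)"
      unfolding \<Psi>_def using norm_triangle_ineq by (metis norm_scaleR)
    also have "\<dots> \<le> B * Y + (X * B) * norm (G x)"
      unfolding abs_mult using X Y B(1)[OF u0] B(2)[OF u0] B0
      by (intro add_mono mult_mono mult_right_mono) auto
    also have "\<dots> \<le> C * (1 + norm (G x))"
      using B0 X Y by (simp add: C_def algebra_simps)
    finally show ?thesis .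
  qed
  have \<Psi>0: "\<Psi> x = 0" if "R < norm x" for x
    using Dc0[OF that] R[of x] that by (simp add: \<Psi>_def)
  have w\<psi>: "has_weak_gradient ?\<psi> \<Psi>"
    unfolding \<Psi>_def
    by (rule has_weak_gradient_cutoff_compose[OF w u0 _ _ _ _ g g'c B c(1,2) R]) measurable
  have \<psi>p: "integrable lborel (\<lambda>x. norm (?\<psi> x) powr p)"
  proof (rule integrable_vanishing[where R = R and B = "(X * B) powr p"])
    show "\<bar>norm (?\<psi> x) powr p\<bar> \<le> (X * B) powr p" for x
      using \<psi>b[of x] pq by (simp add: powr_mono2)
    show "norm (?\<psi> x) powr p = 0" if "R < norm x" for x using R[of x] that by simp
  qed measurable
  have \<Psi>p: "integrable lborel (\<lambda>x. norm (\<Psi> x) powr p)"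
  proof (rule integrable_vanishing_bound[where R = R])
    show "locally_integrable (\<lambda>x. C powr p * (2 powr p * (1 + norm (G x) powr p)))"
      by (intro locally_integrable_cmult locally_integrable_add locally_integrable_const lp)
    show "\<bar>norm (\<Psi> x) powr p\<bar> \<le> C powr p * (2 powr p * (1 + norm (G x) powr p))" for x
    proof -
      have "norm (\<Psi> x) powr p \<le> (C * (1 + norm (G x))) powr p"
        using \<Psi>b[of x] pq by (intro powr_mono2) auto
      also have "\<dots> = C powr p * (1 + norm (G x)) powr p" by (simp add: powr_mult)
      also have "\<dots> \<le> C powr p * (2 powr p * (1 + norm (G x) powr p))"
        using pq by (intro mult_left_mono powr_1_add_le) auto
      finally show ?thesis by simp
    qed
    show "norm (\<Psi> x) powr p = 0" if "R < norm x" for x using \<Psi>0[OF that] by simp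
  qed measurable
  show int: "integrable lborel (\<lambda>x. norm (G x) powr (z - 2) * (G x \<bullet> \<Psi> x))" if z: "1 < z" "z \<le> p" for z
  proof (rule integrable_vanishing_bound[where R = R])
    show "locally_integrable (\<lambda>x. C * (2 * (1 + norm (G x) powr p)))"
      by (intro locally_integrable_cmult locally_integrable_add locally_integrable_const lp)
    show "\<bar>norm (G x) powr (z - 2) * (G x \<bullet> \<Psi> x)\<bar> \<le> C * (2 * (1 + norm (G x) powr p))" for x
    proof -
      have "\<bar>norm (G x) powr (z - 2) * (G x \<bullet> \<Psi> x)\<bar> \<le> norm (G x) powr (z - 2) * (norm (G x) * norm (\<Psi> x))"
        unfolding abs_mult using Cauchy_Schwarz_ineq2 by (intro mult_mono) auto
      also have "\<dots> \<le> norm (G x) powr (z - 2) * (norm (G x) * (C * (1 + norm (G x))))"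
        using \<Psi>b by (intro mult_left_mono) auto
      also have "\<dots> = C * (norm (G x) powr (z - 1) + norm (G x) powr z)"
        by (cases "G x = 0") (auto simp: powr_diff field_simps power2_eq_square)
      also have "\<dots> \<le> C * ((1 + norm (G x) powr p) + (1 + norm (G x) powr p))"
        using z C0 by (intro mult_left_mono add_mono powr_le_1_add_powr) auto
      finally show ?thesis by simp
    qed
    show "norm (G x) powr (z - 2) * (G x \<bullet> \<Psi> x) = 0" if "R < norm x" for x using \<Psi>0[OF that] by simp
  qed measurable
  show us: "integrable lborel (\<lambda>x. u0 x powr s * ?\<psi> x)"
    by (rule locally_integrable_mult[OF ls _ \<psi>b, where R = R]) (use R in auto)
  have \<psi>W: "?\<psi> \<in> W1p p"
  proof -
    have "?\<psi> \<in> Lp_space p"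
      unfolding Lp_space_def using \<psi>p by (auto simp: integrable_lebesgue_iff intro!: borel_imp_lebesgue_measurable)
    moreover have "\<Psi> \<in> Lp_space p"
      unfolding Lp_space_def using \<Psi>p by (auto simp: integrable_lebesgue_iff intro!: borel_imp_lebesgue_measurable)
    ultimately show ?thesis using w\<psi> unfolding W1p_def by blast
  qed
  have \<psi>L: "?\<psi> \<in> Linf_space"
    unfolding Linf_space_def using \<psi>b by (auto intro!: borel_imp_lebesgue_measurable exI[of _ "X * B"])
  have \<psi>0: "AE x in lebesgue. 0 \<le> ?\<psi> x"
    using c(3) g0 u0 by (intro AE_I2) auto
  have \<psi>K: "compact_ess_support ?\<psi>"
    unfolding compact_ess_support_def using R by (intro exI[of _ "cball 0 R"]) auto
  have ineq: "- (LINT x|lebesgue. norm (G x) powr (p - 2) * (G x \<bullet> \<Psi> x))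
        - (LINT x|lebesgue. norm (G x) powr (q - 2) * (G x \<bullet> \<Psi> x))
        + (LINT x|lebesgue. u x powr s * ?\<psi> x) \<le> 0"
    by (rule sol[unfolded nonneg_weak_solution_def, THEN conjunct2, THEN conjunct2, rule_format,
          OF IntI[OF \<psi>W \<psi>L], OF \<psi>0 \<psi>K wu w\<psi>])
  have "(LINT x|lebesgue. u x powr s * ?\<psi> x) = (LINT x|lebesgue. u0 x powr s * ?\<psi> x)"
  proof (rule integral_cong_AE)
    have [measurable]: "u \<in> borel_measurable lebesgue" "?\<psi> \<in> borel_measurable lebesgue"
      using wu \<psi>L by (auto simp: has_weak_gradient_def Lp_loc_def Linf_space_def)
    show "(\<lambda>x. u x powr s * ?\<psi> x) \<in> borel_measurable lebesgue" by measurable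
    show "(\<lambda>x. u0 x powr s * ?\<psi> x) \<in> borel_measurable lebesgue"
      by (rule borel_imp_lebesgue_measurable) measurable
    show "AE x in lebesgue. u x powr s * ?\<psi> x = u0 x powr s * ?\<psi> x" using ae by eventually_elim simp
  qed
  then show "(\<integral>x. u0 x powr s * ?\<psi> x \<partial>lborel) \<le>
      (\<integral>x. norm (G x) powr (p - 2) * (G x \<bullet> \<Psi> x) \<partial>lborel) + (\<integral>x. norm (G x) powr (q - 2) * (G x \<bullet> \<Psi> x) \<partial>lborel)"
    using ineq by (simp add: integral_lebesgue_eq)
qed

section \<open>The logarithmic cutoff\<close>

text \<open>A smooth substitute for \<open>norm x\<close> that is bounded away from 0.\<close>

definition bracket :: "'a::euclidean_space \<Rightarrow> real" where
  "bracket x = sqrt (1 + x \<bullet> x)"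

lemma bracket_ge_1: "1 \<le> bracket x"
  by (simp add: bracket_def)

lemma norm_le_bracket: "norm x \<le> bracket x"
  unfolding bracket_def norm_eq_sqrt_inner by simp

lemma bracket_sq: "bracket x * bracket x = 1 + x \<bullet> x"
  unfolding bracket_def by (simp add: add_nonneg_nonneg)

lemma ln_bracket: "ln (1 + x \<bullet> x) = 2 * ln (bracket x)"
  unfolding bracket_def by (simp add: ln_sqrt add_pos_nonneg)

lemma bracket_measurable [measurable]: "bracket \<in> borel_measurable borel"
  unfolding bracket_def by measurable

lemma max_sq_deriv: "((\<lambda>r. (max 0 r)\<^sup>2) has_real_derivative 2 * max 0 r) (at (r::real))"
proof -
  consider "r < 0" | "r = 0" | "r > 0" by linarith
  then show ?thesis
  proof cases
    case 1
    have "eventually (\<lambda>y. y < 0) (nhds r)"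
      using 1 by (intro order_tendstoD(2)[OF filterlim_ident]) auto
    then have "eventually (\<lambda>y. (max 0 y)\<^sup>2 = 0) (nhds r)"
      by eventually_elim simp
    then have "((\<lambda>r. (max 0 r)\<^sup>2) has_real_derivative 0) (at r) \<longleftrightarrow> ((\<lambda>_. 0) has_real_derivative 0) (at r)"
      by (rule DERIV_cong_ev[OF refl _ refl])
    then show ?thesis using 1 by simp
  next
    case 3
    have "eventually (\<lambda>y. y > 0) (nhds r)"
      using 3 by (intro order_tendstoD(1)[OF filterlim_ident]) auto
    then have "eventually (\<lambda>y. (max 0 y)\<^sup>2 = y\<^sup>2) (nhds r)"
      by eventually_elim simp
    then have "((\<lambda>r. (max 0 r)\<^sup>2) has_real_derivative 2 * r) (at r) \<longleftrightarrow> ((\<lambda>r. r\<^sup>2) has_real_derivative 2 * r) (at r)"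
      by (rule DERIV_cong_ev[OF refl _ refl])
    moreover have "((\<lambda>r. r\<^sup>2) has_real_derivative 2 * r) (at r)"
      by (auto intro!: derivative_eq_intros)
    ultimately show ?thesis using 3 by simp
  next
    case 2
    have "((\<lambda>h::real. (max 0 h)\<^sup>2 / h) \<longlongrightarrow> 0) (at 0)"
    proof (rule Lim_null_comparison)
      show "eventually (\<lambda>h::real. norm ((max 0 h)\<^sup>2 / h) \<le> \<bar>h\<bar>) (at 0)"
        by (intro always_eventually allI) (auto simp: max_def power2_eq_square)
      show "((\<lambda>h::real. \<bar>h\<bar>) \<longlongrightarrow> 0) (at 0)"
        using tendsto_rabs[OF tendsto_ident_at[of "0::real" UNIV]] by simp
    qed
    then show ?thesis using 2 by (simp add: DERIV_def)
  qed
qed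

text \<open>The squared positive part is a simple continuously differentiable gluing; nesting it
  treats both ends of the unit interval, over which the profile falls from 1 to 0. Smoothness of
  first order is the right level, since \<open>\<psi>\<close> has to lie in \<open>W1p\<close> and
  not among the test functions.\<close>

definition cutoff_profile :: "real \<Rightarrow> real" where
  "cutoff_profile r = (max 0 (1 - (max 0 r)\<^sup>2))\<^sup>2"

definition cutoff_profile' :: "real \<Rightarrow> real" where
  "cutoff_profile' r = - 4 * max 0 (1 - (max 0 r)\<^sup>2) * max 0 r"

lemma cutoff_profile_deriv: "(cutoff_profile has_real_derivative cutoff_profile' r) (at r)"
proof -
  have "((\<lambda>r. 1 - (max 0 r)\<^sup>2) has_real_derivative - (2 * max 0 r)) (at r)"
    using DERIV_diff[OF DERIV_const max_sq_deriv, of 1 r] by simp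
  from DERIV_chain2[OF max_sq_deriv this] show ?thesis
    unfolding cutoff_profile_def[abs_def] cutoff_profile'_def by (simp add: mult.assoc)
qed

lemma cutoff_profile_bounds: "0 \<le> cutoff_profile r" "cutoff_profile r \<le> 1"
proof -
  show "0 \<le> cutoff_profile r" by (simp add: cutoff_profile_def)
  have "max 0 (1 - (max 0 r)\<^sup>2) \<le> 1" by simp
  then show "cutoff_profile r \<le> 1"
    unfolding cutoff_profile_def by (intro power_le_one) auto
qed

lemma cutoff_profile_eq_1: "r \<le> 0 \<Longrightarrow> cutoff_profile r = 1"
  by (simp add: cutoff_profile_def)

lemma max_profile_eq_0: "1 \<le> r \<Longrightarrow> max 0 (1 - (max 0 r)\<^sup>2) = (0::real)"
  using one_le_power[of r 2] by (simp add: max_absorb1 max_absorb2)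

lemma cutoff_profile_eq_0: "1 \<le> r \<Longrightarrow> cutoff_profile r = 0"
  by (simp add: cutoff_profile_def max_profile_eq_0)

lemma cutoff_profile'_eq_0: "r \<le> 0 \<or> 1 \<le> r \<Longrightarrow> cutoff_profile' r = 0"
  using max_profile_eq_0[of r] by (auto simp: cutoff_profile'_def)

lemma cutoff_profile'_bound: "\<bar>cutoff_profile' r\<bar> \<le> 4"
proof (cases "r \<le> 0 \<or> 1 \<le> r")
  case False
  then have r: "0 \<le> r" "r \<le> 1" by auto
  then have "(1 - r\<^sup>2) * r \<le> 1 * 1" by (intro mult_mono) (auto simp: power_le_one)
  moreover have "0 \<le> (1 - r\<^sup>2) * r" using r by (intro mult_nonneg_nonneg) (auto simp: power_le_one)
  moreover have "cutoff_profile' r = - 4 * ((1 - r\<^sup>2) * r)"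
    using r by (simp add: cutoff_profile'_def max_def power_le_one algebra_simps)
  ultimately show ?thesis by (simp only: abs_mult)
qed (simp add: cutoff_profile'_eq_0)

text \<open>The argument of the profile equals \<open>ln (bracket x) / real N - 1\<close>; writing
  it with \<open>1 + x \<bullet> x\<close> avoids differentiating a square root.\<close>

definition log_cutoff :: "nat \<Rightarrow> 'a::euclidean_space \<Rightarrow> real" where
  "log_cutoff N x = cutoff_profile (ln (1 + x \<bullet> x) / (2 * real N) - 1)"

definition log_cutoff_grad :: "nat \<Rightarrow> 'a::euclidean_space \<Rightarrow> 'a" where
  "log_cutoff_grad N x = (cutoff_profile' (ln (1 + x \<bullet> x) / (2 * real N) - 1) / (real N * (1 + x \<bullet> x))) *\<^sub>R x"

lemma one_plus_inner_pos: "0 < 1 + x \<bullet> (x::'a::real_inner)"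
  by (simp add: add_pos_nonneg)

lemma log_cutoff_has_derivative:
  assumes "0 < N"
  shows "(log_cutoff N has_derivative (\<lambda>h. log_cutoff_grad N x \<bullet> h)) (at x)"
proof -
  let ?\<tau> = "\<lambda>x::'a. ln (1 + x \<bullet> x) / (2 * real N) - 1"
  have "(?\<tau> has_derivative (\<lambda>h. (x \<bullet> h) / (real N * (1 + x \<bullet> x)))) (at x)"
    using one_plus_inner_pos[of x] assms
    by (auto intro!: derivative_eq_intros simp: inner_commute divide_simps)
  from has_derivative_compose[OF this cutoff_profile_deriv[unfolded has_field_derivative_def]]
  show ?thesis
    unfolding log_cutoff_def[abs_def] log_cutoff_grad_def by (simp add: mult.commute)
qed

lemma continuous_log_cutoff_grad:
  assumes "0 < N"
  shows "continuous_on UNIV (log_cutoff_grad N :: 'a::euclidean_space \<Rightarrow> 'a)"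
proof -
  have nz: "1 + x \<bullet> x \<noteq> 0" for x :: 'a using one_plus_inner_pos[of x] by simp
  have "continuous_on UNIV cutoff_profile'"
    unfolding cutoff_profile'_def[abs_def] by (intro continuous_intros)
  then have "continuous_on UNIV (\<lambda>x::'a. cutoff_profile' (ln (1 + x \<bullet> x) / (2 * real N) - 1))"
    by (rule continuous_on_compose2) (use nz assms in \<open>auto intro!: continuous_intros\<close>)
  moreover have "continuous_on UNIV (\<lambda>x::'a. 1 / (1 + x \<bullet> x))"
    using nz by (intro continuous_intros) auto
  ultimately have "continuous_on UNIV (\<lambda>x::'a. (1 / real N) *\<^sub>R (cutoff_profile' (ln (1 + x \<bullet> x) / (2 * real N) - 1) * (1 / (1 + x \<bullet> x))) *\<^sub>R x)"
    by (intro continuous_on_scaleR continuous_on_mult continuous_on_const continuous_on_id)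
  then show ?thesis unfolding log_cutoff_grad_def[abs_def] by simp
qed

lemma log_cutoff_bounds: "0 \<le> log_cutoff N x" "log_cutoff N x \<le> 1"
  by (simp_all add: log_cutoff_def cutoff_profile_bounds)

lemma log_cutoff_arg: 
  assumes "0 < N"
  shows "ln (1 + x \<bullet> x) / (2 * real N) - 1 \<le> 0 \<longleftrightarrow> bracket x \<le> exp (real N)"
    "1 \<le> ln (1 + x \<bullet> x) / (2 * real N) - 1 \<longleftrightarrow> exp (2 * real N) \<le> bracket x"
proof -
  have b: "0 < bracket x" using bracket_ge_1[of x] by linarith
  have "ln (1 + x \<bullet> x) / (2 * real N) - 1 \<le> 0 \<longleftrightarrow> ln (bracket x) \<le> real N"
    using assms by (simp add: ln_bracket divide_le_eq)
  also have "\<dots> \<longleftrightarrow> bracket x \<le> exp (real N)" using b by (metis exp_le_cancel_iff exp_ln)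
  finally show "ln (1 + x \<bullet> x) / (2 * real N) - 1 \<le> 0 \<longleftrightarrow> bracket x \<le> exp (real N)" .
  have "1 \<le> ln (1 + x \<bullet> x) / (2 * real N) - 1 \<longleftrightarrow> 2 * real N \<le> ln (bracket x)"
    using assms by (simp add: ln_bracket le_diff_eq le_divide_eq)
  also have "\<dots> \<longleftrightarrow> exp (2 * real N) \<le> bracket x" using b by (metis exp_le_cancel_iff exp_ln)
  finally show "1 \<le> ln (1 + x \<bullet> x) / (2 * real N) - 1 \<longleftrightarrow> exp (2 * real N) \<le> bracket x" .
qed

lemma log_cutoff_eq_1: "0 < N \<Longrightarrow> bracket x \<le> exp (real N) \<Longrightarrow> log_cutoff N x = 1"
  unfolding log_cutoff_def using log_cutoff_arg(1)[of N x] by (intro cutoff_profile_eq_1) auto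

lemma log_cutoff_eq_0: 
  assumes "0 < N" "exp (2 * real N) \<le> norm x"
  shows "log_cutoff N x = 0"
  unfolding log_cutoff_def using log_cutoff_arg(2)[OF assms(1), of x] assms(2) norm_le_bracket[of x]
  by (intro cutoff_profile_eq_0) auto

definition annulus :: "nat \<Rightarrow> 'a::euclidean_space set" where
  "annulus N = {x. exp (real N) \<le> bracket x \<and> bracket x \<le> exp (2 * real N)}"

lemma annulus_measurable [measurable]: "annulus N \<in> sets borel"
  unfolding annulus_def by measurable

lemma log_cutoff_grad_eq_0: "0 < N \<Longrightarrow> x \<notin> annulus N \<Longrightarrow> log_cutoff_grad N x = 0"
  using log_cutoff_arg[of N x] cutoff_profile'_eq_0[of "ln (1 + x \<bullet> x) / (2 * real N) - 1"]
  by (auto simp: log_cutoff_grad_def annulus_def)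

lemma norm_log_cutoff_grad_le:
  assumes "0 < N"
  shows "norm (log_cutoff_grad N x) \<le> 4 / (real N * bracket x)"
proof -
  have b: "0 < bracket x" using bracket_ge_1[of x] by linarith
  have "norm (log_cutoff_grad N x) = \<bar>cutoff_profile' (ln (1 + x \<bullet> x) / (2 * real N) - 1)\<bar> * (norm x / (real N * (1 + x \<bullet> x)))"
    using one_plus_inner_pos[of x] by (simp add: log_cutoff_grad_def abs_mult)
  also have "\<dots> \<le> 4 * (bracket x / (real N * (1 + x \<bullet> x)))"
    using one_plus_inner_pos[of x] norm_le_bracket[of x] cutoff_profile'_bound
    by (intro mult_mono divide_right_mono) auto
  also have "\<dots> = 4 / (real N * bracket x)"
    unfolding bracket_sq[symmetric] using b by simp
  finally show ?thesis .
qed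

text \<open>The annulus is covered by \<open>N\<close> shells on which \<open>bracket x\<close> lies
  between \<open>exp (real j)\<close> and \<open>exp (real j + 1)\<close>. On each, the integrand is
  at most \<open>exp (- real j * n)\<close> with \<open>n\<close> the dimension, and the volume of
  the enclosing ball of radius \<open>exp (real j + 1)\<close> cancels this up to
  \<open>exp n\<close>; every shell contributes the same amount.\<close>

lemma integral_annulus_le:
  fixes N :: nat
  assumes "0 < N"
  shows "integrable lborel (\<lambda>x::'a::euclidean_space. indicat_real (annulus N) x * bracket x powr (- real DIM('a)))" (is ?I)
    and "(\<integral>x. indicat_real (annulus N) x * bracket (x::'a) powr (- real DIM('a)) \<partial>lborel)
      \<le> real N * (unit_ball_vol (real DIM('a)) * exp (real DIM('a)))" (is ?L)
proof -
  let ?n = "real DIM('a)"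
  let ?f = "\<lambda>x::'a. indicat_real (annulus N) x * bracket x powr (- ?n)"
  let ?g = "\<lambda>x::'a. \<Sum>j\<in>{N..<2 * N}. exp (- real j * ?n) * indicat_real (cball 0 (exp (real j + 1))) x"
  have ib: "integrable lborel (\<lambda>x::'a. exp (- real j * ?n) * indicat_real (cball 0 (exp (real j + 1))) x)" for j
    by (intro integrable_mult_right integrable_real_indicator emeasure_bounded_finite) auto
  then have ig: "integrable lborel ?g" by (intro Bochner_Integration.integrable_sum)
  have le: "?f x \<le> ?g x" for x
  proof (cases "x \<in> annulus N")
    case False
    then show ?thesis by (auto intro!: sum_nonneg)
  next
    case True
    then have x: "exp (real N) \<le> bracket x" "bracket x \<le> exp (2 * real N)" by (auto simp: annulus_def)
    have "\<exists>j\<in>{N..<2 * N}. exp (real j) \<le> bracket x \<and> bracket x \<le> exp (real j + 1)"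
    proof -
      define J where "J = Max {j\<in>{N..<2 * N}. exp (real j) \<le> bracket x}"
      have "N \<in> {j\<in>{N..<2 * N}. exp (real j) \<le> bracket x}" using x assms by auto
      then have J: "J \<in> {j\<in>{N..<2 * N}. exp (real j) \<le> bracket x}"
        unfolding J_def by (intro Max_in) (simp, blast)
      have "bracket x \<le> exp (real J + 1)"
      proof (cases "Suc J < 2 * N")
        case True
        have "\<not> exp (real (Suc J)) \<le> bracket x"
        proof
          assume "exp (real (Suc J)) \<le> bracket x"
          then have "Suc J \<in> {j\<in>{N..<2 * N}. exp (real j) \<le> bracket x}" using J True by auto
          then have "Suc J \<le> J" unfolding J_def by (intro Max_ge) auto
          then show False by simp
        qed
        then show ?thesis by (simp add: add.commute)
      next
        case False
        \<comment> \<open>In the last shell the upper bound comes from the outer radius of the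
          annulus.\<close>
        then have "2 * N \<le> J + 1" by simp
        then have "2 * real N \<le> real J + 1" by linarith
        then show ?thesis using x(2) by (smt (verit) exp_le_cancel_iff)
      qed
      then show ?thesis using J by auto
    qed
    then obtain j where j: "j \<in> {N..<2 * N}" "exp (real j) \<le> bracket x" "bracket x \<le> exp (real j + 1)" by auto
    have "bracket x powr (- ?n) \<le> exp (real j) powr (- ?n)"
      using j(2) by (intro powr_mono2') auto
    also have "\<dots> = exp (- real j * ?n) * indicat_real (cball 0 (exp (real j + 1))) x"
      using norm_le_bracket[of x] j(3) by (simp add: powr_def mult.commute)
    also have "\<dots> \<le> ?g x"
      using j(1) by (intro member_le_sum) auto
    finally show ?thesis using True by simp
  qed
  show ?I
  proof (rule Bochner_Integration.integrable_bound[OF ig])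
    show "AE x in lborel. norm (?f x) \<le> norm (?g x)"
    proof (intro AE_I2)
      fix x :: 'a
      have "0 \<le> ?f x" by simp
      then show "norm (?f x) \<le> norm (?g x)"
        unfolding real_norm_def using le[of x] by linarith
    qed
  qed measurable
  have "(\<integral>x. ?f x \<partial>lborel) \<le> (\<integral>x. ?g x \<partial>lborel)"
    by (intro integral_mono ig le) fact
  also have "\<dots> = (\<Sum>j\<in>{N..<2 * N}. exp (- real j * ?n) * measure lborel (cball (0::'a) (exp (real j + 1))))"
    using ib by (subst Bochner_Integration.integral_sum) auto
  also have "\<dots> = (\<Sum>j\<in>{N..<2 * N}. unit_ball_vol ?n * exp ?n)"
  proof (intro sum.cong refl)
    fix j
    have "exp (- real j * ?n) * exp (real j + 1) ^ DIM('a) = exp ?n"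
      by (simp add: exp_of_nat_mult[symmetric] exp_add[symmetric] algebra_simps)
    then show "exp (- real j * ?n) * measure lborel (cball (0::'a) (exp (real j + 1))) = unit_ball_vol ?n * exp ?n"
      by (simp add: content_cball mult.left_commute)
  qed
  finally show ?L by simp
qed

section \<open>The main estimate\<close>

text \<open>The product of the constants in \<open>absorb_power\<close> and \<open>critical_decay\<close>.\<close>

definition flux_const :: "nat \<Rightarrow> real \<Rightarrow> real \<Rightarrow> real" where
  "flux_const k s z = 2 powr ((s + 2) * ((z - 1) / (s - z + 1))) *
     (((4 * real k) powr z) powr (s / (s - z + 1)) * exp (2 * z / (s - z + 1)))"

text \<open>\<open>flux_le\<close>, \<open>absorb_power\<close> and \<open>critical_decay\<close>
  combined pointwise for the actual cutoff. Outside the annulus the gradient of the cutoff vanishes,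
  so the left side is at most 0. The indicator of a ball in the last summand makes an otherwise
  constant error integrable.\<close>

lemma flux_cutoff_le:
  fixes G x :: "'a::euclidean_space"
  assumes z: "1 < z" "z - 1 < s" and n: "real DIM('a) * (s - z + 1) \<le> z * s"
    and k: "2 \<le> k" "z * s \<le> real k * (s - z + 1)" and N: "2 \<le> real N * (z - 1)"
    and u: "0 \<le> u" and \<delta>: "0 < \<delta>"
  shows "norm G powr (z - 2) * (G \<bullet> ((u + \<delta>) powr (- (1 / real N)) *\<^sub>R ((real k * log_cutoff N x ^ (k - 1)) *\<^sub>R log_cutoff_grad N x)
      + (log_cutoff N x ^ k * (- (1 / real N) * (u + \<delta>) powr (- (1 / real N) - 1))) *\<^sub>R G))
    \<le> 1 / 4 * (u powr s * (u + \<delta>) powr (- (1 / real N)) * log_cutoff N x ^ k)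
      + flux_const k s z * real N powr (- 1 - (z - 1) / (2 * (s - z + 1))) * (indicat_real (annulus N) x * bracket x powr (- real DIM('a)))
      + (4 * real k) powr z * (2 * \<delta>) powr (z - 1 - 1 / real N) * indicat_real (cball 0 (exp (2 * real N))) x"
    (is "?L \<le> ?A + ?B + ?C")
proof -
  have N0: "1 \<le> real N" "0 < N" using N z by (cases N; simp)+
  let ?t = "1 / real N" and ?\<phi> = "log_cutoff N x" and ?D = "log_cutoff_grad N x" and ?v = "u + \<delta>"
  let ?M = "(4 * real k) powr z"
  have t: "0 < ?t" using N0 by simp
  have "?t \<le> (z - 1) / 2" using N N0 by (simp add: field_simps)
  then have t2: "?t < z - 1" using z by simp
  have v: "0 < ?v" using u \<delta> by simp
  have b: "1 \<le> bracket x" by (rule bracket_ge_1)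
  have nn: "0 \<le> ?A" "0 \<le> ?B" "0 \<le> ?C"
    using log_cutoff_bounds(1)[of N x] by (auto simp: flux_const_def)
  have L: "?L \<le> ?\<phi> ^ (k - 1) * ?v powr (- ?t) * ((real k * norm ?D) powr z * (?t * ?\<phi> / ?v) powr (1 - z))"
    by (rule flux_le[OF z(1) v t log_cutoff_bounds(1) k(1)])
  show ?thesis
  proof (cases "x \<in> annulus N \<and> ?\<phi> \<noteq> 0")
    case False
    then have "?\<phi> ^ (k - 1) * ?v powr (- ?t) * ((real k * norm ?D) powr z * (?t * ?\<phi> / ?v) powr (1 - z)) = 0"
      using log_cutoff_grad_eq_0[OF N0(2), of x] k(1) by auto
    then show ?thesis using L nn by linarith
  next
    case True
    then have \<phi>: "0 < ?\<phi>" "?\<phi> \<le> 1" using log_cutoff_bounds[of N x] by auto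
    have bx: "bracket x \<le> exp (2 * real N)" using True by (simp add: annulus_def)
    have xc: "x \<in> cball 0 (exp (2 * real N))" using bx norm_le_bracket[of x] by simp
    define K where "K = ?M / (real N * bracket x powr z)"
    have M1: "1 \<le> ?M" using k(1) z by (intro ge_one_powr_ge_zero) auto
    have K0: "0 < K" using k(1) N0 b unfolding K_def by (intro divide_pos_pos mult_pos_pos) auto
    \<comment> \<open>Removes \<open>x\<close> from the coefficient of the \<open>\<delta>\<close>
      term, which then integrates to a multiple of a volume.\<close>
    have KM: "K \<le> ?M"
    proof -
      have "1 * 1 \<le> real N * bracket x powr z"
        using N0 b z by (intro mult_mono ge_one_powr_ge_zero) auto
      then show ?thesis unfolding K_def using M1 by (simp add: divide_le_eq mult_le_cancel_left1)
    qed
    have K': "(real k * norm ?D) powr z * ?t powr (1 - z) \<le> K"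
    proof -
      have "(real k * norm ?D) powr z \<le> (real k * (4 / (real N * bracket x))) powr z"
        using z norm_log_cutoff_grad_le[OF N0(2), of x] by (intro powr_mono2 mult_left_mono) auto
      also have "\<dots> = ?M / (real N powr z * bracket x powr z)"
        using N0 b by (simp add: powr_divide powr_mult mult.commute)
      finally have "(real k * norm ?D) powr z * (real N powr z / real N) \<le>
          ?M / (real N powr z * bracket x powr z) * (real N powr z / real N)"
        by (rule mult_right_mono) simp
      moreover have "?t powr (1 - z) = real N powr z / real N"
        using N0 by (simp add: powr_divide powr_diff)
      moreover have "?M / (real N powr z * bracket x powr z) * (real N powr z / real N) = K"
        unfolding K_def using N0 by simp
      ultimately show ?thesis by (simp only:)
    qed
    have "?\<phi> ^ (k - 1) * ?v powr (- ?t) * ((real k * norm ?D) powr z * (?t * ?\<phi> / ?v) powr (1 - z)) =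
        ((real k * norm ?D) powr z * ?t powr (1 - z)) * (?\<phi> powr (real k - z) * ?v powr (z - 1 - ?t))"
    proof -
      have e1: "(?t * ?\<phi> / ?v) powr (1 - z) = ?t powr (1 - z) * (?\<phi> powr (1 - z) * ?v powr (z - 1))"
      proof -
        have "(?t * ?\<phi> / ?v) powr (1 - z) = (?t powr (1 - z) * ?\<phi> powr (1 - z)) / ?v powr (1 - z)"
          using t \<phi> v by (simp only: powr_divide powr_mult less_imp_le)
        also have "\<dots> = (?t powr (1 - z) * ?\<phi> powr (1 - z)) * ?v powr (- (1 - z))"
          by (simp only: powr_minus divide_inverse)
        finally show ?thesis by (simp add: mult.assoc)
      qed
      have e2: "?\<phi> ^ (k - 1) * ?\<phi> powr (1 - z) = ?\<phi> powr (real k - z)"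
        using \<phi>(1) k(1) by (simp add: powr_realpow[symmetric] powr_add[symmetric] of_nat_diff)
      have e3: "?v powr (- ?t) * ?v powr (z - 1) = ?v powr (z - 1 - ?t)"
        by (simp add: powr_add[symmetric])
      show ?thesis unfolding e1 e2[symmetric] e3[symmetric] by (simp only: mult.assoc mult.commute mult.left_commute)
    qed
    also have "\<dots> \<le> K * (?\<phi> powr (real k - z) * ?v powr (z - 1 - ?t))"
      by (intro mult_right_mono K') simp
    also have "\<dots> \<le> ?A + 2 powr ((s + 2) * ((z - 1) / (s - z + 1))) * K powr ((s - ?t) / (s - z + 1)) + K * (2 * \<delta>) powr (z - 1 - ?t)"
      by (rule absorb_power[OF K0 \<phi> u \<delta> t t2 z k(2)])
    also have "\<dots> \<le> ?A + ?B + ?C"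
    proof (intro add_mono order_refl)
      have "K powr ((s - ?t) / (s - z + 1)) \<le> ?M powr (s / (s - z + 1)) * exp (2 * z / (s - z + 1)) * (real N powr (- 1 - (z - 1) / (2 * (s - z + 1))) * bracket x powr (- real DIM('a)))"
        unfolding K_def by (rule critical_decay[OF z n M1 N b bx])
      then have "2 powr ((s + 2) * ((z - 1) / (s - z + 1))) * K powr ((s - ?t) / (s - z + 1)) \<le>
        2 powr ((s + 2) * ((z - 1) / (s - z + 1))) * (?M powr (s / (s - z + 1)) * exp (2 * z / (s - z + 1)) * (real N powr (- 1 - (z - 1) / (2 * (s - z + 1))) * bracket x powr (- real DIM('a))))"
        by (rule mult_left_mono) simp
      also have "\<dots> = ?B" using True unfolding flux_const_def by simp
      finally show "2 powr ((s + 2) * ((z - 1) / (s - z + 1))) * K powr ((s - ?t) / (s - z + 1)) \<le> ?B" .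
      show "K * (2 * \<delta>) powr (z - 1 - ?t) \<le> ?C" using KM xc by (simp add: mult_right_mono)
    qed
    finally show ?thesis using L by linarith
  qed
qed

lemma shifted_powr_deriv:
  assumes "0 < \<delta>" "0 \<le> v"
  shows "((\<lambda>v. (v + \<delta>) powr (- t)) has_real_derivative - t * (v + \<delta>) powr (- t - 1)) (at v)"
  using assms by (auto intro!: derivative_eq_intros)

text \<open>The fluxes for \<open>z = p\<close> and \<open>z = q\<close> each return a quarter of
  the integral on the left; the half that survives explains the factor 2. In \<open>E\<close> the
  factor \<open>N\<close> from the integral over the annulus is already cancelled against the
  \<open>- 1\<close> in the exponent of \<open>N\<close>.\<close>

lemma local_estimate:
  fixes u0 :: "'a::euclidean_space \<Rightarrow> real"
  assumes sol: "nonneg_weak_solution p q s u" and pq: "1 < q" "q \<le> p" and s: "p - 1 < s"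
    and [measurable]: "u0 \<in> borel_measurable borel" "G \<in> borel_measurable borel" and u0: "\<And>x. 0 \<le> u0 x"
    and ae: "AE x in lebesgue. u x = u0 x" and wu: "has_weak_gradient u G" and w: "has_weak_gradient u0 G"
    and ls: "locally_integrable (\<lambda>x. u0 x powr s)" and lp: "locally_integrable (\<lambda>x. norm (G x) powr p)"
    and n: "real DIM('a) * (s - p + 1) \<le> p * s" "real DIM('a) * (s - q + 1) \<le> q * s"
    and k: "2 \<le> k" "p * s \<le> real k * (s - p + 1)" "q * s \<le> real k * (s - q + 1)"
    and N: "2 \<le> real N * (q - 1)" and \<delta>: "0 < \<delta>"
  defines "V \<equiv> unit_ball_vol (real DIM('a)) * exp (real DIM('a))"
    and "E \<equiv> \<lambda>z. flux_const k s z * real N powr (- ((z - 1) / (2 * (s - z + 1))))"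
    and "F \<equiv> \<lambda>z. (4 * real k) powr z * (2 * \<delta>) powr (z - 1 - 1 / real N) * measure lborel (cball (0::'a) (exp (2 * real N)))"
  shows "integrable lborel (\<lambda>x. u0 x powr s * (log_cutoff N x ^ k * (u0 x + \<delta>) powr (- (1 / real N))))"
    and "(\<integral>x. u0 x powr s * (log_cutoff N x ^ k * (u0 x + \<delta>) powr (- (1 / real N))) \<partial>lborel)
      \<le> 2 * (E p * V + F p) + 2 * (E q * V + F q)"
proof -
  have N0: "1 \<le> real N" "0 < N" using N pq by (cases N; simp)+
  have "real N * (q - 1) \<le> real N * (p - 1)" using pq by (intro mult_left_mono) auto
  then have Np: "2 \<le> real N * (p - 1)" using N by linarith
  let ?t = "1 / real N"
  let ?g = "\<lambda>v. (v + \<delta>) powr (- ?t)" and ?g' = "\<lambda>v. - ?t * (v + \<delta>) powr (- ?t - 1)"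
  let ?c = "\<lambda>x::'a. log_cutoff N x ^ k"
  let ?Dc = "\<lambda>x::'a. (real k * log_cutoff N x ^ (k - 1)) *\<^sub>R log_cutoff_grad N x"
  let ?\<Psi> = "\<lambda>x. ?g (u0 x) *\<^sub>R ?Dc x + (?c x * ?g' (u0 x)) *\<^sub>R G x"
  define B where "B = \<delta> powr (- ?t) + \<delta> powr (- ?t - 1)"
  have t: "0 < ?t" "?t \<le> 1" using N0 by auto
  have g: "(?g has_real_derivative ?g' v) (at v)" if "0 \<le> v" for v
    by (rule shifted_powr_deriv[OF \<delta> that])
  have g'c: "continuous_on {0..} ?g'"
    using \<delta> by (intro continuous_intros) auto
  have gB: "\<bar>?g v\<bar> \<le> B" if "0 \<le> v" for v
  proof -
    have "(v + \<delta>) powr (- ?t) \<le> \<delta> powr (- ?t)" using \<delta> that t by (intro powr_mono2') auto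
    then show ?thesis by (simp add: B_def add_increasing2)
  qed
  have g'B: "\<bar>?g' v\<bar> \<le> B" if "0 \<le> v" for v
  proof -
    have "- ?t - 1 \<le> 0" using t by linarith
    then have "(v + \<delta>) powr (- ?t - 1) \<le> \<delta> powr (- ?t - 1)" using \<delta> that by (intro powr_mono2') auto
    then have "?t * (v + \<delta>) powr (- ?t - 1) \<le> 1 * \<delta> powr (- ?t - 1)" using t by (intro mult_mono) auto
    moreover have "\<bar>?g' v\<bar> = ?t * (v + \<delta>) powr (- ?t - 1)" using t by (simp add: abs_mult)
    moreover have "0 \<le> \<delta> powr (- ?t)" by simp
    ultimately show ?thesis unfolding B_def by linarith
  qed
  have c: "(?c has_derivative (\<lambda>h. ?Dc x \<bullet> h)) (at x)" for x
  proof -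
    have "(?c has_derivative (\<lambda>h. real k * (log_cutoff_grad N x \<bullet> h) * log_cutoff N x ^ (k - 1))) (at x)"
      by (rule has_derivative_power[OF log_cutoff_has_derivative[OF N0(2)]])
    then show ?thesis by (simp add: mult.assoc mult.commute mult.left_commute)
  qed
  have cl: "continuous_on UNIV (log_cutoff N :: 'a \<Rightarrow> real)"
    using log_cutoff_has_derivative[OF N0(2)] by (intro continuous_at_imp_continuous_on) (auto intro: has_derivative_continuous)
  have Dc: "continuous_on UNIV ?Dc"
    by (intro continuous_intros cl continuous_log_cutoff_grad N0)
  have c0: "0 \<le> ?c x" for x by (intro zero_le_power log_cutoff_bounds(1))
  have R: "?c x = 0" if "exp (2 * real N) \<le> norm x" for x
    using log_cutoff_eq_0[OF N0(2) that] k(1) by simp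
  note tests = test_inequality[where R = "exp (2 * real N)", OF sol pq \<open>u0 \<in> _\<close> \<open>G \<in> _\<close> u0 ae wu w ls lp _ _ g g'c _ gB g'B c Dc c0 R]
  have gm: "?g \<in> borel_measurable borel" "?g' \<in> borel_measurable borel" by measurable
  let ?I = "\<lambda>x. u0 x powr s * (?c x * ?g (u0 x))"
  let ?J = "\<lambda>z x. norm (G x) powr (z - 2) * (G x \<bullet> ?\<Psi> x)"
  have iJ: "integrable lborel (?J z)" if "1 < z" "z \<le> p" for z
    by (rule tests(1)[OF gm]) (use that in auto)
  show iI: "integrable lborel ?I"
    by (rule tests(2)[OF gm]) auto
  have main: "(\<integral>x. ?I x \<partial>lborel) \<le> (\<integral>x. ?J p x \<partial>lborel) + (\<integral>x. ?J q x \<partial>lborel)"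
    by (rule tests(3)[OF gm]) auto
  have J: "(\<integral>x. ?J z x \<partial>lborel) \<le> 1 / 4 * (\<integral>x. ?I x \<partial>lborel) + (E z * V + F z)"
    if z: "1 < z" "z \<le> p" "real DIM('a) * (s - z + 1) \<le> z * s" "z * s \<le> real k * (s - z + 1)" "2 \<le> real N * (z - 1)" for z
  proof -
    have zs: "z - 1 < s" using z s by simp
    let ?C1 = "flux_const k s z * real N powr (- 1 - (z - 1) / (2 * (s - z + 1)))"
    let ?C2 = "(4 * real k) powr z * (2 * \<delta>) powr (z - 1 - 1 / real N)"
    let ?f1 = "\<lambda>x::'a. indicat_real (annulus N) x * bracket x powr (- real DIM('a))"
    let ?f2 = "indicat_real (cball (0::'a) (exp (2 * real N)))"
    have i1: "integrable lborel ?f1" by (rule integral_annulus_le(1)[OF N0(2)])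
    have i2: "integrable lborel ?f2" by (intro integrable_real_indicator emeasure_bounded_finite) auto
    have "(\<integral>x. ?J z x \<partial>lborel) \<le> (\<integral>x. 1 / 4 * ?I x + ?C1 * ?f1 x + ?C2 * ?f2 x \<partial>lborel)"
    proof (intro integral_mono iJ z(1,2) Bochner_Integration.integrable_add integrable_mult_right i1 i2 iI)
      fix x
      show "?J z x \<le> 1 / 4 * ?I x + ?C1 * ?f1 x + ?C2 * ?f2 x"
        using flux_cutoff_le[OF z(1) zs z(3) k(1) z(4,5) u0 \<delta>, of "G x" x x] by (simp only: mult.assoc mult.commute[of "log_cutoff N x ^ k"])
    qed
    also have "\<dots> = 1 / 4 * (\<integral>x. ?I x \<partial>lborel) + ?C1 * (\<integral>x. ?f1 x \<partial>lborel) + ?C2 * (\<integral>x. ?f2 x \<partial>lborel)"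
      using i1 i2 iI by simp
    also have "?C1 * (\<integral>x. ?f1 x \<partial>lborel) \<le> ?C1 * (real N * V)"
      unfolding V_def by (intro mult_left_mono integral_annulus_le(2)[OF N0(2)]) (simp add: flux_const_def)
    also have "?C1 * (real N * V) = E z * V"
    proof -
      have "real N powr (- 1 - a) * real N = real N powr (- a)" for a
        using N0 by (simp add: powr_diff powr_minus divide_inverse)
      then show ?thesis unfolding E_def by (simp add: mult.assoc[symmetric])
    qed
    also have "?C2 * (\<integral>x. ?f2 x \<partial>lborel) = F z" by (simp add: F_def)
    finally show ?thesis by simp
  qed
  show "(\<integral>x. ?I x \<partial>lborel) \<le> 2 * (E p * V + F p) + 2 * (E q * V + F q)"
    using main J[of p] J[of q] pq n k N Np by simp
qed

theorem corollary1p9: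
  fixes p q s :: real and u :: "real ^ 'n \<Rightarrow> real"
  assumes "p \<ge> q" and "q > 1"
    and "p - 1 < s"
    and "(real CARD('n) - q) * s \<le> real CARD('n) * (q - 1)"
    and "nonneg_weak_solution p q s u"
  shows "AE x in lebesgue. u x = 0"
proof -
  let ?n = "real DIM(real ^ 'n)"
  have s0: "0 < s" and mp: "0 < s - p + 1" and mq: "0 < s - q + 1" using assms by auto
  \<comment> \<open>The hypothesis on \<open>s\<close>, rearranged into the form that
    \<open>critical_decay\<close> uses. As \<open>?n * (s - z + 1)\<close> decreases and
    \<open>z * s\<close> increases with \<open>z\<close>, it passes from \<open>q\<close> to
    \<open>p\<close>.\<close>
  have nq: "?n * (s - q + 1) \<le> q * s"
    using assms(4) by (simp add: algebra_simps)
  have "?n * (s - p + 1) \<le> ?n * (s - q + 1)" using assms(1) by (intro mult_left_mono) auto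
  also have "\<dots> \<le> q * s" by (rule nq)
  also have "\<dots> \<le> p * s" using assms(1) s0 by (intro mult_right_mono) auto
  finally have np: "?n * (s - p + 1) \<le> p * s" .
  \<comment> \<open>One power \<open>k\<close> of the cutoff must meet the requirement of
    \<open>absorb_power\<close> for both exponents.\<close>
  obtain k :: nat where k0: "max 2 (max (p * s / (s - p + 1)) (q * s / (s - q + 1))) \<le> real k"
    using real_arch_simple by blast
  then have k: "2 \<le> k" "p * s \<le> real k * (s - p + 1)" "q * s \<le> real k * (s - q + 1)"
    using mp mq by (auto simp: divide_le_eq)
  obtain u0 G where [measurable]: "u0 \<in> borel_measurable borel" "G \<in> borel_measurable borel"
    and u0: "\<And>x. 0 \<le> u0 x" and ae: "AE x in lebesgue. u x = u0 x"
    and wu: "has_weak_gradient u G" and w: "has_weak_gradient u0 G"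
    and ls: "locally_integrable (\<lambda>x. u0 x powr s)" and lp: "locally_integrable (\<lambda>x. norm (G x) powr p)"
    using nonneg_weak_solution_representative[OF assms(5)] by blast
  define V where "V = unit_ball_vol ?n * exp ?n"
  define E where "E = (\<lambda>z N. flux_const k s z * real N powr (- ((z - 1) / (2 * (s - z + 1)))))"
  define F where "F = (\<lambda>z N \<delta>. (4 * real k) powr z * (2 * \<delta>) powr (z - 1 - 1 / real N) * measure lborel (cball (0::real^'n) (exp (2 * real N))))"
  \<comment> \<open>The test integral is bounded below on the set where \<open>u0\<close> stays
    between \<open>1 / m\<close> and \<open>m\<close>: there \<open>u0 x powr s\<close> is at least
    \<open>m powr (- s)\<close>, and \<open>u0 x + \<delta> \<le> m + 1\<close> together with
    \<open>1 / N \<le> 1\<close> gives the factor \<open>1 / (m + 1)\<close>. Neither bound depends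
    on \<open>N\<close> or \<open>\<delta>\<close>.\<close>
  have est: "measure lborel {x. bracket x \<le> real m \<and> 1 / real m \<le> u0 x \<and> u0 x \<le> real m} * (real m powr (- s) / (real m + 1))
      \<le> 2 * (E p N * V + F p N \<delta>) + 2 * (E q N * V + F q N \<delta>)"
    if m: "1 \<le> m" and N: "2 \<le> real N * (q - 1)" "real m \<le> exp (real N)" and \<delta>: "0 < \<delta>" "\<delta> < 1" for m N :: nat and \<delta>
  proof -
    let ?S = "{x. bracket x \<le> real m \<and> 1 / real m \<le> u0 x \<and> u0 x \<le> real m}"
    let ?I = "\<lambda>x. u0 x powr s * (log_cutoff N x ^ k * (u0 x + \<delta>) powr (- (1 / real N)))"
    note le = local_estimate[OF assms(5,2,1,3) \<open>u0 \<in> _\<close> \<open>G \<in> _\<close> u0 ae wu w ls lp np nq k N(1) \<delta>(1)]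
    have N0: "1 \<le> real N" "0 < N" using N assms(2) by (cases N; simp)+
    have [measurable]: "?S \<in> sets borel" by measurable
    have "?S \<subseteq> cball 0 (real m)" using norm_le_bracket by (fastforce intro: order_trans)
    then have "bounded ?S" using bounded_subset bounded_cball by blast
    then have fin: "emeasure lborel ?S < \<infinity>" by (rule emeasure_bounded_finite)
    have "measure lborel ?S * (real m powr (- s) / (real m + 1)) = (\<integral>x. (real m powr (- s) / (real m + 1)) * indicat_real ?S x \<partial>lborel)"
      using fin by simp
    also have "\<dots> \<le> (\<integral>x. ?I x \<partial>lborel)"
    proof (intro integral_mono integrable_mult_right integrable_real_indicator fin le(1))
      fix x
      show "(real m powr (- s) / (real m + 1)) * indicat_real ?S x \<le> ?I x"
      proof (cases "x \<in> ?S")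
        case True
        then have x: "bracket x \<le> exp (real N)" "1 / real m \<le> u0 x" "u0 x \<le> real m" using N by auto
        have "real m powr (- s) = (1 / real m) powr s" by (simp add: powr_divide powr_minus_divide)
        also have "\<dots> \<le> u0 x powr s" using x s0 by (intro powr_mono2) auto
        finally have 1: "real m powr (- s) \<le> u0 x powr s" .
        have v: "0 < u0 x + \<delta>" "u0 x + \<delta> \<le> real m + 1" using u0[of x] x \<delta> by auto
        have "1 / (real m + 1) = (real m + 1) powr (- 1)" by (simp add: powr_minus divide_inverse)
        also have "\<dots> \<le> (real m + 1) powr (- (1 / real N))" using N0 by (intro powr_mono) auto
        also have "\<dots> \<le> (u0 x + \<delta>) powr (- (1 / real N))" using v N0 by (intro powr_mono2') auto
        finally have "real m powr (- s) * (1 / (real m + 1)) \<le> u0 x powr s * (u0 x + \<delta>) powr (- (1 / real N))"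
          using 1 by (intro mult_mono) auto
        then show ?thesis using True log_cutoff_eq_1[OF N0(2) x(1)] by simp
      next
        case False
        then show ?thesis using log_cutoff_bounds(1)[of N x] by simp
      qed
    qed measurable
    also have "\<dots> \<le> 2 * (E p N * V + F p N \<delta>) + 2 * (E q N * V + F q N \<delta>)"
      using le(2) unfolding V_def E_def F_def .
    finally show ?thesis .
  qed
  have null: "measure lborel {x. bracket x \<le> real m \<and> 1 / real m \<le> u0 x \<and> u0 x \<le> real m} = 0" if m: "1 \<le> m" for m :: nat
  proof -
    let ?c = "measure lborel {x. bracket x \<le> real m \<and> 1 / real m \<le> u0 x \<and> u0 x \<le> real m} * (real m powr (- s) / (real m + 1))"
    have bigN: "eventually (\<lambda>N. 2 < real N * (q - 1) \<and> real m < exp (real N)) sequentially"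
    proof (intro eventually_conj)
      have "filterlim (\<lambda>N. real N * (q - 1)) at_top sequentially"
        using assms(2) by (intro filterlim_tendsto_pos_mult_at_top[OF tendsto_const _ filterlim_real_sequentially, of "q - 1", simplified mult.commute]) auto
      then show "eventually (\<lambda>N. 2 < real N * (q - 1)) sequentially" by (auto simp: filterlim_at_top_dense)
      have "filterlim (\<lambda>N. exp (real N)) at_top sequentially"
        by (rule filterlim_compose[OF exp_at_top filterlim_real_sequentially])
      then show "eventually (\<lambda>N. real m < exp (real N)) sequentially" by (auto simp: filterlim_at_top_dense)
    qed
    have "eventually (\<lambda>N. ?c \<le> 2 * (E p N * V) + 2 * (E q N * V)) sequentially"
      using bigN
    proof eventually_elim
      case (elim N)
      have N0: "1 \<le> real N" using elim assms(2) by (cases N) auto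
      \<comment> \<open>For fixed \<open>N\<close> the exponent of \<open>\<delta>\<close> is
        positive, because \<open>1 / N < q - 1\<close>. Letting \<open>\<delta>\<close> tend to 0
        first removes the ball volume, which grows exponentially in \<open>N\<close>.\<close>
      have Fz: "((\<lambda>\<delta>. F z N \<delta>) \<longlongrightarrow> 0) (at_right 0)" if "q \<le> z" for z
      proof -
        have e: "0 < z - 1 - 1 / real N"
        proof -
          have "1 / real N < q - 1" using elim N0 assms(2) by (simp add: divide_less_eq mult.commute)
          then show ?thesis using that by simp
        qed
        have "((\<lambda>\<delta>::real. (2 * \<delta>) powr (z - 1 - 1 / real N)) \<longlongrightarrow> 0) (at_right 0)"
          by (rule tendsto_zero_powrI[OF _ tendsto_const _ e]) (auto intro!: tendsto_eq_intros simp: eventually_at_filter)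
        then show ?thesis unfolding F_def by (intro tendsto_mult_left_zero tendsto_mult_right_zero)
      qed
      have lim: "((\<lambda>\<delta>. 2 * (E p N * V + F p N \<delta>) + 2 * (E q N * V + F q N \<delta>)) \<longlongrightarrow>
          2 * (E p N * V + 0) + 2 * (E q N * V + 0)) (at_right 0)"
        using assms(1) by (intro tendsto_intros Fz) auto
      have ev: "eventually (\<lambda>\<delta>. ?c \<le> 2 * (E p N * V + F p N \<delta>) + 2 * (E q N * V + F q N \<delta>)) (at_right 0)"
        using eventually_at_right_real[of 0 1, OF zero_less_one]
      proof eventually_elim
        case (elim \<delta>)
        then show ?case
          using \<open>2 < real N * (q - 1) \<and> real m < exp (real N)\<close> by (intro est m) auto
      qed
      show ?case using tendsto_lowerbound[OF lim ev] by simp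
    qed
    moreover have "(\<lambda>N. 2 * (E p N * V) + 2 * (E q N * V)) \<longlonglongrightarrow> 2 * (0 * V) + 2 * (0 * V)"
    proof (intro tendsto_intros)
      have E0: "(\<lambda>N. E z N) \<longlonglongrightarrow> 0" if "0 < z - 1" "0 < s - z + 1" for z
      proof -
        have "(\<lambda>N. real N powr (- ((z - 1) / (2 * (s - z + 1))))) \<longlonglongrightarrow> 0"
          using that by (intro tendsto_neg_powr filterlim_real_sequentially) auto
        then show ?thesis unfolding E_def by (rule tendsto_mult_right_zero)
      qed
      show "E p \<longlonglongrightarrow> 0" "E q \<longlonglongrightarrow> 0" using assms mp mq by (auto intro!: E0)
    qed
    ultimately have "?c \<le> 2 * (0 * V) + 2 * (0 * V)"
      by (intro tendsto_lowerbound) auto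
    moreover have "0 < real m powr (- s) / (real m + 1)" using m by (intro divide_pos_pos) auto
    ultimately show ?thesis
      using measure_nonneg[of lborel "{x. bracket x \<le> real m \<and> 1 / real m \<le> u0 x \<and> u0 x \<le> real m}"]
      by (smt (verit) mult_pos_pos)
  qed
  \<comment> \<open>Where \<open>u0 x > 0\<close>, some \<open>m\<close> is at least
    \<open>bracket x\<close>, \<open>u0 x\<close> and \<open>1 / u0 x\<close>; hence countably many
    null sets cover the set on which \<open>u0\<close> is positive.\<close>
  have "AE x in lborel. \<forall>m::nat. 1 \<le> m \<longrightarrow> \<not> (bracket x \<le> real m \<and> 1 / real m \<le> u0 x \<and> u0 x \<le> real m)"
  proof (subst AE_all_countable, intro allI)
    fix m :: nat
    show "AE x in lborel. 1 \<le> m \<longrightarrow> \<not> (bracket x \<le> real m \<and> 1 / real m \<le> u0 x \<and> u0 x \<le> real m)"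
    proof (cases "1 \<le> m")
      case True
      let ?S = "{x. bracket x \<le> real m \<and> 1 / real m \<le> u0 x \<and> u0 x \<le> real m}"
      have [measurable]: "?S \<in> sets borel" by measurable
      have "?S \<subseteq> cball 0 (real m)" using norm_le_bracket by (fastforce intro: order_trans)
      then have "bounded ?S" using bounded_subset bounded_cball by blast
      then have fin: "emeasure lborel ?S < \<infinity>" by (rule emeasure_bounded_finite)
      then have "emeasure lborel ?S = ennreal (measure lborel ?S)"
        by (intro emeasure_eq_ennreal_measure) auto
      then have "?S \<in> null_sets lborel" using null[OF True] by (auto intro!: null_setsI)
      then have "AE x in lborel. x \<notin> ?S" by (rule AE_not_in)
      then show ?thesis by eventually_elim simp
    qed simp
  qed
  then have "AE x in lborel. u0 x = 0"
  proof eventually_elim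
    case (elim x)
    show ?case
    proof (rule ccontr)
      assume "u0 x \<noteq> 0"
      then have "0 < u0 x" using u0[of x] by simp
      obtain m :: nat where m: "max 1 (max (bracket x) (max (1 / u0 x) (u0 x))) \<le> real m"
        using real_arch_simple by blast
      then have "1 \<le> m" "bracket x \<le> real m" "u0 x \<le> real m" by auto
      moreover have "1 / real m \<le> u0 x"
      proof -
        have "1 / u0 x \<le> real m" using m by simp
        then have "1 \<le> real m * u0 x" using \<open>0 < u0 x\<close> by (simp add: divide_le_eq)
        then show ?thesis using \<open>1 \<le> m\<close> by (simp add: divide_le_eq mult.commute)
      qed
      ultimately show False using elim by blast
    qed
  qed
  then have "AE x in lebesgue. u0 x = 0" by (rule AE_completion)
  with ae show ?thesis by eventually_elim simp
qed

end
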